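(* Let $p\in(1,\infty)$ and $\gamma$ be a closed planar $p$-elastica. Then $\gamma$ is either a circle or a figure-eight $p$-elastica, possibly multiply covered.
   Context: **$p$-elastica.** For an immersed curve $\gamma\in W^{2,p}(0,1;\mathbb{R}^2)$ (i.e. $\gamma'\ne0$ on $[0,1]$), let $\mathcal{B}_p[\gamma]=\int_\gamma|k|^p\,ds$ ($s$ arclength, $k$ signed curvature) and let $\mathcal{L}[\gamma]$ be the length. The curve $\gamma$ is a $p$-elastica if there is $\lambda\in\mathbb{R}$ such that $\frac{d}{d\varepsilon}\big(\mathcal{B}_p[\gamma+\varepsilon\eta]+\lambda\mathcal{L}[\gamma+\varepsilon\eta]\big)\big|_{\varepsilon=0}=0$ for all $\eta\in C^\infty_{\rm c}(0,1;\mathbb{R}^2)$. It is closed if its arclength parametrization $\tilde\gamma:[0,L]\to\mathbb{R}^2$ satisfies $\tilde\gamma(0)=\tilde\gamma(L)$ and $\tilde\gamma'(0)=\tilde\gamma'(L)$. **$p$-elliptic functions.** For $q\in[0,1)$, $x\in\mathbb{R}$: $$\mathrm{F}_{1,p}(x,q)=\int_0^x\frac{|\cos\theta|^{1-\frac2p}}{\sqrt{1-q^2\sin^2\theta}}\,d\theta,\qquad \mathrm{E}_{1,p}(x,q)=\int_0^x\sqrt{1-q^2\sin^2\theta}\,|\cos\theta|^{1-\frac2p}\,d\theta,$$ $\mathrm{K}_{1,p}(q)=\mathrm{F}_{1,p}(\frac\pi2,q)$, $\mathrm{E}_{1,p}(q)=\mathrm{E}_{1,p}(\frac\pi2,q)$;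 $\mathrm{am}_{1,p}(\cdot,q):\mathbb{R}\to\mathbb{R}$ is the inverse function of $\mathrm{F}_{1,p}(\cdot,q)$, and $\mathrm{cn}_p(x,q)=|\cos\mathrm{am}_{1,p}(x,q)|^{\frac2p-1}\cos\mathrm{am}_{1,p}(x,q)$ (read as $0$ where the cosine vanishes). The wavelike $p$-elastica of modulus $q\in(0,1)$ is the arclength parametrized curve $$\gamma_w(s,q)=\begin{pmatrix}2\mathrm{E}_{1,p}(\mathrm{am}_{1,p}(s,q),q)-s\\ -q\frac p{p-1}|\mathrm{cn}_p(s,q)|^{p-2}\mathrm{cn}_p(s,q)\end{pmatrix},\quad s\in\mathbb{R}.$$ **Figure-eight $p$-elasticae and multiple coverings.** For each $p\in(1,\infty)$ there is a unique solution $q^*=q^*(p)\in(0,1)$ of $2\frac{\mathrm{E}_{1,p}(q)}{\mathrm{K}_{1,p}(q)}-1=0$. A planar curve is a figure-eight $p$-elastica if, up to similarity of $\mathbb{R}^2$ (translation, rotation, reflection, dilation) and reparametrization, it is represented by $s\mapsto\gamma_w(s+s_0,q^* )$ for some $s_0\in\mathbb{R}$. For a positive integer $N$, the $N$-fold closed figure-eight $p$-elastica is the one for which the parameter $s$ ranges over $[0,4N\mathrm{K}_{1,p}(q^* )]$; an $N$-fold circle is a curve represented, up to similarity and reparametrization, by $[0,2N\pi]\ni s\mapsto(\cos(s+s_0),\sin(s+s_0))$ for some $s_0\in\mathbb{R}$. "Possibly multiply covered" means that the circle or the closed figure-eight may be $N$-fold with any positive integer $N$. *)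

theory Defs
  imports "HOL-Analysis.Analysis"
begin

definition nth_vderiv :: "nat \<Rightarrow> (real \<Rightarrow> 'a::real_normed_vector) \<Rightarrow> real \<Rightarrow> 'a" where
  "nth_vderiv n f = ((\<lambda>g t. vector_derivative g (at t)) ^^ n) f"

text \<open>The support is a closed subset of a bounded interval, so it is automatically compact.\<close>

definition test_function :: "(real \<Rightarrow> 'a::real_normed_vector) \<Rightarrow> bool" where
  "test_function \<phi> \<longleftrightarrow>
     (\<forall>n t. nth_vderiv n \<phi> differentiable (at t)) \<and> closure {t. \<phi> t \<noteq> 0} \<subseteq> {0<..<1}"

definition locally_integrable :: "(real \<Rightarrow> 'a::euclidean_space) \<Rightarrow> bool" where
  "locally_integrable f \<longleftrightarrow> (\<forall>K. compact K \<and> K \<subseteq> {0<..<1} \<longrightarrow> integrable (lebesgue_on K) f)"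

definition is_weak_deriv :: "nat \<Rightarrow> (real \<Rightarrow> 'a::euclidean_space) \<Rightarrow> (real \<Rightarrow> 'a) \<Rightarrow> bool" where
  "is_weak_deriv n f g \<longleftrightarrow>
     locally_integrable f \<and> locally_integrable g \<and>
     (\<forall>\<phi> :: real \<Rightarrow> real. test_function \<phi> \<longrightarrow>
        (LINT t|lebesgue_on {0<..<1}. nth_vderiv n \<phi> t *\<^sub>R f t)
        = (-1) ^ n *\<^sub>R (LINT t|lebesgue_on {0<..<1}. \<phi> t *\<^sub>R g t))"

text \<open>Weak derivatives are unique almost everywhere; the choice of representative is immaterial
  because \<open>weak_deriv\<close> is only used under an integral.\<close>

definition weak_deriv :: "nat \<Rightarrow> (real \<Rightarrow> 'a::euclidean_space) \<Rightarrow> real \<Rightarrow> 'a" where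
  "weak_deriv n f = (SOME g. is_weak_deriv n f g)"

definition in_Lp :: "real \<Rightarrow> (real \<Rightarrow> 'a::euclidean_space) \<Rightarrow> bool" where
  "in_Lp p f \<longleftrightarrow> f \<in> borel_measurable (lebesgue_on {0<..<1}) \<and>
     integrable (lebesgue_on {0<..<1}) (\<lambda>t. norm (f t) powr p)"

definition in_Sobolev :: "nat \<Rightarrow> real \<Rightarrow> (real \<Rightarrow> 'a::euclidean_space) \<Rightarrow> bool" where
  "in_Sobolev m p f \<longleftrightarrow> in_Lp p f \<and> (\<forall>n\<le>m. \<exists>g. is_weak_deriv n f g \<and> in_Lp p g)"

text \<open>Curves are functions on \<open>\<real>\<close> of which only the restriction to \<open>[0,1]\<close> matters; one-sided
  derivatives are used at the endpoints.\<close>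

abbreviation velocity :: "(real \<Rightarrow> real^2) \<Rightarrow> real \<Rightarrow> real^2" where
  "velocity \<gamma> t \<equiv> vector_derivative \<gamma> (at t within {0..1})"

text \<open>An element of \<open>W\<^sup>2\<^sup>,\<^sup>p\<close> is identified with its continuous representative on \<open>[0,1]\<close>, which is
  then automatically continuously differentiable there.\<close>

definition immersed_W2p :: "real \<Rightarrow> (real \<Rightarrow> real^2) \<Rightarrow> bool" where
  "immersed_W2p p \<gamma> \<longleftrightarrow>
     in_Sobolev 2 p \<gamma> \<and> continuous_on {0..1} \<gamma> \<and> (\<forall>t\<in>{0..1}. velocity \<gamma> t \<noteq> 0)"

definition curvature :: "(real \<Rightarrow> real^2) \<Rightarrow> real \<Rightarrow> real" where
  "curvature \<gamma> t =
     (velocity \<gamma> t $ 1 * weak_deriv 2 \<gamma> t $ 2 - velocity \<gamma> t $ 2 * weak_deriv 2 \<gamma> t $ 1)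
       / norm (velocity \<gamma> t) ^ 3"

definition arclength :: "(real \<Rightarrow> real^2) \<Rightarrow> real \<Rightarrow> real" where
  "arclength \<gamma> t = (LINT \<tau>|lebesgue_on {0..t}. norm (velocity \<gamma> \<tau>))"

abbreviation curve_length :: "(real \<Rightarrow> real^2) \<Rightarrow> real" where
  "curve_length \<gamma> \<equiv> arclength \<gamma> 1"

definition bending_energy :: "real \<Rightarrow> (real \<Rightarrow> real^2) \<Rightarrow> real" where
  "bending_energy p \<gamma> =
     (LINT t|lebesgue_on {0..1}. \<bar>curvature \<gamma> t\<bar> powr p * norm (velocity \<gamma> t))"

definition p_elastica :: "real \<Rightarrow> (real \<Rightarrow> real^2) \<Rightarrow> bool" where
  "p_elastica p \<gamma> \<longleftrightarrow> immersed_W2p p \<gamma> \<and>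
     (\<exists>\<mu>::real. \<forall>\<eta> :: real \<Rightarrow> real^2. test_function \<eta> \<longrightarrow>
        ((\<lambda>\<epsilon>. bending_energy p (\<lambda>t. \<gamma> t + \<epsilon> *\<^sub>R \<eta> t) + \<mu> * curve_length (\<lambda>t. \<gamma> t + \<epsilon> *\<^sub>R \<eta> t))
          has_real_derivative 0) (at 0))"

definition arclength_param :: "(real \<Rightarrow> real^2) \<Rightarrow> real \<Rightarrow> real^2" where
  "arclength_param \<gamma> s = \<gamma> (the_inv_into {0..1} (arclength \<gamma>) s)"

definition closed_curve :: "(real \<Rightarrow> real^2) \<Rightarrow> bool" where
  "closed_curve \<gamma> \<longleftrightarrow> (let L = curve_length \<gamma>; c = arclength_param \<gamma> in
     c 0 = c L \<and>
     vector_derivative c (at 0 within {0..L}) = vector_derivative c (at L within {0..L}))"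

text \<open>The integrands may be singular at zeros of the cosine, where \<open>powr\<close> returns 0; this is a null
  set, so the (signed) Lebesgue integral has the intended value.\<close>

definition F1 :: "real \<Rightarrow> real \<Rightarrow> real \<Rightarrow> real" where
  "F1 p x q = (LBINT \<theta>=ereal 0..ereal x.
     \<bar>cos \<theta>\<bar> powr (1 - 2 / p) / sqrt (1 - q\<^sup>2 * (sin \<theta>)\<^sup>2))"

definition E1 :: "real \<Rightarrow> real \<Rightarrow> real \<Rightarrow> real" where
  "E1 p x q = (LBINT \<theta>=ereal 0..ereal x.
     sqrt (1 - q\<^sup>2 * (sin \<theta>)\<^sup>2) * \<bar>cos \<theta>\<bar> powr (1 - 2 / p))"

definition K1_complete :: "real \<Rightarrow> real \<Rightarrow> real" where
  "K1_complete p q = F1 p (pi / 2) q"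

definition E1_complete :: "real \<Rightarrow> real \<Rightarrow> real" where
  "E1_complete p q = E1 p (pi / 2) q"

definition am1 :: "real \<Rightarrow> real \<Rightarrow> real \<Rightarrow> real" where
  "am1 p x q = inv (\<lambda>y. F1 p y q) x"

definition cn_p :: "real \<Rightarrow> real \<Rightarrow> real \<Rightarrow> real" where
  "cn_p p x q = \<bar>cos (am1 p x q)\<bar> powr (2 / p - 1) * cos (am1 p x q)"

definition wavelike :: "real \<Rightarrow> real \<Rightarrow> real \<Rightarrow> real^2" where
  "wavelike p q s = vector
     [2 * E1 p (am1 p s q) q - s,
      - q * (p / (p - 1)) * \<bar>cn_p p s q\<bar> powr (p - 2) * cn_p p s q]"

definition q_star :: "real \<Rightarrow> real" where
  "q_star p = (THE q. 0 < q \<and> q < 1 \<and> 2 * (E1_complete p q / K1_complete p q) - 1 = 0)"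

definition similarity :: "(real^2 \<Rightarrow> real^2) \<Rightarrow> bool" where
  "similarity S \<longleftrightarrow>
     (\<exists>r Q b. r > 0 \<and> orthogonal_transformation Q \<and> S = (\<lambda>x. r *\<^sub>R Q x + b))"

text \<open>Reparametrizations are \<open>C\<^sup>1\<close> diffeomorphisms from \<open>[0,1]\<close> onto \<open>[0,T]\<close>, possibly reversing the
  orientation.\<close>

definition reparametrization :: "real \<Rightarrow> (real \<Rightarrow> real) \<Rightarrow> bool" where
  "reparametrization T h \<longleftrightarrow> bij_betw h {0..1} {0..T} \<and>
     (\<exists>h'. continuous_on {0..1} h' \<and>
        (\<forall>t\<in>{0..1}. h' t \<noteq> 0 \<and> (h has_real_derivative h' t) (at t within {0..1})))"

text \<open>Up to similarity and reparametrization, \<open>\<gamma>\<close> is \<open>[0,T] \<ni> s \<mapsto> c (s + s\<^sub>0)\<close> for some \<open>s\<^sub>0\<close>.\<close>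

definition represented_by :: "(real \<Rightarrow> real^2) \<Rightarrow> real \<Rightarrow> (real \<Rightarrow> real^2) \<Rightarrow> bool" where
  "represented_by c T \<gamma> \<longleftrightarrow>
     (\<exists>S h s\<^sub>0. similarity S \<and> reparametrization T h \<and> (\<forall>t\<in>{0..1}. \<gamma> t = S (c (h t + s\<^sub>0))))"

definition N_fold_circle :: "nat \<Rightarrow> (real \<Rightarrow> real^2) \<Rightarrow> bool" where
  "N_fold_circle N \<gamma> \<longleftrightarrow> represented_by (\<lambda>s. vector [cos s, sin s]) (2 * real N * pi) \<gamma>"

definition N_fold_figure_eight :: "real \<Rightarrow> nat \<Rightarrow> (real \<Rightarrow> real^2) \<Rightarrow> bool" where
  "N_fold_figure_eight p N \<gamma> \<longleftrightarrow>
     represented_by (wavelike p (q_star p)) (4 * real N * K1_complete p (q_star p)) \<gamma>"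

end

theory Submission
  imports Defs
begin

text \<open>
  Let \<open>T\<close> be the unit tangent, \<open>N\<close> the unit normal and \<open>w = \<bar>k\<bar> powr (p - 2) * k\<close>. The lemma of
  du Bois-Reymond turns the weak Euler--Lagrange equation into
  \<open>(p w N)' = ((1 - 2 p) \<bar>k\<bar>\<^sup>p + \<mu>) T + c\<close> (derivatives with respect to arclength) for a constant
  vector \<open>c\<close>. Hence \<open>w\<close> is continuously differentiable, and the normal and tangential parts read
  \<open>p w' = c \<bullet> N\<close> and \<open>(p - 1) \<bar>k\<bar>\<^sup>p = \<mu> + c \<bullet> T\<close>.

  If \<open>c = 0\<close>, the curvature is constant and the curve is a circle. Otherwise let \<open>X, x\<close> and \<open>y\<close> be the
  components of the position along \<open>c\<close> and of \<open>T\<close> along and across \<open>c\<close>. If \<open>\<mu> \<le> - \<bar>c\<bar>\<close>, the curve is a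
  segment; if \<open>\<mu> \<ge> \<bar>c\<bar>\<close>, the function \<open>X - sgn k * y / k0\<close> with \<open>(p - 1) k0\<^sup>p = \<mu>\<close> is
  nonincreasing and not constant, so the curve does not close. If \<open>\<bar>\<mu>\<bar> < \<bar>c\<bar>\<close>, an amplitude \<open>a\<close> is defined by
  letting \<open>q sin a\<close> be the sine of half the tangent angle and \<open>cos a\<close> a signed power of \<open>k\<close>.
  Then \<open>F(a, q)\<close> is an affine function of the arclength. This identifies the curve with a wavelike
  elastica without a uniqueness theorem for the curvature equation, which is not Lipschitz.
  Closing up means that \<open>a\<close> increases by a multiple of \<open>2 \<pi>\<close> and that \<open>2 E = K\<close>.
\<close>

section \<open>The fundamental lemma of the calculus of variations\<close>

text \<open>The obstacle is regularity. The parametrization is arbitrary, so the tangential part of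
  the second derivative is merely in L^p. Absolutely continuous functions are therefore carried as a
  function together with an integrable density. The field \<open>p w N\<close> gains a continuous
  derivative because that tangential part cancels in it. The first variation contains second and
  first derivatives of the test function, so integrating the equation brings in two constant
  vectors. One of them is, up to sign, \<open>c\<close>, the conserved vector that belongs to
  translation invariance. The amplitude is dictated by the first integral. With \<theta> the angle
  between tangent and \<open>c\<close>, \<open>l = \<bar>c\<bar>\<close> and
  \<open>q^2 = (\<mu> + l) / (2 l)\<close>, it says that \<open>(p - 1) \<bar>k\<bar>^p\<close>
  equals \<open>2 l (q^2 - sin^2 (\<theta>/2))\<close>. So the signed power \<open>p / 2\<close> of
  \<open>k\<close> and the sine of the half angle move on an ellipse, and \<open>a\<close> is the
  angle on it. At zeros of \<open>k\<close> the integrand of \<open>F\<close> degenerates: for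
  \<open>p < 2\<close> it is unbounded nearby, for \<open>p > 2\<close> it vanishes. There are only
  finitely many zeros, and continuity bridges them.\<close>

lemma sigma_finite_lebesgue: "sigma_finite_measure (lebesgue :: 'a::euclidean_space measure)"
proof -
  obtain A :: "'a set set" where A: "countable A" "A \<subseteq> sets lborel" "\<Union>A = space lborel"
      "\<forall>a\<in>A. emeasure lborel a \<noteq> \<infinity>"
    using sigma_finite_measure.sigma_finite_countable[OF lborel.sigma_finite_measure_axioms]
    by (elim exE conjE) (rule that, assumption+)
  have "A \<subseteq> sets lebesgue" using A(2) by (auto intro: sets_completionI_sets)
  moreover have "\<forall>a\<in>A. emeasure lebesgue a \<noteq> \<infinity>"
  proof
    fix a assume "a \<in> A"
    then have "a \<in> sets lborel" "emeasure lborel a \<noteq> \<infinity>" using A(2,4) by auto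
    then show "emeasure lebesgue a \<noteq> \<infinity>" by simp
  qed
  ultimately show ?thesis
    unfolding sigma_finite_measure_def using A(1,3) by (intro exI[of _ A]) simp
qed

text \<open>Sets over which \<open>f\<close> integrates to zero form a Dynkin system, and the closed
  intervals are an intersection-stable generator of the Borel sets. Lebesgue sets differ from Borel
  sets by null sets, so \<open>density_zero\<close> applies.\<close>

lemma negligible_if_interval_integrals_zero:
  fixes f :: "real \<Rightarrow> 'a::euclidean_space"
  assumes f: "f absolutely_integrable_on {a..b}"
    and zero: "\<And>c d. a \<le> c \<Longrightarrow> c \<le> d \<Longrightarrow> d \<le> b \<Longrightarrow> integral {c..d} f = 0"
  shows "negligible {t\<in>{a..b}. f t \<noteq> 0}"
proof -
  define F where "F = (\<lambda>t. indicator {a..b} t *\<^sub>R f t)"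
  have F: "integrable lebesgue F"
    using f by (simp add: F_def set_integrable_def)
  have int_A: "integrable lebesgue (\<lambda>t. indicator A t *\<^sub>R F t)" if "A \<in> sets lebesgue" for A
    using F that by (rule integrable_mult_indicator[rotated])
  have basic: "(LINT t|lebesgue. indicator {c..d} t *\<^sub>R F t) = 0" for c d
  proof -
    have "(LINT t|lebesgue. indicator {c..d} t *\<^sub>R F t) = (LINT t:{max a c..min b d}|lebesgue. f t)"
      unfolding set_lebesgue_integral_def F_def
      by (intro Bochner_Integration.integral_cong) (auto simp: indicator_def)
    also have "\<dots> = integral {max a c..min b d} f"
      by (intro set_lebesgue_integral_eq_integral(2) set_integrable_subset[OF f]) auto
    also have "\<dots> = 0"
      using zero[of "max a c" "min b d"] by (cases "max a c \<le> min b d") auto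
    finally show ?thesis .
  qed
  \<comment> \<open>Needed for complements in the induction below.\<close>
  have whole: "integral\<^sup>L lebesgue F = 0"
  proof -
    have "F = (\<lambda>t. indicator {a..b} t *\<^sub>R F t)" by (auto simp: F_def indicator_def)
    then show ?thesis using basic[of a b] by simp
  qed
  have borel: "(LINT t|lebesgue. indicator A t *\<^sub>R F t) = 0" if "A \<in> sets borel" for A :: "real set"
  proof -
    have A: "A \<in> sigma_sets UNIV (range (\<lambda>(x,y). {x..y::real}))"
      using that by (simp add: borel_eq_atLeastAtMost)
    have bor: "sigma_sets UNIV (range (\<lambda>(x,y). {x..y::real})) = sets borel"
      by (simp add: borel_eq_atLeastAtMost)
    have leb: "B \<in> sets lebesgue" if "B \<in> sets borel" for B :: "real set" using that by simp
    show ?thesis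
    proof (rule sigma_sets_induct_disjoint[OF _ _ A])
      show "Int_stable (range (\<lambda>(x,y). {x..y::real}))"
      proof (rule Int_stableI)
        fix A B :: "real set"
        assume "A \<in> range (\<lambda>(x,y). {x..y})" "B \<in> range (\<lambda>(x,y). {x..y})"
        then obtain a b c d where "A = {a..b}" "B = {c..d}" by auto
        then have "A \<inter> B = (\<lambda>(x,y). {x..y}) (max a c, min b d)" by auto
        then show "A \<inter> B \<in> range (\<lambda>(x,y). {x..y})" by (rule range_eqI)
      qed
    next
      fix B assume "B \<in> range (\<lambda>(x,y). {x..y::real})"
      then show "(LINT t|lebesgue. indicator B t *\<^sub>R F t) = 0" using basic by auto
    next
      fix B assume B: "B \<in> sigma_sets UNIV (range (\<lambda>(x,y). {x..y::real}))"
        and 0: "(LINT t|lebesgue. indicator B t *\<^sub>R F t) = 0"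
      have "(LINT t|lebesgue. indicator (UNIV - B) t *\<^sub>R F t) = (LINT t|lebesgue. F t - indicator B t *\<^sub>R F t)"
        by (intro Bochner_Integration.integral_cong) (auto simp: indicator_def)
      also have "\<dots> = 0"
        using B 0 whole by (subst Bochner_Integration.integral_diff) (auto intro!: F int_A leb simp: bor)
      finally show "(LINT t|lebesgue. indicator (UNIV - B) t *\<^sub>R F t) = 0" .
    next
      fix B :: "nat \<Rightarrow> real set"
      assume dis: "disjoint_family B" and r: "range B \<subseteq> sigma_sets UNIV (range (\<lambda>(x,y). {x..y::real}))"
        and 0: "\<And>i. (LINT t|lebesgue. indicator (B i) t *\<^sub>R F t) = 0"
      have rr: "\<And>i. B i \<in> sets lebesgue" using r bor by (metis leb range_subsetD)
      have "(LINT t:(\<Union>i. B i)|lebesgue. F t) = (\<Sum>i. LINT t:B i|lebesgue. F t)"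
        using dis rr
        by (intro lebesgue_integral_countable_add)
           (auto simp: disjoint_family_on_def set_integrable_def intro!: int_A)
      then show "(LINT t|lebesgue. indicator (\<Union>i. B i) t *\<^sub>R F t) = 0"
        using 0 by (simp add: set_lebesgue_integral_def)
    qed auto
  qed
  have "AE t in lebesgue. F t = 0"
  proof (rule sigma_finite_measure.density_zero[OF sigma_finite_lebesgue F])
    fix A :: "real set" assume "A \<in> sets lebesgue"
    then obtain B N N' where A: "A = B \<union> N" "N \<subseteq> N'" "N' \<in> null_sets lborel" "B \<in> sets lborel"
      by (auto elim: sets_completionE)
    have "N' \<in> null_sets lebesgue" using A(3) by (rule null_sets_completionI)
    then have ae: "AE t in lebesgue. t \<notin> N'" by (rule AE_not_in)
    have "(LINT t|lebesgue. indicator A t *\<^sub>R F t) = (LINT t|lebesgue. indicator B t *\<^sub>R F t)"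
    proof (rule integral_cong_AE)
      show "(\<lambda>t. indicator A t *\<^sub>R F t) \<in> borel_measurable lebesgue"
        using int_A[OF \<open>A \<in> sets lebesgue\<close>] by auto
      show "(\<lambda>t. indicator B t *\<^sub>R F t) \<in> borel_measurable lebesgue"
        using int_A[of B] A(4) by auto
      show "AE t in lebesgue. indicator A t *\<^sub>R F t = indicator B t *\<^sub>R F t"
        using ae by eventually_elim (use A(1,2) in \<open>auto simp: indicator_def\<close>)
    qed
    then show "set_lebesgue_integral lebesgue A F = 0"
      using borel[of B] A(4) by (simp add: set_lebesgue_integral_def)
  qed
  then have "{t. F t \<noteq> 0} \<in> null_sets lebesgue"
    by (simp add: completion.AE_iff_null_sets)
  moreover have "{t\<in>{a..b}. f t \<noteq> 0} \<subseteq> {t. F t \<noteq> 0}" by (auto simp: F_def)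
  ultimately show ?thesis
    by (meson negligible_iff_null_sets negligible_subset)
qed

section \<open>Smooth functions and bump functions\<close>

definition smooth :: "(real \<Rightarrow> 'a::real_normed_vector) \<Rightarrow> bool" where
  "smooth f \<longleftrightarrow> (\<forall>n t. nth_vderiv n f differentiable (at t))"

lemma nth_vderiv_0 [simp]: "nth_vderiv 0 f = f"
  by (simp add: nth_vderiv_def)

lemma nth_vderiv_Suc: "nth_vderiv (Suc n) f = (\<lambda>t. vector_derivative (nth_vderiv n f) (at t))"
  by (simp add: nth_vderiv_def)

lemma nth_vderiv_add: "nth_vderiv (m + n) f = nth_vderiv m (nth_vderiv n f)"
  by (simp add: nth_vderiv_def funpow_add)

lemma nth_vderiv_1_unique:
  assumes "\<And>t. (f has_vector_derivative g t) (at t)"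
  shows "nth_vderiv 1 f = g"
  using assms by (auto simp: nth_vderiv_Suc vector_derivative_at)

text \<open>An invariant replaces formulas for the higher derivatives: by induction all of them stay
  in \<open>S\<close>.\<close>

lemma smooth_if_closed_under_derivative:
  assumes f: "f \<in> S"
    and S: "\<And>g. g \<in> S \<Longrightarrow> \<exists>h\<in>S. \<forall>t. (g has_vector_derivative h t) (at t)"
  shows "smooth f"
proof -
  have mem: "nth_vderiv n f \<in> S" for n
  proof (induction n)
    case (Suc n)
    then obtain h where h: "h \<in> S" "\<And>t. (nth_vderiv n f has_vector_derivative h t) (at t)"
      using S by blast
    then have "nth_vderiv (Suc n) f = h"
      by (auto simp: nth_vderiv_Suc vector_derivative_at)
    then show ?case using h by simp
  qed (use f in simp)
  have "nth_vderiv n f differentiable (at t)" for n t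
    using S[OF mem] differentiableI_vector by blast
  then show ?thesis by (simp add: smooth_def)
qed

lemma smooth_has_vector_derivative:
  assumes "smooth f"
  shows "(nth_vderiv n f has_vector_derivative nth_vderiv (Suc n) f t) (at t)"
  using assms by (simp add: smooth_def nth_vderiv_Suc vector_derivative_works)

lemma smooth_nth_vderiv: "smooth f \<Longrightarrow> smooth (nth_vderiv n f)"
  by (simp add: smooth_def flip: nth_vderiv_add)

lemma smooth_continuous_on: "smooth f \<Longrightarrow> continuous_on S (nth_vderiv n f)"
  by (meson continuous_at_imp_continuous_on has_vector_derivative_continuous smooth_has_vector_derivative)

lemma smooth_antiderivative:
  assumes "smooth g" "\<And>t. (f has_vector_derivative g t) (at t)"
  shows "smooth f"
proof (rule smooth_if_closed_under_derivative[where S="insert f (range (\<lambda>n. nth_vderiv n g))"])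
  fix h assume "h \<in> insert f (range (\<lambda>n. nth_vderiv n g))"
  then consider "h = f" | n where "h = nth_vderiv n g" by blast
  then show "\<exists>h'\<in>insert f (range (\<lambda>n. nth_vderiv n g)). \<forall>t. (h has_vector_derivative h' t) (at t)"
  proof cases
    case 1
    then show ?thesis using assms(2) by (intro bexI[of _ g]) (auto intro!: range_eqI[of _ _ 0])
  next
    case 2
    then show ?thesis
      using smooth_has_vector_derivative[OF assms(1)] by (intro bexI[of _ "nth_vderiv (Suc n) g"]) auto
  qed
qed simp

lemma nth_vderiv_add_scaled:
  assumes "smooth u" "smooth v"
  shows "nth_vderiv n (\<lambda>t. u t + c *\<^sub>R v t) = (\<lambda>t. nth_vderiv n u t + c *\<^sub>R nth_vderiv n v t)"
proof (induction n)
  case (Suc n)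
  have "((\<lambda>t. nth_vderiv n u t + c *\<^sub>R nth_vderiv n v t) has_vector_derivative
      nth_vderiv (Suc n) u t + c *\<^sub>R nth_vderiv (Suc n) v t) (at t)" for t
    by (intro has_vector_derivative_add
        bounded_linear.has_vector_derivative[OF bounded_linear_scaleR_right]
        smooth_has_vector_derivative assms)
  then show ?case unfolding nth_vderiv_Suc[of n "\<lambda>t. u t + c *\<^sub>R v t"] Suc by (auto intro!: vector_derivative_at)
qed simp

lemma smooth_add_scaled:
  assumes "smooth u" "smooth v"
  shows "smooth (\<lambda>t. u t + c *\<^sub>R v t)"
proof (rule smooth_if_closed_under_derivative
    [where S="range (\<lambda>n t. nth_vderiv n u t + c *\<^sub>R nth_vderiv n v t)"])
  show "(\<lambda>t. u t + c *\<^sub>R v t) \<in> range (\<lambda>n t. nth_vderiv n u t + c *\<^sub>R nth_vderiv n v t)"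
    by (intro range_eqI[of _ _ 0]) simp
next
  fix h assume "h \<in> range (\<lambda>n t. nth_vderiv n u t + c *\<^sub>R nth_vderiv n v t)"
  then obtain n where h: "h = (\<lambda>t. nth_vderiv n u t + c *\<^sub>R nth_vderiv n v t)" by blast
  have "(h has_vector_derivative nth_vderiv (Suc n) u t + c *\<^sub>R nth_vderiv (Suc n) v t) (at t)" for t
    unfolding h
    by (intro has_vector_derivative_add
        bounded_linear.has_vector_derivative[OF bounded_linear_scaleR_right]
        smooth_has_vector_derivative assms)
  then show "\<exists>h'\<in>range (\<lambda>n t. nth_vderiv n u t + c *\<^sub>R nth_vderiv n v t).
      \<forall>t. (h has_vector_derivative h' t) (at t)"
    by (intro bexI[of _ "\<lambda>t. nth_vderiv (Suc n) u t + c *\<^sub>R nth_vderiv (Suc n) v t"]) auto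
qed

lemma nth_vderiv_scaleR_const:
  assumes "smooth u"
  shows "nth_vderiv n (\<lambda>t. u t *\<^sub>R e) = (\<lambda>t. nth_vderiv n u t *\<^sub>R e)"
proof (induction n)
  case (Suc n)
  have "((\<lambda>t. nth_vderiv n u t *\<^sub>R e) has_vector_derivative nth_vderiv (Suc n) u t *\<^sub>R e) (at t)" for t
    by (intro bounded_linear.has_vector_derivative[OF bounded_linear_scaleR_left]
        smooth_has_vector_derivative assms)
  then show ?case unfolding nth_vderiv_Suc[of n "\<lambda>t. u t *\<^sub>R e"] Suc by (auto intro!: vector_derivative_at)
qed simp

lemma smooth_scaleR_const:
  assumes "smooth u"
  shows "smooth (\<lambda>t. u t *\<^sub>R e)"
  unfolding smooth_def nth_vderiv_scaleR_const[OF assms]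
  using differentiableI_vector[OF bounded_linear.has_vector_derivative
      [OF bounded_linear_scaleR_left smooth_has_vector_derivative[OF assms]]]
  by blast

text \<open>\<open>flat 0\<close> is the classical smooth function that vanishes with all its
  derivatives at 0. Dividing by powers of \<open>x\<close> gives a family whose linear span is
  closed under differentiation.\<close>

definition flat :: "nat \<Rightarrow> real \<Rightarrow> real" where
  "flat k x = (if 0 < x then exp (- 1 / x) / x ^ k else 0)"

text \<open>A single term of the exponential series, of order \<open>Suc k\<close>, already bounds
  \<open>exp (1 / x)\<close> from below. Used with \<open>Suc k\<close> in place of
  \<open>k\<close>, the estimate makes the difference quotient of \<open>flat k\<close> at 0 tend to
  0.\<close>

lemma flat_le:
  assumes "0 < x"
  shows "flat k x \<le> fact (Suc k) * x"
proof -
  have pos: "0 < (1 / x) ^ Suc k / fact (Suc k)" using assms by simp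
  have "(1 / x) ^ Suc k / fact (Suc k) \<le> exp (1 / x)"
  proof -
    have "summable (\<lambda>n. (1 / x) ^ n / fact n)"
      using summable_exp[of "1 / x"] by (simp add: field_simps)
    then have "(\<Sum>n\<in>{Suc k}. (1 / x) ^ n / fact n) \<le> (\<Sum>n. (1 / x) ^ n / fact n)"
      using assms by (intro sum_le_suminf) auto
    then show ?thesis by (simp add: exp_def scaleR_conv_of_real field_simps)
  qed
  then have "inverse (exp (1 / x)) \<le> inverse ((1 / x) ^ Suc k / fact (Suc k))"
    using pos by (rule le_imp_inverse_le)
  then have "exp (- 1 / x) \<le> fact (Suc k) * x ^ Suc k"
    by (simp add: exp_minus field_simps)
  then have "exp (- 1 / x) / x ^ k \<le> fact (Suc k) * x ^ Suc k / x ^ k"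
    using assms by (intro divide_right_mono) auto
  then show ?thesis using assms by (simp add: flat_def)
qed

lemma flat_nonneg: "0 \<le> flat k x"
  by (simp add: flat_def)

lemma flat_has_derivative:
  "(flat k has_real_derivative flat (k + 2) x - real k * flat (k + 1) x) (at x)"
proof -
  consider "x < 0" | "x = 0" | "0 < x" by linarith
  then show ?thesis
  proof cases
    case 1
    have "((\<lambda>_. 0) has_real_derivative 0) (at x)" by simp
    then have "(flat k has_real_derivative 0) (at x)"
      by (rule has_field_derivative_transform_within_open[of _ _ _ "{..<0}"])
         (use 1 in \<open>auto simp: flat_def\<close>)
    then show ?thesis using 1 by (simp add: flat_def)
  next
    case 2
    have "((\<lambda>h. (flat k (0 + h) - flat k 0) / h) \<longlongrightarrow> 0) (at 0)"
    proof (rule tendsto_sandwich)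
      show "\<forall>\<^sub>F h in at 0. 0 \<le> (flat k (0 + h) - flat k 0) / h"
        by (intro always_eventually allI) (auto simp: flat_def)
      show "\<forall>\<^sub>F h in at 0. (flat k (0 + h) - flat k 0) / h \<le> fact (Suc (Suc k)) * \<bar>h\<bar>"
      proof (intro always_eventually allI)
        fix h :: real
        show "(flat k (0 + h) - flat k 0) / h \<le> fact (Suc (Suc k)) * \<bar>h\<bar>"
        proof (cases "0 < h")
          case True
          then have "(flat k (0 + h) - flat k 0) / h = flat (Suc k) h"
            by (simp add: flat_def field_simps)
          then show ?thesis using flat_le[OF True, of "Suc k"] True by simp
        next
          case False
          then have e: "(flat k (0 + h) - flat k 0) / h = 0" by (simp add: flat_def)
          show ?thesis unfolding e by simp
        qed
      qed
    qed (auto intro!: tendsto_eq_intros)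
    then show ?thesis using 2 by (simp add: DERIV_def flat_def)
  next
    case 3
    have "((\<lambda>x. exp (- 1 / x) / x ^ k) has_real_derivative
        exp (- 1 / x) / x ^ (k + 2) - real k * (exp (- 1 / x) / x ^ (k + 1))) (at x)"
    proof (cases k)
      case 0
      then show ?thesis using 3
        by (auto intro!: derivative_eq_intros simp: power2_eq_square)
    next
      case (Suc m)
      have "x ^ m = x * x ^ (m - Suc 0) \<or> m = 0" by (cases m) auto
      then show ?thesis using 3 Suc
        by (auto intro!: derivative_eq_intros simp: field_simps power2_eq_square)
    qed
    then have "(flat k has_real_derivative
        exp (- 1 / x) / x ^ (k + 2) - real k * (exp (- 1 / x) / x ^ (k + 1))) (at x)"
      by (rule has_field_derivative_transform_within_open[of _ _ _ "{0<..}"])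
         (use 3 in \<open>auto simp: flat_def\<close>)
    then show ?thesis using 3 by (simp add: flat_def)
  qed
qed

text \<open>Large enough to contain the bump functions and, by the derivative of \<open>flat\<close>
  and the product rule, closed under differentiation.\<close>

inductive_set flat_algebra :: "(real \<Rightarrow> real) set" where
  flat: "(\<lambda>t. flat k (a * t + b)) \<in> flat_algebra"
| const: "(\<lambda>t. c) \<in> flat_algebra"
| add: "f \<in> flat_algebra \<Longrightarrow> g \<in> flat_algebra \<Longrightarrow> (\<lambda>t. f t + g t) \<in> flat_algebra"
| mult: "f \<in> flat_algebra \<Longrightarrow> g \<in> flat_algebra \<Longrightarrow> (\<lambda>t. f t * g t) \<in> flat_algebra"

lemma flat_algebra_smooth:
  assumes "f \<in> flat_algebra"
  shows "smooth f"
proof (rule smooth_if_closed_under_derivative[OF assms])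
  fix g assume "g \<in> flat_algebra"
  then have "\<exists>h\<in>flat_algebra. \<forall>t. (g has_real_derivative h t) (at t)"
  proof induction
    case (flat k a b)
    have 1: "(\<lambda>t. a * (flat (k + 2) (a * t + b) + - real k * flat (k + 1) (a * t + b))) \<in> flat_algebra"
      by (intro flat_algebra.intros)
    have 2: "((\<lambda>t. flat k (a * t + b)) has_real_derivative
        a * (flat (k + 2) (a * t + b) + - real k * flat (k + 1) (a * t + b))) (at t)" for t
    proof -
      have "((\<lambda>t. a * t + b) has_real_derivative a) (at t)"
        by (auto intro!: derivative_eq_intros)
      from DERIV_chain2[OF flat_has_derivative this] show ?thesis
        by (simp add: mult.commute)
    qed
    show ?case by (rule bexI[OF _ 1]) (use 2 in blast)
  next
    case (const c)
    have "(\<lambda>t. 0) \<in> flat_algebra" by (rule flat_algebra.const)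
    then show ?case by (rule bexI[rotated]) simp
  next
    case (add f g)
    then obtain f' g' where d: "f' \<in> flat_algebra" "g' \<in> flat_algebra"
      "\<And>t. (f has_real_derivative f' t) (at t)" "\<And>t. (g has_real_derivative g' t) (at t)" by blast
    show ?case by (rule bexI[OF _ flat_algebra.add[OF d(1,2)]]) (auto intro: DERIV_add d)
  next
    case (mult f g)
    then obtain f' g' where d: "f' \<in> flat_algebra" "g' \<in> flat_algebra"
      "\<And>t. (f has_real_derivative f' t) (at t)" "\<And>t. (g has_real_derivative g' t) (at t)" by blast
    have "(\<lambda>t. f' t * g t + g' t * f t) \<in> flat_algebra"
      using mult d by (intro flat_algebra.intros)
    then show ?case by (rule bexI[rotated]) (auto intro!: DERIV_mult d)
  qed
  then show "\<exists>h\<in>flat_algebra. \<forall>t. (g has_vector_derivative h t) (at t)"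
    by (simp add: has_real_derivative_iff_has_vector_derivative)
qed

text \<open>The factor \<open>n\<close> steepens both flanks: as \<open>n\<close> grows, each factor
  tends to 1 on the open interval. So the bumps approximate its indicator, with values in
  \<open>{0..1}\<close> throughout.\<close>

definition bump :: "real \<Rightarrow> real \<Rightarrow> nat \<Rightarrow> real \<Rightarrow> real" where
  "bump c d n t = flat 0 (real n * (t - c)) * flat 0 (real n * (d - t))"

lemma bump_nonneg: "0 \<le> bump c d n t"
  by (simp add: bump_def flat_nonneg)

lemma flat_0_le_1: "flat 0 x \<le> 1"
  by (simp add: flat_def)

lemma bump_le_1: "bump c d n t \<le> 1"
  unfolding bump_def using mult_le_one[OF flat_0_le_1 flat_nonneg flat_0_le_1] by simp

lemma bump_eq_0: "t \<notin> {c<..<d} \<Longrightarrow> bump c d n t = 0"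
  by (auto simp: bump_def flat_def zero_less_mult_iff)

lemma bump_pos: "0 < n \<Longrightarrow> t \<in> {c<..<d} \<Longrightarrow> 0 < bump c d n t"
  by (auto simp: bump_def flat_def)

lemma smooth_bump: "smooth (bump c d n)"
proof -
  have "bump c d n = (\<lambda>t. flat 0 (real n * t + - real n * c) * flat 0 (- real n * t + real n * d))"
    by (auto simp: bump_def fun_eq_iff algebra_simps)
  also have "\<dots> \<in> flat_algebra" by (intro flat_algebra.intros)
  finally show ?thesis by (rule flat_algebra_smooth)
qed

lemma test_function_bump:
  assumes "0 < c" "d < 1"
  shows "test_function (bump c d n)"
proof -
  have "t \<in> {c..d}" if "bump c d n t \<noteq> 0" for t
  proof -
    have "t \<in> {c<..<d}" using bump_eq_0[of t c d n] that by blast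
    then show ?thesis by auto
  qed
  then have "{t. bump c d n t \<noteq> 0} \<subseteq> {c..d}" by blast
  then have "closure {t. bump c d n t \<noteq> 0} \<subseteq> {c..d}" by (rule closure_minimal) simp
  then show ?thesis using smooth_bump[of c d n] assms
    by (fastforce simp: test_function_def smooth_def)
qed

lemma bump_tendsto:
  "(\<lambda>n. bump c d n t) \<longlonglongrightarrow> indicator {c<..<d} t"
proof (cases "t \<in> {c<..<d}")
  case True
  have 1: "(\<lambda>n. exp (- 1 / (real n * x))) \<longlonglongrightarrow> 1" if "0 < x" for x
  proof -
    have "(\<lambda>n. - 1 / x * inverse (real n)) \<longlonglongrightarrow> - 1 / x * 0"
      by (intro tendsto_mult tendsto_const lim_inverse_n)
    then have "(\<lambda>n. exp (- 1 / x * inverse (real n))) \<longlonglongrightarrow> exp 0"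
      by (intro tendsto_exp) simp
    then show ?thesis by (simp add: field_simps)
  qed
  have "(\<lambda>n. exp (- 1 / (real n * (t - c))) * exp (- 1 / (real n * (d - t)))) \<longlonglongrightarrow> 1 * 1"
    using True by (intro tendsto_mult 1) auto
  moreover have "\<forall>\<^sub>F n in sequentially. exp (- 1 / (real n * (t - c))) * exp (- 1 / (real n * (d - t))) = bump c d n t"
    using eventually_gt_at_top[of 0] by eventually_elim (use True in \<open>auto simp: bump_def flat_def\<close>)
  ultimately have "(\<lambda>n. bump c d n t) \<longlonglongrightarrow> 1 * 1" by (rule Lim_transform_eventually)
  then show ?thesis using True by simp
next
  case False
  then show ?thesis by (simp add: bump_eq_0)
qed

section \<open>Operations on test functions, and the fundamental lemma\<close>

lemma test_function_iff_smooth: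
  "test_function \<phi> \<longleftrightarrow> smooth \<phi> \<and> closure {t. \<phi> t \<noteq> 0} \<subseteq> {0<..<1}"
  by (auto simp: test_function_def smooth_def)

lemma test_function_smooth: "test_function \<phi> \<Longrightarrow> smooth \<phi>"
  by (simp add: test_function_iff_smooth)

lemma test_function_eq_0:
  assumes "test_function \<phi>" "t \<notin> {0<..<1}"
  shows "\<phi> t = 0"
  using assms closure_subset[of "{t. \<phi> t \<noteq> 0}"] by (auto simp: test_function_def)

text \<open>The complement of the support is open, so vanishing there passes to the next
  derivative.\<close>

lemma nth_vderiv_eq_0_off_support:
  assumes "smooth \<phi>" "t \<notin> closure {t. \<phi> t \<noteq> 0}"
  shows "nth_vderiv n \<phi> t = 0"
proof -
  have "\<forall>t\<in>- closure {t. \<phi> t \<noteq> 0}. nth_vderiv n \<phi> t = 0"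
  proof (induction n)
    case 0
    then show ?case using closure_subset[of "{t. \<phi> t \<noteq> 0}"] by auto
  next
    case (Suc n)
    show ?case
    proof
      fix t assume t: "t \<in> - closure {t. \<phi> t \<noteq> 0}"
      have "((\<lambda>_. 0) has_vector_derivative 0) (at t)" by simp
      then have "(nth_vderiv n \<phi> has_vector_derivative 0) (at t)"
        by (rule has_vector_derivative_transform_within_open[OF _ _ t]) (use Suc in auto)
      then show "nth_vderiv (Suc n) \<phi> t = 0"
        by (simp add: nth_vderiv_Suc vector_derivative_at)
    qed
  qed
  then show ?thesis using assms(2) by blast
qed

lemma test_function_nth_vderiv:
  assumes "test_function \<phi>"
  shows "test_function (nth_vderiv n \<phi>)"
proof -
  have "{t. nth_vderiv n \<phi> t \<noteq> 0} \<subseteq> closure {t. \<phi> t \<noteq> 0}"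
    using nth_vderiv_eq_0_off_support[OF test_function_smooth[OF assms]] by blast
  then have "closure {t. nth_vderiv n \<phi> t \<noteq> 0} \<subseteq> closure {t. \<phi> t \<noteq> 0}"
    by (simp add: closure_minimal)
  then show ?thesis
    using assms smooth_nth_vderiv[of \<phi> n] by (auto simp: test_function_iff_smooth)
qed

lemma test_function_support:
  assumes "test_function \<phi>"
  obtains a b where "0 < a" "a < b" "b < 1" "\<And>t. t \<notin> {a..b} \<Longrightarrow> \<phi> t = 0"
proof -
  \<comment> \<open>The point 1/2 keeps the set nonempty for the zero function.\<close>
  let ?S = "insert (1/2) (closure {t. \<phi> t \<noteq> 0})"
  have S: "?S \<subseteq> {0<..<1}" using assms by (auto simp: test_function_def)
  have "bounded (closure {t. \<phi> t \<noteq> 0})"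
    using assms bounded_subset[of "{0<..<1::real}"] by (auto simp: test_function_def)
  then have "compact ?S" by (simp add: compact_eq_bounded_closed)
  then obtain a b where ab: "a \<in> ?S" "b \<in> ?S" "\<And>t. t \<in> ?S \<Longrightarrow> a \<le> t \<and> t \<le> b"
    using compact_attains_inf[of ?S] compact_attains_sup[of ?S] by blast
  have "t \<in> {a..b}" if "\<phi> t \<noteq> 0" for t
    using ab(3)[of t] that closure_subset[of "{t. \<phi> t \<noteq> 0}"] by auto
  then have z: "t \<notin> {a..b} \<Longrightarrow> \<phi> t = 0" for t by blast
  have 01: "0 < a" "b < 1" "a \<le> b" using S ab by (auto simp: subset_iff)
  show ?thesis
  \<comment> \<open>Enlarging the interval towards 0 and 1 makes \<open>a < b\<close> strict even if
    the extreme points coincide.\<close>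
  proof (rule that[of "a/2" "(b+1)/2"])
    show "\<phi> t = 0" if "t \<notin> {a/2..(b+1)/2}" for t
      using that 01 by (intro z) auto
  qed (use 01 in auto)
qed

lemma test_function_if_support:
  assumes "smooth \<phi>" "0 < a" "b < 1" "\<And>t. t \<notin> {a..b} \<Longrightarrow> \<phi> t = 0"
  shows "test_function \<phi>"
proof -
  have "{t. \<phi> t \<noteq> 0} \<subseteq> {a..b}" using assms(4) by blast
  then have "closure {t. \<phi> t \<noteq> 0} \<subseteq> {a..b}" by (rule closure_minimal) simp
  then show ?thesis using assms(1-3) by (fastforce simp: test_function_iff_smooth)
qed

lemma test_function_add_scaled:
  assumes "test_function u" "test_function v"
  shows "test_function (\<lambda>t. u t + c *\<^sub>R v t)"
proof -
  obtain a b where u: "0 < a" "a < b" "b < 1" "\<And>t. t \<notin> {a..b} \<Longrightarrow> u t = 0"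
    using test_function_support[OF assms(1)] by blast
  obtain a' b' where v: "0 < a'" "a' < b'" "b' < 1" "\<And>t. t \<notin> {a'..b'} \<Longrightarrow> v t = 0"
    using test_function_support[OF assms(2)] by blast
  show ?thesis
  proof (rule test_function_if_support[of _ "min a a'" "max b b'"])
    show "smooth (\<lambda>t. u t + c *\<^sub>R v t)"
      by (intro smooth_add_scaled test_function_smooth assms)
    show "u t + c *\<^sub>R v t = 0" if "t \<notin> {min a a'..max b b'}" for t
    proof -
      have "t \<notin> {a..b}" "t \<notin> {a'..b'}" using that by auto
      then show ?thesis using u(4) v(4) by simp
    qed
  qed (use u v in auto)
qed

lemma test_function_scaleR_const:
  assumes "test_function u"
  shows "test_function (\<lambda>t. u t *\<^sub>R e)"
proof -
  obtain a b where u: "0 < a" "a < b" "b < 1" "\<And>t. t \<notin> {a..b} \<Longrightarrow> u t = 0"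
    using test_function_support[OF assms] by blast
  show ?thesis
    by (rule test_function_if_support[of _ a b])
       (use u in \<open>auto intro!: smooth_scaleR_const test_function_smooth[OF assms]\<close>)
qed

text \<open>To the right of the support the primitive equals the total integral, which is 0; so it
  again has compact support in the open interval.\<close>

lemma test_function_antiderivative:
  fixes \<phi> :: "real \<Rightarrow> real"
  assumes \<phi>: "test_function \<phi>" and 0: "integral {0..1} \<phi> = 0"
  obtains \<psi> where "test_function \<psi>" "nth_vderiv 1 \<psi> = \<phi>"
proof -
  obtain a b where ab: "0 < a" "a < b" "b < 1" "\<And>t. t \<notin> {a..b} \<Longrightarrow> \<phi> t = 0"
    using test_function_support[OF \<phi>] by blast
  have cont: "continuous_on S \<phi>" for S
    using smooth_continuous_on[OF test_function_smooth[OF \<phi>], of S 0] by simp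
  define \<psi> where "\<psi> = (\<lambda>t. integral {0..t} \<phi>)"
  \<comment> \<open>\<open>integral {0..t}\<close> is 0 by convention for negative \<open>t\<close>.
    Since \<open>\<phi>\<close> vanishes left of 0, the base point can be moved to
    \<open>- M\<close>, which makes \<open>t\<close> an interior point for the fundamental
    theorem.\<close>
  have shift: "\<psi> t = integral {-M..t} \<phi>" if "0 \<le> M" "-M \<le> t" for M t
  proof (cases "0 \<le> t")
    case True
    have z: "integral {-M..0} \<phi> = 0"
      by (rule integral_unique[OF has_integral_is_0]) (use ab in auto)
    have "integral {-M..0} \<phi> + integral {0..t} \<phi> = integral {-M..t} \<phi>"
      by (rule Henstock_Kurzweil_Integration.integral_combine)
         (use True that in \<open>auto intro!: integrable_continuous_interval cont\<close>)
    then show ?thesis using z by (simp add: \<psi>_def)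
  next
    case False
    have "integral {-M..t} \<phi> = 0"
      by (rule integral_unique[OF has_integral_is_0]) (use ab False in auto)
    then show ?thesis using False by (simp add: \<psi>_def)
  qed
  have deriv: "(\<psi> has_vector_derivative \<phi> t) (at t)" for t
  proof -
    define M where "M = \<bar>t\<bar> + 1"
    have t: "t \<in> {-M<..<M}" by (auto simp: M_def)
    have "((\<lambda>u. integral {-M..u} \<phi>) has_vector_derivative \<phi> t) (at t within {-M..M})"
      by (rule integral_has_vector_derivative) (use t in \<open>auto intro!: cont\<close>)
    then have "((\<lambda>u. integral {-M..u} \<phi>) has_vector_derivative \<phi> t) (at t within {-M<..<M})"
      by (rule has_vector_derivative_within_subset) auto
    then have "((\<lambda>u. integral {-M..u} \<phi>) has_vector_derivative \<phi> t) (at t)"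
      using t by (simp add: at_within_open[OF t])
    then show ?thesis
      by (rule has_vector_derivative_transform_within_open[OF _ _ t])
         (use shift[of M] in \<open>auto simp: M_def\<close>)
  qed
  have "smooth \<psi>" using smooth_antiderivative[OF test_function_smooth[OF \<phi>] deriv] .
  moreover have "\<psi> t = 0" if t: "t \<notin> {a..b}" for t
  proof (cases "t < a")
    case True
    then show ?thesis unfolding \<psi>_def
      by (intro integral_unique[OF has_integral_is_0]) (use ab in auto)
  next
    case False
    then have bt: "b < t" using t by simp
    \<comment> \<open>The support bound says nothing about the point \<open>b\<close> itself, hence
      the spike there.\<close>
    have z: "integral {b..s} \<phi> = 0" if "b < s" for s
    proof (rule integral_unique, rule has_integral_spike_finite[of "{b}" _ _ "\<lambda>_. 0"])
      show "\<And>x. x \<in> {b..s} - {b} \<Longrightarrow> \<phi> x = 0" using ab by auto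
    qed auto
    have "integral {0..b} \<phi> + integral {b..s} \<phi> = integral {0..s} \<phi>" if "b < s" for s
      by (rule Henstock_Kurzweil_Integration.integral_combine)
         (use ab that in \<open>auto intro!: integrable_continuous_interval cont\<close>)
    from this[of t] this[of 1] show ?thesis
      using z[of t] z[of 1] bt ab(3) 0 by (simp add: \<psi>_def)
  qed
  ultimately have "test_function \<psi>"
    by (intro test_function_if_support[of \<psi> a b]) (use ab in auto)
  then show ?thesis using nth_vderiv_1_unique[OF deriv] by (rule that)
qed

lemma locally_integrable_times_test_function:
  fixes f :: "real \<Rightarrow> 'a::euclidean_space"
  assumes f: "locally_integrable f" and \<phi>: "test_function \<phi>"
  shows "(\<lambda>t. \<phi> t *\<^sub>R f t) absolutely_integrable_on {0<..<1}"
proof -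
  obtain a b where ab: "0 < a" "a < b" "b < 1" "\<And>t. t \<notin> {a..b} \<Longrightarrow> \<phi> t = 0"
    using test_function_support[OF \<phi>] by blast
  have cont: "continuous_on S \<phi>" for S
    using smooth_continuous_on[OF test_function_smooth[OF \<phi>], of S 0] by simp
  have "integrable (lebesgue_on {a..b}) f"
  proof -
    have "{a..b} \<subseteq> {0<..<1}" using ab by auto
    then show ?thesis using f by (simp add: locally_integrable_def)
  qed
  then have "f absolutely_integrable_on {a..b}"
    by (simp add: integrable_restrict_space set_integrable_def)
  then have "(\<lambda>t. \<phi> t *\<^sub>R f t) absolutely_integrable_on {a..b}"
    by (intro absolutely_integrable_bounded_measurable_product[where h=scaleR])
       (auto simp: bilinear_conv_bounded_bilinear intro!: bounded_bilinear_scaleR continuous_imp_measurable_on_sets_lebesgue cont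
          compact_imp_bounded compact_continuous_image)
  then have "(\<lambda>t. if t \<in> {a..b} then \<phi> t *\<^sub>R f t else 0) absolutely_integrable_on UNIV"
    by (subst absolutely_integrable_restrict_UNIV)
  moreover have "(\<lambda>t. if t \<in> {a..b} then \<phi> t *\<^sub>R f t else 0) = (\<lambda>t. \<phi> t *\<^sub>R f t)"
    using ab(4) by auto
  ultimately have "(\<lambda>t. \<phi> t *\<^sub>R f t) absolutely_integrable_on UNIV" by simp
  then show ?thesis by (rule set_integrable_subset) auto
qed

text \<open>Bump functions of growing steepness turn the hypothesis, by dominated convergence, into
  vanishing integrals over all intervals compactly inside the unit interval; these determine
  \<open>f\<close> almost everywhere.\<close>

lemma fundamental_lemma:
  fixes f :: "real \<Rightarrow> 'a::euclidean_space"
  assumes f: "locally_integrable f"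
    and 0: "\<And>\<phi> :: real \<Rightarrow> real. test_function \<phi> \<Longrightarrow> (LINT t|lebesgue_on {0<..<1}. \<phi> t *\<^sub>R f t) = 0"
  shows "negligible {t\<in>{0<..<1}. f t \<noteq> 0}"
proof -
  have absint: "f absolutely_integrable_on {a..b}" if "0 < a" "b < 1" for a b
  proof -
    have "integrable (lebesgue_on {a..b}) f"
    proof -
      have "{a..b} \<subseteq> {0<..<1}" using that by auto
      then show ?thesis using f by (simp add: locally_integrable_def)
    qed
    then show ?thesis by (simp add: integrable_restrict_space set_integrable_def)
  qed
  have zero: "integral {c..d} f = 0" if "0 < c" "c \<le> d" "d < 1" for c d
  proof -
    have bz: "(LINT t|lebesgue. indicator {c..d} t *\<^sub>R (bump c d n t *\<^sub>R f t)) = 0" for n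
    proof -
      have "(LINT t|lebesgue. indicator {c..d} t *\<^sub>R (bump c d n t *\<^sub>R f t))
          = (LINT t|lebesgue. indicator {0<..<1} t *\<^sub>R (bump c d n t *\<^sub>R f t))"
        using that by (intro Bochner_Integration.integral_cong)
          (auto simp: indicator_def intro!: bump_eq_0)
      also have "\<dots> = (LINT t|lebesgue_on {0<..<1}. bump c d n t *\<^sub>R f t)"
        by (simp add: integral_restrict_space)
      finally show ?thesis using 0[OF test_function_bump, of c d] that by simp
    qed
    have int: "integrable lebesgue (\<lambda>t. indicator {c..d} t *\<^sub>R f t)"
      using absint[of c d] that by (simp add: set_integrable_def)
    have "(\<lambda>n. LINT t|lebesgue. indicator {c..d} t *\<^sub>R (bump c d n t *\<^sub>R f t))
        \<longlonglongrightarrow> (LINT t|lebesgue. indicator {c<..<d} t *\<^sub>R f t)"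
    proof (rule integral_dominated_convergence[where w="\<lambda>t. norm (indicator {c..d} t *\<^sub>R f t)"])
      have "f absolutely_integrable_on {c<..<d}"
        by (rule set_integrable_subset[OF absint[of c d]]) (use that in auto)
      then show "(\<lambda>t. indicator {c<..<d} t *\<^sub>R f t) \<in> borel_measurable lebesgue"
        by (auto simp: set_integrable_def)
      fix n
      have "(\<lambda>t. bump c d n t *\<^sub>R (indicator {c..d} t *\<^sub>R f t)) \<in> borel_measurable lebesgue"
        using smooth_continuous_on[OF smooth_bump, of UNIV 0 c d n]
        by (intro borel_measurable_scaleR[OF _ borel_measurable_integrable[OF int]]
            measurable_completion) (simp add: borel_measurable_continuous_onI)
      then show "(\<lambda>t. indicator {c..d} t *\<^sub>R (bump c d n t *\<^sub>R f t)) \<in> borel_measurable lebesgue"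
        by (simp add: mult.commute)
      show "AE t in lebesgue. norm (indicator {c..d} t *\<^sub>R (bump c d n t *\<^sub>R f t))
          \<le> norm (indicator {c..d} t *\<^sub>R f t)"
        using bump_nonneg[of c d n] bump_le_1[of c d n]
        by (intro always_eventually allI) (auto simp: indicator_def intro!: mult_left_le_one_le)
    next
      show "AE t in lebesgue. (\<lambda>n. indicator {c..d} t *\<^sub>R (bump c d n t *\<^sub>R f t))
          \<longlonglongrightarrow> indicator {c<..<d} t *\<^sub>R f t"
      proof (intro always_eventually allI)
        fix t
        have "(\<lambda>n. indicator {c..d} t *\<^sub>R (bump c d n t *\<^sub>R f t))
            \<longlonglongrightarrow> indicator {c..d} t *\<^sub>R (indicator {c<..<d} t *\<^sub>R f t)"
          by (intro tendsto_intros bump_tendsto)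
        then show "(\<lambda>n. indicator {c..d} t *\<^sub>R (bump c d n t *\<^sub>R f t)) \<longlonglongrightarrow> indicator {c<..<d} t *\<^sub>R f t"
          by (auto simp: indicator_def split: if_splits)
      qed
    qed (rule integrable_norm[OF int])
    then have "(LINT t|lebesgue. indicator {c<..<d} t *\<^sub>R f t) = 0"
      unfolding bz by (simp add: LIMSEQ_const_iff)
    then have "(LINT t:{c<..<d}|lebesgue. f t) = 0" by (simp add: set_lebesgue_integral_def)
    then have "integral {c<..<d} f = 0"
    proof -
      have "f absolutely_integrable_on {c<..<d}"
        by (rule set_integrable_subset[OF absint[of c d]]) (use that in auto)
      then show ?thesis
        using set_lebesgue_integral_eq_integral(2)[of "{c<..<d}" f] \<open>(LINT t:{c<..<d}|lebesgue. f t) = 0\<close>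
        by simp
    qed
    then show ?thesis by (simp add: integral_open_interval_real)
  qed
  \<comment> \<open>Compact intervals exhausting the open one; the shift by 2 keeps the left end at
    most 1/2, so that none is empty.\<close>
  define I where "I n = {1 / real (n + 2)..1 - 1 / real (n + 2)}" for n :: nat
  have "negligible {t\<in>I n. f t \<noteq> 0}" for n
  proof -
    have n: "0 < 1 / real (n + 2)" by simp
    show ?thesis
      unfolding I_def
    proof (rule negligible_if_interval_integrals_zero)
      show "f absolutely_integrable_on {1 / real (n + 2)..1 - 1 / real (n + 2)}"
        by (rule absint) (use n in linarith)+
      show "integral {c..d} f = 0"
        if "1 / real (n + 2) \<le> c" "c \<le> d" "d \<le> 1 - 1 / real (n + 2)" for c d
        by (rule zero) (use n that in linarith)+
    qed
  qed
  then have "negligible (\<Union>n. {t\<in>I n. f t \<noteq> 0})" by (rule negligible_Union_nat)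
  moreover have "{t\<in>{0<..<1}. f t \<noteq> 0} \<subseteq> (\<Union>n. {t\<in>I n. f t \<noteq> 0})"
  proof clarsimp
    fix t :: real assume t: "0 < t" "t < 1"
    obtain n :: nat where n: "1 / min t (1 - t) < real n" using reals_Archimedean2 by blast
    then have "1 / real (n + 2) < min t (1 - t)"
      using t by (simp add: field_simps min_def split: if_splits)
    then show "\<exists>n. t \<in> I n" by (intro exI[of _ n]) (auto simp: I_def)
  qed
  ultimately show ?thesis by (rule negligible_subset)
qed

section \<open>Primitives of integrable functions\<close>

text \<open>With \<open>\<Gamma>\<close> as the new parameter, the hypothesis says that the derivative of \<open>f\<close> vanishes.\<close>

lemma constant_if_small_relative_to_monotone:
  fixes f :: "real \<Rightarrow> 'a::banach" and \<Gamma> :: "real \<Rightarrow> real"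
  assumes cont: "continuous_on {a..b} \<Gamma>" and mono: "strict_mono_on {a..b} \<Gamma>"
    and small: "\<And>t e. t \<in> {a..b} \<Longrightarrow> 0 < e \<Longrightarrow>
      \<exists>d>0. \<forall>s\<in>{a..b}. \<bar>s - t\<bar> < d \<longrightarrow> norm (f s - f t) \<le> e * \<bar>\<Gamma> s - \<Gamma> t\<bar>"
    and t: "t \<in> {a..b}"
  shows "f t = f a"
proof -
  have inj: "inj_on \<Gamma> {a..b}" using mono by (rule strict_mono_on_imp_inj_on)
  define g where "g = the_inv_into {a..b} \<Gamma>"
  have g\<Gamma>: "g (\<Gamma> s) = s" if "s \<in> {a..b}" for s
    using the_inv_into_f_f[OF inj that] by (simp add: g_def)
  \<comment> \<open>Continuity of the inverse translates closeness of values of \<Gamma> into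
    closeness of parameters, where \<open>small\<close> applies.\<close>
  have contg: "continuous_on (\<Gamma> ` {a..b}) g"
    using cont g\<Gamma> by (intro continuous_on_inv) auto
  have "convex (\<Gamma> ` {a..b})"
    by (metis cont connected_Icc connected_continuous_image is_interval_connected_1 is_interval_convex_1)
  moreover have "((f \<circ> g) has_derivative (\<lambda>_. 0)) (at y within \<Gamma> ` {a..b})" if y: "y \<in> \<Gamma> ` {a..b}" for y
    unfolding has_derivative_within_alt
  proof (intro conjI allI impI bounded_linear_zero)
    fix e :: real assume e: "0 < e"
    obtain t where ty: "t \<in> {a..b}" "y = \<Gamma> t" using y by blast
    obtain d where d: "0 < d" "\<And>s. s \<in> {a..b} \<Longrightarrow> \<bar>s - t\<bar> < d \<Longrightarrow> norm (f s - f t) \<le> e * \<bar>\<Gamma> s - \<Gamma> t\<bar>"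
      using small[OF ty(1) e] by blast
    obtain d' where d': "0 < d'" "\<And>z. z \<in> \<Gamma> ` {a..b} \<Longrightarrow> dist z y < d' \<Longrightarrow> dist (g z) (g y) < d"
      using contg y d(1) unfolding continuous_on_iff by blast
    show "\<exists>d>0. \<forall>z\<in>\<Gamma> ` {a..b}. norm (z - y) < d \<longrightarrow> norm ((f \<circ> g) z - (f \<circ> g) y - 0) \<le> e * norm (z - y)"
    proof (intro exI[of _ d'] conjI ballI impI d'(1))
      fix z assume z: "z \<in> \<Gamma> ` {a..b}" "norm (z - y) < d'"
      then obtain s where s: "s \<in> {a..b}" "z = \<Gamma> s" by blast
      have "\<bar>s - t\<bar> < d"
        using d'(2)[OF z(1)] z(2) s ty by (simp add: dist_norm g\<Gamma>)
      from d(2)[OF s(1) this] show "norm ((f \<circ> g) z - (f \<circ> g) y - 0) \<le> e * norm (z - y)"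
        using s ty by (simp add: g\<Gamma>)
    qed
  qed
  ultimately obtain c where c: "\<And>y. y \<in> \<Gamma> ` {a..b} \<Longrightarrow> (f \<circ> g) y = c"
    using has_derivative_zero_constant[of "\<Gamma> ` {a..b}" "f \<circ> g"] by blast
  have "a \<in> {a..b}" using t by auto
  then show ?thesis
    using c[of "\<Gamma> t"] c[of "\<Gamma> a"] t by (simp add: g\<Gamma>)
qed

text \<open>Absolute continuity of \<open>f\<close> with density \<open>g\<close>, expressed by
  integrals only. On an interval this is the one-dimensional form of having the integrable weak
  derivative \<open>g\<close>.\<close>

definition primitive_on :: "real set \<Rightarrow> (real \<Rightarrow> 'a::euclidean_space) \<Rightarrow> (real \<Rightarrow> 'a) \<Rightarrow> bool" where
  "primitive_on I f g \<longleftrightarrow> g absolutely_integrable_on I \<and>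
     (\<forall>x\<in>I. \<forall>y\<in>I. x \<le> y \<longrightarrow> f y - f x = integral {x..y} g)"

lemma primitive_onD:
  assumes "primitive_on I f g"
  shows "g absolutely_integrable_on I"
    and "x \<in> I \<Longrightarrow> y \<in> I \<Longrightarrow> x \<le> y \<Longrightarrow> f y - f x = integral {x..y} g"
  using assms unfolding primitive_on_def by blast+

lemma primitive_on_integral:
  assumes "g absolutely_integrable_on {a..b}"
  shows "primitive_on {a..b} (\<lambda>t. v + integral {a..t} g) g"
  unfolding primitive_on_def
proof (intro conjI ballI impI assms)
  fix x y assume xy: "x \<in> {a..b}" "y \<in> {a..b}" "x \<le> y"
  have "g integrable_on {a..b}" using assms absolutely_integrable_on_def by blast
  then have "g integrable_on {a..y}"
    by (rule integrable_subinterval_real) (use xy in auto)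
  then have "integral {a..x} g + integral {x..y} g = integral {a..y} g"
    using xy by (intro Henstock_Kurzweil_Integration.integral_combine) auto
  then show "v + integral {a..y} g - (v + integral {a..x} g) = integral {x..y} g"
    by (simp add: algebra_simps)
qed

lemma primitive_on_subset:
  assumes "primitive_on {a..b} f g" "a \<le> c" "d \<le> b"
  shows "primitive_on {c..d} f g"
  using assms set_integrable_subset[of lebesgue "{a..b}" g "{c..d}"]
  by (auto simp: primitive_on_def)

lemma primitive_on_bound:
  assumes "primitive_on {a..b} f g" "x \<in> {a..b}" "y \<in> {a..b}" "x \<le> y"
  shows "norm (f y - f x) \<le> integral {x..y} (\<lambda>t. norm (g t))"
proof -
  have "g absolutely_integrable_on {x..y}"
    using primitive_on_subset[OF assms(1), of x y] assms(2,3) by (simp add: primitive_on_def)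
  then show ?thesis
    using assms absolutely_integrable_on_def
    by (auto simp: primitive_on_def intro!: integral_norm_bound_integral)
qed

lemma primitive_on_continuous:
  assumes "primitive_on {a..b} f g"
  shows "continuous_on {a..b} f"
proof (cases "a \<le> b")
  case True
  have "g integrable_on {a..b}"
    using assms absolutely_integrable_on_def by (auto simp: primitive_on_def)
  then have "continuous_on {a..b} (\<lambda>t. f a + integral {a..t} g)"
    by (intro continuous_intros indefinite_integral_continuous_1)
  moreover have "f a + integral {a..t} g = f t" if "t \<in> {a..b}" for t
    using primitive_onD(2)[OF assms, of a t] that True by (simp add: algebra_simps)
  ultimately show ?thesis by (rule continuous_on_eq)
qed simp

text \<open>Allows a density to be exchanged for its continuous representative, after which the
  primitive is differentiable in the classical sense.\<close>

lemma primitive_on_spike: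
  assumes "primitive_on {a..b} f g" "negligible N" "\<And>t. t \<in> {a..b} - N \<Longrightarrow> h t = g t"
  shows "primitive_on {a..b} f h"
  unfolding primitive_on_def
proof (intro conjI ballI impI)
  show "h absolutely_integrable_on {a..b}"
    by (rule absolutely_integrable_spike[OF primitive_onD(1)[OF assms(1)] assms(2,3)])
  fix x y assume xy: "x \<in> {a..b}" "y \<in> {a..b}" "x \<le> y"
  have "integral {x..y} g = integral {x..y} h"
    by (rule integral_spike[OF assms(2)]) (use assms(3) xy in auto)
  then show "f y - f x = integral {x..y} h"
    using primitive_onD(2)[OF assms(1) xy] by simp
qed

lemma primitive_on_has_vector_derivative:
  assumes "primitive_on {a..b} f g" "continuous_on {a..b} g" "t \<in> {a..b}"
  shows "(f has_vector_derivative g t) (at t within {a..b})"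
proof -
  have ab: "a \<le> b" using assms(3) by auto
  have "((\<lambda>u. f a + integral {a..u} g) has_vector_derivative 0 + g t) (at t within {a..b})"
    by (intro has_vector_derivative_add has_vector_derivative_const
        integral_has_vector_derivative assms)
  then have "((\<lambda>u. f a + integral {a..u} g) has_vector_derivative g t) (at t within {a..b})"
    by simp
  then show ?thesis
  proof (rule has_vector_derivative_transform[OF assms(3), rotated])
    fix t assume "t \<in> {a..b}"
    then show "f t = f a + integral {a..t} g"
      using primitive_onD(2)[OF assms(1), of a t] ab by (simp add: algebra_simps)
  qed
qed

lemma primitive_on_if_has_vector_derivative:
  assumes "\<And>t. t \<in> {a..b} \<Longrightarrow> (f has_vector_derivative g t) (at t within {a..b})"
    and "continuous_on {a..b} g"
  shows "primitive_on {a..b} f g"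
  unfolding primitive_on_def
proof (intro conjI ballI impI)
  show "g absolutely_integrable_on {a..b}"
    using assms(2) by (rule absolutely_integrable_continuous_real)
  fix x y assume xy: "x \<in> {a..b}" "y \<in> {a..b}" "x \<le> y"
  have "(g has_integral f y - f x) {x..y}"
    using xy by (intro fundamental_theorem_of_calculus has_vector_derivative_within_subset[OF assms(1)]) auto
  then show "f y - f x = integral {x..y} g" by (simp add: integral_unique)
qed

lemma bounded_linear_euclidean_expansion:
  fixes L :: "'a::euclidean_space \<Rightarrow> 'b::real_normed_vector"
  assumes "bounded_linear L"
  shows "L v = (\<Sum>i\<in>Basis. (v \<bullet> i) *\<^sub>R L i)"
proof -
  interpret bounded_linear L by (rule assms)
  have "L v = L (\<Sum>i\<in>Basis. (v \<bullet> i) *\<^sub>R i)" by (simp add: euclidean_representation)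
  then show ?thesis by (simp add: sum scaleR)
qed

text \<open>The error in the chain rule over \<open>[x, y]\<close> is \<open>o(\<Gamma> y - \<Gamma> x)\<close> for
  \<open>\<Gamma> t = t + \<integral> \<bar>g\<bar>\<close> (the integral from \<open>a\<close> to \<open>t\<close>), so no almost-everywhere differentiation theorem is needed.\<close>

lemma primitive_on_chain:
  fixes f :: "real \<Rightarrow> 'a::euclidean_space" and F :: "'a \<Rightarrow> 'b::euclidean_space"
  assumes f: "primitive_on {a..b} f g" and S: "f ` {a..b} \<subseteq> S"
    and dF: "\<And>x. x \<in> S \<Longrightarrow> (F has_derivative F' x) (at x)"
    and contF': "\<And>v. continuous_on S (\<lambda>x. F' x v)"
  shows "primitive_on {a..b} (\<lambda>t. F (f t)) (\<lambda>t. F' (f t) (g t))"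
proof -
  have gabs: "g absolutely_integrable_on {a..b}" using f by (simp add: primitive_on_def)
  have gint: "g integrable_on {a..b}" "(\<lambda>t. norm (g t)) integrable_on {a..b}"
    using gabs absolutely_integrable_on_def by auto
  have contf: "continuous_on {a..b} f" using f by (rule primitive_on_continuous)
  have contF'f: "continuous_on {a..b} (\<lambda>t. F' (f t) v)" for v
    by (rule continuous_on_compose2[OF contF' contf]) (use S in auto)
  have bl: "bounded_linear (F' (f t))" if "t \<in> {a..b}" for t
    using dF[of "f t"] S that has_derivative_bounded_linear by blast
  have habs: "(\<lambda>t. F' (f t) (g t)) absolutely_integrable_on {a..b}"
  proof -
    \<comment> \<open>In coordinates the density is a finite sum of products of an integrable and a
      bounded continuous function.\<close>
    have "(\<lambda>t. \<Sum>i\<in>Basis. (g t \<bullet> i) *\<^sub>R F' (f t) i) absolutely_integrable_on {a..b}"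
    proof (rule absolutely_integrable_sum)
      fix i :: 'a assume "i \<in> Basis"
      have gi: "(\<lambda>t. g t \<bullet> i) absolutely_integrable_on {a..b}"
        using absolutely_integrable_linear[OF gabs bounded_linear_inner_left[of i]] by (simp add: o_def)
      show "(\<lambda>t. (g t \<bullet> i) *\<^sub>R F' (f t) i) absolutely_integrable_on {a..b}"
      proof (rule absolutely_integrable_bounded_measurable_product[of "\<lambda>x c. c *\<^sub>R x"])
        show "bilinear (\<lambda>x c. c *\<^sub>R x :: 'b)"
          by (simp add: bilinear_conv_bounded_bilinear bounded_bilinear.flip[OF bounded_bilinear_scaleR])
        show "bounded ((\<lambda>t. F' (f t) i) ` {a..b})"
          by (intro compact_imp_bounded compact_continuous_image contF'f) simp
        show "(\<lambda>t. F' (f t) i) \<in> borel_measurable (lebesgue_on {a..b})"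
          by (rule continuous_imp_measurable_on_sets_lebesgue[OF contF'f]) simp
      qed (use gi in auto)
    qed simp
    then show ?thesis
    proof (rule absolutely_integrable_spike[OF _ negligible_empty])
      show "F' (f x) (g x) = (\<Sum>i\<in>Basis. (g x \<bullet> i) *\<^sub>R F' (f x) i)" if "x \<in> {a..b} - {}" for x
        by (rule bounded_linear_euclidean_expansion[OF bl]) (use that in simp)
    qed
  qed
  \<comment> \<open>\<open>M s t\<close> dominates the operator norm of
    \<open>F' (f s) - F' (f t)\<close> and tends to 0 as \<open>s\<close> tends to
    \<open>t\<close>.\<close>
  define M where "M = (\<lambda>s t. \<Sum>i\<in>Basis. norm (F' (f s) i - F' (f t) i))"
  have M: "norm (F' (f s) v - F' (f t) v) \<le> M s t * norm v" if st: "s \<in> {a..b}" "t \<in> {a..b}" for s t v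
  proof -
    have "F' (f s) v - F' (f t) v = (\<Sum>i\<in>Basis. (v \<bullet> i) *\<^sub>R (F' (f s) i - F' (f t) i))"
      unfolding bounded_linear_euclidean_expansion[OF bl[OF st(1)], of v]
        bounded_linear_euclidean_expansion[OF bl[OF st(2)], of v]
      by (simp add: scaleR_diff_right sum_subtractf)
    also have "norm \<dots> \<le> (\<Sum>i\<in>Basis. norm ((v \<bullet> i) *\<^sub>R (F' (f s) i - F' (f t) i)))"
      by (rule norm_sum)
    also have "\<dots> \<le> (\<Sum>i\<in>Basis. norm (F' (f s) i - F' (f t) i) * norm v)"
    proof (rule sum_mono)
      fix i :: 'a assume "i \<in> Basis"
      then have "\<bar>v \<bullet> i\<bar> * norm (F' (f s) i - F' (f t) i) \<le> norm v * norm (F' (f s) i - F' (f t) i)"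
        by (intro mult_right_mono Basis_le_norm) auto
      then show "norm ((v \<bullet> i) *\<^sub>R (F' (f s) i - F' (f t) i)) \<le> norm (F' (f s) i - F' (f t) i) * norm v"
        by (simp add: mult.commute)
    qed
    finally show ?thesis by (simp add: M_def sum_distrib_right)
  qed
  show ?thesis
  proof (cases "a \<le> b")
    case True
    define h where "h = (\<lambda>t. F' (f t) (g t))"
    have hint: "h integrable_on {a..b}"
      using habs absolutely_integrable_on_def by (auto simp: h_def)
    \<comment> \<open>The chain rule amounts to \<open>R\<close> being constant.\<close>
    define R where "R = (\<lambda>t. F (f t) - integral {a..t} h)"
    define \<Gamma> where "\<Gamma> = (\<lambda>t. t + integral {a..t} (\<lambda>t. norm (g t)))"
    have sub: "k integrable_on {x..y}" if "k integrable_on {a..b}" "x \<in> {a..b}" "y \<in> {a..b}" for x y and k :: "real \<Rightarrow> 'c::banach"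
      using that(1) by (rule integrable_subinterval_real) (use that in auto)
    have diff: "integral {a..y} k - integral {a..x} k = integral {x..y} k"
      if "k integrable_on {a..b}" "x \<in> {a..b}" "y \<in> {a..b}" "x \<le> y" for x y and k :: "real \<Rightarrow> 'c::banach"
      using Henstock_Kurzweil_Integration.integral_combine[of a x y k] sub[OF that(1), of a y] that True
      by (auto simp: algebra_simps)
    have \<Gamma>diff: "\<Gamma> y - \<Gamma> x = (y - x) + integral {x..y} (\<lambda>t. norm (g t))"
      if "x \<in> {a..b}" "y \<in> {a..b}" "x \<le> y" for x y
      using diff[OF gint(2) that] by (simp add: \<Gamma>_def)
    have nonneg: "0 \<le> integral {x..y} (\<lambda>t. norm (g t))" for x y
      by (cases "(\<lambda>t. norm (g t)) integrable_on {x..y}")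
         (auto intro: Henstock_Kurzweil_Integration.integral_nonneg simp: not_integrable_integral)
    \<comment> \<open>The base point \<open>t\<close> of the linearization may be either end, since
      nearby points lie on both sides of it. The error \<open>e1\<close> comes from freezing
      \<open>F'\<close> at \<open>t\<close>, the error \<open>e2\<close> from linearizing
      \<open>F\<close>.\<close>
    have key: "norm (R y - R x) \<le> (e1 + e2) * (\<Gamma> y - \<Gamma> x)"
      if xy: "x \<in> {a..b}" "y \<in> {a..b}" "x \<le> y" and t: "t = x \<or> t = y"
        and e: "0 < e1" "0 < e2"
        and 1: "\<And>s. s \<in> {x..y} \<Longrightarrow> M s t \<le> e1"
        and 2: "norm (F (f y) - F (f x) - F' (f t) (f y - f x)) \<le> e2 * norm (f y - f x)"
      for x y t e1 e2
    proof -
      have fd: "f y - f x = integral {x..y} g" using f xy by (simp add: primitive_on_def)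
      have gi: "g integrable_on {x..y}" "(\<lambda>t. norm (g t)) integrable_on {x..y}"
        using sub[OF gint(1) xy(1,2)] sub[OF gint(2) xy(1,2)] by auto
      have hi: "h integrable_on {x..y}" using sub[OF hint xy(1,2)] .
      have tab: "t \<in> {a..b}" using t xy by auto
      have lin: "F' (f t) (integral {x..y} g) = integral {x..y} (\<lambda>s. F' (f t) (g s))"
        using integral_linear[OF gi(1) bl[OF tab]] by (simp add: o_def)
      have li: "(\<lambda>s. F' (f t) (g s)) integrable_on {x..y}"
        using integrable_linear[OF gi(1) bl[OF tab]] by (simp add: o_def)
      have "norm (integral {x..y} (\<lambda>s. h s - F' (f t) (g s))) \<le> integral {x..y} (\<lambda>s. e1 * norm (g s))"
      proof (rule integral_norm_bound_integral)
        show "(\<lambda>s. h s - F' (f t) (g s)) integrable_on {x..y}"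
          by (intro Henstock_Kurzweil_Integration.integrable_diff hi li)
        show "(\<lambda>s. e1 * norm (g s)) integrable_on {x..y}"
          using gi(2) by (rule integrable_on_mult_right)
        fix s assume s: "s \<in> {x..y}"
        have "norm (h s - F' (f t) (g s)) \<le> M s t * norm (g s)"
          unfolding h_def by (rule M) (use s xy tab in auto)
        also have "\<dots> \<le> e1 * norm (g s)" by (intro mult_right_mono 1 s) simp
        finally show "norm (h s - F' (f t) (g s)) \<le> e1 * norm (g s)" .
      qed
      moreover have "integral {x..y} (\<lambda>s. h s - F' (f t) (g s)) = integral {x..y} h - F' (f t) (f y - f x)"
        using Henstock_Kurzweil_Integration.integral_diff[OF hi li] by (simp add: lin fd)
      ultimately have 3: "norm (integral {x..y} h - F' (f t) (f y - f x)) \<le> e1 * integral {x..y} (\<lambda>s. norm (g s))"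
        by simp
      have "R y - R x = (F (f y) - F (f x) - F' (f t) (f y - f x)) - (integral {x..y} h - F' (f t) (f y - f x))"
        using diff[OF hint xy] by (simp add: R_def algebra_simps)
      then have "norm (R y - R x) \<le> e2 * norm (f y - f x) + e1 * integral {x..y} (\<lambda>s. norm (g s))"
        using 2 3 by (smt (verit) norm_triangle_ineq4)
      also have "\<dots> \<le> e2 * integral {x..y} (\<lambda>s. norm (g s)) + e1 * integral {x..y} (\<lambda>s. norm (g s))"
        using primitive_on_bound[OF f xy] e by (intro add_right_mono mult_left_mono) auto
      also have "\<dots> \<le> (e1 + e2) * (\<Gamma> y - \<Gamma> x)"
        using e xy(3) mult_nonneg_nonneg[of "e1 + e2" "y - x"] by (simp add: \<Gamma>diff[OF xy] algebra_simps)
      finally show ?thesis .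
    qed
    have const: "R t = R a" if t: "t \<in> {a..b}" for t
    proof (rule constant_if_small_relative_to_monotone[where \<Gamma>=\<Gamma>, OF _ _ _ t])
      show "continuous_on {a..b} \<Gamma>"
        unfolding \<Gamma>_def by (intro continuous_intros indefinite_integral_continuous_1 gint)
      show "strict_mono_on {a..b} \<Gamma>"
      proof (rule strict_mono_onI)
        fix r s assume "r \<in> {a..b}" "s \<in> {a..b}" "r < s"
        then show "\<Gamma> r < \<Gamma> s" using \<Gamma>diff[of r s] nonneg[of r s] by simp
      qed
    next
      fix t and e :: real assume t: "t \<in> {a..b}" and e: "0 < e"
      obtain d1 where d1: "0 < d1" "\<And>s. s \<in> {a..b} \<Longrightarrow> dist s t < d1 \<Longrightarrow> M s t < e / 2"
      proof -
        have "continuous_on {a..b} (\<lambda>s. M s t)"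
          unfolding M_def by (intro continuous_intros contF'f)
        moreover have "M t t = 0" "\<And>s. 0 \<le> M s t" by (auto simp: M_def sum_nonneg)
        ultimately show ?thesis
          using t e that unfolding continuous_on_iff dist_real_def
          by (metis abs_of_nonneg diff_zero half_gt_zero)
      qed
      have "(F has_derivative F' (f t)) (at (f t))" using dF[of "f t"] S t by blast
      then obtain d2 where d2: "0 < d2" "\<And>z. norm (z - f t) < d2 \<Longrightarrow>
          norm (F z - F (f t) - F' (f t) (z - f t)) \<le> e / 2 * norm (z - f t)"
        unfolding has_derivative_at_alt using e by (meson half_gt_zero)
      obtain d3 where d3: "0 < d3" "\<And>s. s \<in> {a..b} \<Longrightarrow> dist s t < d3 \<Longrightarrow> dist (f s) (f t) < d2"
        using contf t d2(1) unfolding continuous_on_iff by meson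
      show "\<exists>d>0. \<forall>s\<in>{a..b}. \<bar>s - t\<bar> < d \<longrightarrow> norm (R s - R t) \<le> e * \<bar>\<Gamma> s - \<Gamma> t\<bar>"
      proof (intro exI[of _ "min d1 d3"] conjI ballI impI)
        show "0 < min d1 d3" using d1 d3 by simp
        fix s assume s: "s \<in> {a..b}" "\<bar>s - t\<bar> < min d1 d3"
        have st2: "norm (F (f s) - F (f t) - F' (f t) (f s - f t)) \<le> e / 2 * norm (f s - f t)"
          using d2(2)[of "f s"] d3(2)[OF s(1)] s(2) by (simp add: dist_norm)
        show "norm (R s - R t) \<le> e * \<bar>\<Gamma> s - \<Gamma> t\<bar>"
        proof (cases "t \<le> s")
          case True
          have "norm (R s - R t) \<le> (e/2 + e/2) * (\<Gamma> s - \<Gamma> t)"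
          proof (rule key[OF t s(1) True])
            show "M r t \<le> e / 2" if "r \<in> {t..s}" for r
              using d1(2)[of r] that s t by (simp add: dist_norm)
          qed (use e st2 in auto)
          also have "\<dots> \<le> e * \<bar>\<Gamma> s - \<Gamma> t\<bar>" using e by simp
          finally show ?thesis .
        next
          case False
          have "norm (R t - R s) \<le> (e/2 + e/2) * (\<Gamma> t - \<Gamma> s)"
          proof (rule key[OF s(1) t, of t])
            show "M r t \<le> e / 2" if "r \<in> {s..t}" for r
              using d1(2)[of r] that s t by (simp add: dist_norm)
            have "F (f t) - F (f s) - F' (f t) (f t - f s) = - (F (f s) - F (f t) - F' (f t) (f s - f t))"
              by (simp add: linear_diff[OF bounded_linear.linear[OF bl[OF t]]])
            then show "norm (F (f t) - F (f s) - F' (f t) (f t - f s)) \<le> e / 2 * norm (f t - f s)"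
              using st2 by (metis norm_minus_cancel norm_minus_commute)
          qed (use e False in auto)
          also have "\<dots> \<le> e * \<bar>\<Gamma> s - \<Gamma> t\<bar>" using e by simp
          finally show ?thesis by (simp add: norm_minus_commute)
        qed
      qed
    qed
    show ?thesis
      unfolding primitive_on_def
    proof (intro conjI ballI impI habs)
      fix x y assume xy: "x \<in> {a..b}" "y \<in> {a..b}" "x \<le> y"
      have "R y = R x" using const[OF xy(2)] const[OF xy(1)] by (rule trans[OF _ sym])
      then show "F (f y) - F (f x) = integral {x..y} (\<lambda>t. F' (f t) (g t))"
        using diff[OF hint xy] by (simp add: R_def h_def algebra_simps)
    qed
  qed (use habs in \<open>simp add: primitive_on_def\<close>)
qed

lemma primitive_on_Pair:
  assumes "primitive_on {a..b} f f'" "primitive_on {a..b} g g'"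
  shows "primitive_on {a..b} (\<lambda>t. (f t, g t)) (\<lambda>t. (f' t, g' t))"
  unfolding primitive_on_def
proof (intro conjI ballI impI)
  have 1: "f' absolutely_integrable_on {a..b}" "g' absolutely_integrable_on {a..b}"
    using assms by (auto simp: primitive_on_def)
  have p1: "(\<lambda>t. (f' t, 0::'b)) absolutely_integrable_on {a..b}"
    using absolutely_integrable_linear[OF 1(1), of "\<lambda>x. (x, 0)"]
    by (simp add: o_def bounded_linear_Pair bounded_linear_ident bounded_linear_zero)
  have p2: "(\<lambda>t. (0::'a, g' t)) absolutely_integrable_on {a..b}"
    using absolutely_integrable_linear[OF 1(2), of "\<lambda>x. (0, x)"]
    by (simp add: o_def bounded_linear_Pair bounded_linear_ident bounded_linear_zero)
  have "(\<lambda>t. (f' t, 0) + (0, g' t)) absolutely_integrable_on {a..b}"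
    using p1 p2 by (rule set_integral_add)
  then show "(\<lambda>t. (f' t, g' t)) absolutely_integrable_on {a..b}" by simp
  fix x y assume xy: "x \<in> {a..b}" "y \<in> {a..b}" "x \<le> y"
  have "f' integrable_on {x..y}" "g' integrable_on {x..y}"
    using primitive_on_subset[OF assms(1), of x y] primitive_on_subset[OF assms(2), of x y] xy
      absolutely_integrable_on_def by (auto simp: primitive_on_def)
  then have "((\<lambda>t. (f' t, 0) + (0, g' t)) has_integral (integral {x..y} f', 0) + (0, integral {x..y} g')) {x..y}"
    using has_integral_linear[OF integrable_integral, of f' "{x..y}" "\<lambda>x. (x, 0::'b)"]
     has_integral_linear[OF integrable_integral, of g' "{x..y}" "\<lambda>x. (0::'a, x)"]
    by (intro has_integral_add) (simp_all add: o_def bounded_linear_Pair bounded_linear_ident bounded_linear_zero)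
  then show "(f y, g y) - (f x, g x) = integral {x..y} (\<lambda>t. (f' t, g' t))"
    using assms xy by (simp add: primitive_on_def integral_unique)
qed

text \<open>The product rule, obtained as the chain rule for the bilinear map along the pair
  \<open>(f, g)\<close>.\<close>

lemma primitive_on_bilinear:
  fixes f :: "real \<Rightarrow> 'a::euclidean_space" and g :: "real \<Rightarrow> 'b::euclidean_space"
    and prod :: "'a \<Rightarrow> 'b \<Rightarrow> 'c::euclidean_space"
  assumes prod: "bounded_bilinear prod"
    and f: "primitive_on {a..b} f f'" and g: "primitive_on {a..b} g g'"
  shows "primitive_on {a..b} (\<lambda>t. prod (f t) (g t)) (\<lambda>t. prod (f t) (g' t) + prod (f' t) (g t))"
proof -
  interpret bounded_bilinear prod by (rule prod)
  have "primitive_on {a..b} (\<lambda>t. (\<lambda>z. prod (fst z) (snd z)) (f t, g t))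
      (\<lambda>t. (\<lambda>z w. prod (fst z) (snd w) + prod (fst w) (snd z)) (f t, g t) (f' t, g' t))"
  proof (rule primitive_on_chain[OF primitive_on_Pair[OF f g], of UNIV])
    show "((\<lambda>z. prod (fst z) (snd z)) has_derivative
        (\<lambda>w. prod (fst x) (snd w) + prod (fst w) (snd x))) (at x)" for x
      by (rule FDERIV) (auto intro!: derivative_eq_intros)
    show "continuous_on UNIV (\<lambda>x. prod (fst x) (snd v) + prod (fst v) (snd x))" for v
      by (intro continuous_intros continuous_on)
  qed simp
  then show ?thesis by simp
qed

section \<open>Weak derivatives\<close>

lemma absolutely_integrable_open01:
  fixes f :: "real \<Rightarrow> 'a::euclidean_space"
  shows "f absolutely_integrable_on {0<..<1} \<longleftrightarrow> f absolutely_integrable_on {0..1}"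
  using absolutely_integrable_on_open_interval[of 0 1 f] by simp

lemma integrable_lebesgue_on_open01:
  fixes f :: "real \<Rightarrow> 'a::euclidean_space"
  shows "integrable (lebesgue_on {0<..<1}) f \<longleftrightarrow> f absolutely_integrable_on {0..1}"
  unfolding absolutely_integrable_open01[symmetric]
  unfolding set_integrable_def
  by (simp add: integrable_restrict_space)

lemma lint_open01:
  fixes f :: "real \<Rightarrow> 'a::euclidean_space"
  assumes "f absolutely_integrable_on {0..1}"
  shows "(LINT t|lebesgue_on {0<..<1}. f t) = integral {0..1} f"
  using assms lebesgue_integral_eq_integral[of "{0<..<1}" f]
  by (simp add: integrable_lebesgue_on_open01 integral_open_interval_real)

lemma locally_integrable_if_integrable:
  assumes "f absolutely_integrable_on {0..1}"
  shows "locally_integrable f"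
  unfolding locally_integrable_def
proof safe
  fix K :: "real set" assume K: "compact K" "K \<subseteq> {0<..<1}"
  then have "K \<in> sets lebesgue" by (simp add: lmeasurable_compact fmeasurableD)
  moreover have "K \<subseteq> {0..1}" using K(2) by auto
  ultimately have "f absolutely_integrable_on K" using set_integrable_subset[OF assms] by blast
  then show "integrable (lebesgue_on K) f"
    using \<open>K \<in> sets lebesgue\<close> by (rule absolutely_integrable_imp_integrable)
qed

lemma test_function_times_integrable:
  fixes f :: "real \<Rightarrow> 'a::euclidean_space"
  assumes "f absolutely_integrable_on {0..1}" "test_function \<phi>"
  shows "(\<lambda>t. \<phi> t *\<^sub>R f t) absolutely_integrable_on {0..1}"
  using locally_integrable_times_test_function[OF locally_integrable_if_integrable[OF assms(1)] assms(2)]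
  by (simp add: absolutely_integrable_open01)

lemma test_function_absolutely_integrable:
  fixes \<phi> :: "real \<Rightarrow> 'a::euclidean_space"
  assumes "test_function \<phi>"
  shows "\<phi> absolutely_integrable_on {0..1}"
  using smooth_continuous_on[OF test_function_smooth[OF assms], of "{0..1}" 0]
  by (simp add: absolutely_integrable_continuous_real)

lemma negligible_open01_iff:
  "negligible {t\<in>{0<..<1}. P t} \<longleftrightarrow> negligible {t\<in>{0..1::real}. P t}"
proof
  assume "negligible {t\<in>{0<..<1::real}. P t}"
  then have "negligible ({t\<in>{0<..<1}. P t} \<union> {0, 1})" by (intro negligible_Un) auto
  then show "negligible {t\<in>{0..1}. P t}" by (rule negligible_subset) auto
qed (erule negligible_subset, auto)

lemma fundamental_lemma_integrable:
  fixes f :: "real \<Rightarrow> 'a::euclidean_space"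
  assumes f: "f absolutely_integrable_on {0..1}"
    and 0: "\<And>\<phi> :: real \<Rightarrow> real. test_function \<phi> \<Longrightarrow> integral {0..1} (\<lambda>t. \<phi> t *\<^sub>R f t) = 0"
  shows "negligible {t\<in>{0..1}. f t \<noteq> 0}"
  unfolding negligible_open01_iff[symmetric]
  by (rule fundamental_lemma)
     (use 0 in \<open>simp_all add: locally_integrable_if_integrable[OF f]
        lint_open01 test_function_times_integrable[OF f]\<close>)

section \<open>The lemma of du Bois-Reymond and regularity of Sobolev functions\<close>

lemma integral_add_scaled:
  fixes f g :: "real \<Rightarrow> 'a::euclidean_space"
  assumes f: "f integrable_on S" and g: "g integrable_on S"
  shows "integral S (\<lambda>t. f t + c *\<^sub>R g t) = integral S f + c *\<^sub>R integral S g"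
  by (simp only: Henstock_Kurzweil_Integration.integral_add[OF f integrable_cmul[OF g]] integral_cmul)

text \<open>With \<open>\<phi>0\<close> a bump of integral 1, subtracting
  \<open>integral {0..1} \<phi>\<close> times \<open>\<phi>0\<close> leaves a test function of
  integral 0, and this is the derivative of a test function.\<close>

lemma test_function_decomposition:
  obtains \<phi>0 :: "real \<Rightarrow> real" where "test_function \<phi>0"
    and "\<And>\<phi>. test_function \<phi> \<Longrightarrow>
      \<exists>\<psi>. test_function \<psi> \<and> nth_vderiv 1 \<psi> = (\<lambda>t. \<phi> t + (- integral {0..1} \<phi>) *\<^sub>R \<phi>0 t)"
proof -
  define b where "b = bump (1/4) (3/4) 1"
  have b: "test_function b" by (simp add: b_def test_function_bump)
  have ti: "\<phi> integrable_on {0..1}" if "test_function \<phi>" for \<phi> :: "real \<Rightarrow> real"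
    using test_function_absolutely_integrable[OF that] absolutely_integrable_on_def by blast
  define I where "I = integral {0..1} b"
  have cont0: "continuous_on {0..1} b"
    using smooth_continuous_on[OF test_function_smooth[OF b], of "{0..1}" 0] by simp
  have "I \<noteq> 0"
  proof
    assume "I = 0"
    then have "(b has_integral 0) {0..1}"
      using ti[OF b] by (simp add: I_def has_integral_iff)
    then have "b (1/2) = 0"
      using has_integral_0_cbox_imp_0[of 0 1 b "1/2"] cont0 by (simp add: b_def bump_nonneg)
    then show False using bump_pos[of 1 "1/2" "1/4" "3/4"] by (simp add: b_def)
  qed
  define \<phi>0 where "\<phi>0 = (\<lambda>t. b t *\<^sub>R (1 / I))"
  have \<phi>0: "test_function \<phi>0" unfolding \<phi>0_def by (rule test_function_scaleR_const[OF b])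
  have "integral {0..1} \<phi>0 = 1"
    using \<open>I \<noteq> 0\<close> by (simp add: \<phi>0_def I_def)
  have "\<exists>\<psi>. test_function \<psi> \<and> nth_vderiv 1 \<psi> = (\<lambda>t. \<phi> t + (- integral {0..1} \<phi>) *\<^sub>R \<phi>0 t)"
    if \<phi>: "test_function \<phi>" for \<phi>
  proof -
    define \<xi> where "\<xi> = (\<lambda>t. \<phi> t + (- integral {0..1} \<phi>) *\<^sub>R \<phi>0 t)"
    have \<xi>: "test_function \<xi>" unfolding \<xi>_def by (intro test_function_add_scaled \<phi> \<phi>0)
    have "integral {0..1} \<xi> = integral {0..1} \<phi> + (- integral {0..1} \<phi>) *\<^sub>R integral {0..1} \<phi>0"
      unfolding \<xi>_def by (rule integral_add_scaled[OF ti[OF \<phi>] ti[OF \<phi>0]])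
    then have "integral {0..1} \<xi> = 0" using \<open>integral {0..1} \<phi>0 = 1\<close> by simp
    then obtain \<psi> where "test_function \<psi>" "nth_vderiv 1 \<psi> = \<xi>"
      using test_function_antiderivative[OF \<xi>] by blast
    then show ?thesis by (auto simp: \<xi>_def)
  qed
  with \<phi>0 show ?thesis by (rule that)
qed

text \<open>Adding \<open>t *\<^sub>R a\<close> to \<open>h\<close> cancels the right-hand side
  through integration by parts. What remains is orthogonal to every derivative of a test function;
  splitting \<open>\<phi>\<close> by \<open>test_function_decomposition\<close> shows that it equals
  a constant weakly, hence almost everywhere.\<close>

lemma du_bois_reymond_constant:
  fixes h :: "real \<Rightarrow> 'a::euclidean_space"
  assumes h: "h absolutely_integrable_on {0..1}"
    and 0: "\<And>\<phi> :: real \<Rightarrow> real. test_function \<phi> \<Longrightarrow>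
      integral {0..1} (\<lambda>t. nth_vderiv 1 \<phi> t *\<^sub>R h t) = (integral {0..1} \<phi>) *\<^sub>R a"
  obtains c where "negligible {t\<in>{0..1}. h t \<noteq> c - t *\<^sub>R a}"
proof -
  have abs1: "u absolutely_integrable_on {0..1} \<Longrightarrow> u integrable_on {0..1}" for u :: "real \<Rightarrow> 'b::euclidean_space"
    using absolutely_integrable_on_def by blast
  obtain \<phi>0 where \<phi>0: "test_function \<phi>0" and dec: "\<And>\<phi>. test_function \<phi> \<Longrightarrow>
      \<exists>\<psi>. test_function \<psi> \<and> nth_vderiv 1 \<psi> = (\<lambda>t. \<phi> t + (- integral {0..1} \<phi>) *\<^sub>R \<phi>0 t)"
    using test_function_decomposition by blast
  define k where "k = (\<lambda>t. h t + t *\<^sub>R a)"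
  have idabs: "(\<lambda>t. t *\<^sub>R a) absolutely_integrable_on {0..1}"
    by (intro absolutely_integrable_continuous_real continuous_intros)
  have k: "k absolutely_integrable_on {0..1}"
    unfolding k_def by (intro set_integral_add h idabs)
  have k0: "integral {0..1} (\<lambda>t. nth_vderiv 1 \<psi> t *\<^sub>R k t) = 0" if \<psi>: "test_function \<psi>" for \<psi> :: "real \<Rightarrow> real"
  proof -
    have "((\<lambda>t. t * nth_vderiv 1 \<psi> t + 1 * \<psi> t) has_integral (1 * \<psi> 1 - 0 * \<psi> 0)) {0..1}"
    proof (rule fundamental_theorem_of_calculus)
      fix t :: real assume "t \<in> {0..1}"
      have "(\<psi> has_vector_derivative nth_vderiv 1 \<psi> t) (at t within {0..1})"
        using smooth_has_vector_derivative[OF test_function_smooth[OF \<psi>], of 0 t]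
        by (simp add: has_vector_derivative_at_within)
      then show "((\<lambda>t. t * \<psi> t) has_vector_derivative t * nth_vderiv 1 \<psi> t + 1 * \<psi> t) (at t within {0..1})"
        by (intro has_vector_derivative_mult has_vector_derivative_id)
    qed simp
    then have "integral {0..1} (\<lambda>t. t * nth_vderiv 1 \<psi> t + \<psi> t) = 0"
      using test_function_eq_0[OF \<psi>, of 1] by (simp add: integral_unique)
    moreover have \<psi>i: "\<psi> integrable_on {0..1}" "(\<lambda>t. t * nth_vderiv 1 \<psi> t) integrable_on {0..1}"
      using smooth_continuous_on[OF test_function_smooth[OF \<psi>], of "{0..1}" 0]
         smooth_continuous_on[OF test_function_smooth[OF \<psi>], of "{0..1}" 1]
      by (auto intro!: integrable_continuous_interval continuous_intros)
    ultimately have t: "integral {0..1} (\<lambda>t. t * nth_vderiv 1 \<psi> t) = - integral {0..1} \<psi>"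
      using Henstock_Kurzweil_Integration.integral_add[OF \<psi>i(2,1)] by simp
    have "integral {0..1} (\<lambda>t. nth_vderiv 1 \<psi> t *\<^sub>R k t)
        = integral {0..1} (\<lambda>t. nth_vderiv 1 \<psi> t *\<^sub>R h t + (t * nth_vderiv 1 \<psi> t) *\<^sub>R a)"
      by (simp add: k_def algebra_simps)
    also have "\<dots> = integral {0..1} (\<lambda>t. nth_vderiv 1 \<psi> t *\<^sub>R h t) + integral {0..1} (\<lambda>t. (t * nth_vderiv 1 \<psi> t) *\<^sub>R a)"
    proof (rule Henstock_Kurzweil_Integration.integral_add)
      show "(\<lambda>t. nth_vderiv 1 \<psi> t *\<^sub>R h t) integrable_on {0..1}"
        by (intro abs1 test_function_times_integrable h test_function_nth_vderiv \<psi>)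
      show "(\<lambda>t. (t * nth_vderiv 1 \<psi> t) *\<^sub>R a) integrable_on {0..1}"
        using integrable_linear[OF \<psi>i(2) bounded_linear_scaleR_left[of a]] by (simp add: o_def)
    qed
    also have "integral {0..1} (\<lambda>t. (t * nth_vderiv 1 \<psi> t) *\<^sub>R a) = integral {0..1} (\<lambda>t. t * nth_vderiv 1 \<psi> t) *\<^sub>R a"
      using integral_linear[OF \<psi>i(2) bounded_linear_scaleR_left[of a]] by (simp add: o_def)
    finally show ?thesis using 0[OF \<psi>] t by simp
  qed
  define c where "c = integral {0..1} (\<lambda>t. \<phi>0 t *\<^sub>R k t)"
  have kc: "(\<lambda>t. k t - c) absolutely_integrable_on {0..1}"
    by (intro set_integral_diff k) (auto intro: absolutely_integrable_on_const)
  have "negligible {t\<in>{0..1}. k t - c \<noteq> 0}"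
  proof (rule fundamental_lemma_integrable[OF kc])
    fix \<phi> :: "real \<Rightarrow> real" assume \<phi>: "test_function \<phi>"
    define J where "J = integral {0..1} \<phi>"
    obtain \<psi> where \<psi>: "test_function \<psi>" "nth_vderiv 1 \<psi> = (\<lambda>t. \<phi> t + (- J) *\<^sub>R \<phi>0 t)"
      using dec[OF \<phi>] by (auto simp: J_def)
    have \<phi>i: "\<phi> integrable_on {0..1}"
      by (intro abs1 test_function_absolutely_integrable \<phi>)
    have 1: "(\<lambda>t. \<phi> t *\<^sub>R k t) integrable_on {0..1}" "(\<lambda>t. \<phi>0 t *\<^sub>R k t) integrable_on {0..1}"
      by (intro abs1 test_function_times_integrable k \<phi> \<phi>0)+
    have "0 = integral {0..1} (\<lambda>t. \<phi> t *\<^sub>R k t + (- J) *\<^sub>R (\<phi>0 t *\<^sub>R k t))"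
      using k0[OF \<psi>(1)] unfolding \<psi>(2) by (simp add: algebra_simps)
    also have "\<dots> = integral {0..1} (\<lambda>t. \<phi> t *\<^sub>R k t) + (- J) *\<^sub>R integral {0..1} (\<lambda>t. \<phi>0 t *\<^sub>R k t)"
      by (rule integral_add_scaled[OF 1])
    also have "\<dots> = integral {0..1} (\<lambda>t. \<phi> t *\<^sub>R k t) - J *\<^sub>R c"
      by (simp add: c_def)
    also have "J *\<^sub>R c = integral {0..1} (\<lambda>t. \<phi> t *\<^sub>R c)"
      using integral_linear[OF \<phi>i bounded_linear_scaleR_left[of c]] by (simp add: o_def J_def)
    also have "integral {0..1} (\<lambda>t. \<phi> t *\<^sub>R k t) - integral {0..1} (\<lambda>t. \<phi> t *\<^sub>R c) = integral {0..1} (\<lambda>t. \<phi> t *\<^sub>R (k t - c))"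
      using 1(1) \<phi>i
      by (subst Henstock_Kurzweil_Integration.integral_diff[symmetric])
         (auto intro!: integrable_on_scaleR_left simp: algebra_simps)
    finally show "integral {0..1} (\<lambda>t. \<phi> t *\<^sub>R (k t - c)) = 0" by simp
  qed
  moreover have "{t\<in>{0..1}. h t \<noteq> c - t *\<^sub>R a} = {t\<in>{0..1}. k t - c \<noteq> 0}"
    by (auto simp: k_def algebra_simps)
  ultimately show ?thesis using that[of c] by simp
qed

lemma integral_by_parts_test_function:
  fixes f :: "real \<Rightarrow> 'a::euclidean_space"
  assumes f: "primitive_on {0..1} f g" and \<phi>: "test_function \<phi>"
  shows "integral {0..1} (\<lambda>t. nth_vderiv 1 \<phi> t *\<^sub>R f t) = - integral {0..1} (\<lambda>t. \<phi> t *\<^sub>R g t)"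
proof -
  have "primitive_on {0..1} \<phi> (nth_vderiv 1 \<phi>)"
  proof (rule primitive_on_if_has_vector_derivative)
    show "(\<phi> has_vector_derivative nth_vderiv 1 \<phi> t) (at t within {0..1})" for t
      using smooth_has_vector_derivative[OF test_function_smooth[OF \<phi>], of 0 t]
      by (simp add: has_vector_derivative_at_within)
  qed (intro smooth_continuous_on test_function_smooth \<phi>)
  from primitive_on_bilinear[OF bounded_bilinear_scaleR this f]
  have p: "primitive_on {0..1} (\<lambda>t. \<phi> t *\<^sub>R f t) (\<lambda>t. \<phi> t *\<^sub>R g t + nth_vderiv 1 \<phi> t *\<^sub>R f t)" .
  have fabs: "f absolutely_integrable_on {0..1}"
    by (intro absolutely_integrable_continuous_real primitive_on_continuous[OF f])
  have "0 = integral {0..1} (\<lambda>t. \<phi> t *\<^sub>R g t + nth_vderiv 1 \<phi> t *\<^sub>R f t)"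
    using primitive_onD(2)[OF p, of 0 1] test_function_eq_0[OF \<phi>, of 0] test_function_eq_0[OF \<phi>, of 1]
    by simp
  also have "\<dots> = integral {0..1} (\<lambda>t. \<phi> t *\<^sub>R g t) + integral {0..1} (\<lambda>t. nth_vderiv 1 \<phi> t *\<^sub>R f t)"
    using test_function_times_integrable[OF primitive_onD(1)[OF f] \<phi>]
      test_function_times_integrable[OF fabs test_function_nth_vderiv[OF \<phi>], of 1]
    by (intro Henstock_Kurzweil_Integration.integral_add) (auto simp: absolutely_integrable_on_def)
  finally show ?thesis by (simp add: eq_neg_iff_add_eq_0 add.commute)
qed

text \<open>Subtracting the indefinite integral of \<open>g\<close> from \<open>f\<close> leaves a
  function with weak derivative 0, so \<open>du_bois_reymond_constant\<close> applies with
  \<open>a = 0\<close>.\<close>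

lemma primitive_on_if_weak:
  fixes f g :: "real \<Rightarrow> 'a::euclidean_space"
  assumes f: "f absolutely_integrable_on {0..1}" and g: "g absolutely_integrable_on {0..1}"
    and weak: "\<And>\<phi> :: real \<Rightarrow> real. test_function \<phi> \<Longrightarrow>
      integral {0..1} (\<lambda>t. nth_vderiv 1 \<phi> t *\<^sub>R f t) = - integral {0..1} (\<lambda>t. \<phi> t *\<^sub>R g t)"
  obtains F where "primitive_on {0..1} F g" "negligible {t\<in>{0..1}. f t \<noteq> F t}"
proof -
  define G where "G = (\<lambda>t. 0 + integral {0..t} g)"
  have G: "primitive_on {0..1} G g" unfolding G_def by (rule primitive_on_integral[OF g])
  have Gabs: "G absolutely_integrable_on {0..1}"
    by (intro absolutely_integrable_continuous_real primitive_on_continuous[OF G])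
  have fG: "(\<lambda>t. f t - G t) absolutely_integrable_on {0..1}"
    by (intro set_integral_diff f Gabs)
  have "integral {0..1} (\<lambda>t. nth_vderiv 1 \<phi> t *\<^sub>R (f t - G t)) = (integral {0..1} \<phi>) *\<^sub>R 0"
    if \<phi>: "test_function \<phi>" for \<phi> :: "real \<Rightarrow> real"
  proof -
    have "integral {0..1} (\<lambda>t. nth_vderiv 1 \<phi> t *\<^sub>R (f t - G t)) =
        integral {0..1} (\<lambda>t. nth_vderiv 1 \<phi> t *\<^sub>R f t) - integral {0..1} (\<lambda>t. nth_vderiv 1 \<phi> t *\<^sub>R G t)"
      using test_function_times_integrable[OF f test_function_nth_vderiv[OF \<phi>], of 1]
        test_function_times_integrable[OF Gabs test_function_nth_vderiv[OF \<phi>], of 1]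
      by (subst Henstock_Kurzweil_Integration.integral_diff[symmetric])
         (auto simp: absolutely_integrable_on_def algebra_simps)
    then show ?thesis using weak[OF \<phi>] integral_by_parts_test_function[OF G \<phi>] by simp
  qed
  from du_bois_reymond_constant[OF fG this]
  obtain c where c: "negligible {t\<in>{0..1}. f t - G t \<noteq> c - t *\<^sub>R 0}" by blast
  have e: "{t\<in>{0..1}. f t \<noteq> c + integral {0..t} g} = {t\<in>{0..1}. f t - G t \<noteq> c - t *\<^sub>R 0}"
    by (auto simp: G_def algebra_simps)
  show ?thesis
    by (rule that[OF primitive_on_integral[OF g, of c]]) (use c in \<open>simp only: e\<close>)
qed

lemma continuous_eq_if_negligible:
  fixes f g :: "real \<Rightarrow> 'a::euclidean_space"
  assumes "continuous_on {0..1} f" "continuous_on {0..1} g" "negligible {t\<in>{0..1}. f t \<noteq> g t}"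
    and t: "t \<in> {0..1}"
  shows "f t = g t"
proof (rule ccontr)
  assume "f t \<noteq> g t"
  have cont: "continuous_on {0..1} (\<lambda>s. norm (f s - g s))" by (intro continuous_intros assms)
  have "((\<lambda>s. norm (f s - g s)) has_integral 0) {0..1}"
    by (rule has_integral_spike[OF assms(3), of _ _ "\<lambda>_. 0"]) auto
  then have "norm (f t - g t) = 0"
    using has_integral_0_cbox_imp_0[of 0 1 "\<lambda>s. norm (f s - g s)" t] cont t by simp
  then show False using \<open>f t \<noteq> g t\<close> by simp
qed

text \<open>Differentiating the splitting of \<open>\<phi>\<close> gives
  \<open>\<phi>' = \<psi>'' + J \<phi>0'\<close>. The pairing of \<open>h\<close> with
  \<open>\<phi>'\<close> is thus \<open>J\<close> times its pairing with \<open>\<phi>0'\<close>,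
  which is the hypothesis of \<open>du_bois_reymond_constant\<close>.\<close>

lemma weakly_affine:
  fixes h :: "real \<Rightarrow> 'a::euclidean_space"
  assumes h: "h absolutely_integrable_on {0..1}"
    and 0: "\<And>\<phi> :: real \<Rightarrow> real. test_function \<phi> \<Longrightarrow> integral {0..1} (\<lambda>t. nth_vderiv 2 \<phi> t *\<^sub>R h t) = 0"
  obtains a c where "negligible {t\<in>{0..1}. h t \<noteq> c - t *\<^sub>R a}"
proof -
  have abs1: "u absolutely_integrable_on {0..1} \<Longrightarrow> u integrable_on {0..1}" for u :: "real \<Rightarrow> 'b::euclidean_space"
    using absolutely_integrable_on_def by blast
  obtain \<phi>0 where \<phi>0: "test_function \<phi>0" and dec: "\<And>\<phi>. test_function \<phi> \<Longrightarrow>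
      \<exists>\<psi>. test_function \<psi> \<and> nth_vderiv 1 \<psi> = (\<lambda>t. \<phi> t + (- integral {0..1} \<phi>) *\<^sub>R \<phi>0 t)"
    using test_function_decomposition by blast
  define a where "a = integral {0..1} (\<lambda>t. nth_vderiv 1 \<phi>0 t *\<^sub>R h t)"
  have "integral {0..1} (\<lambda>t. nth_vderiv 1 \<phi> t *\<^sub>R h t) = (integral {0..1} \<phi>) *\<^sub>R a"
    if \<phi>: "test_function \<phi>" for \<phi> :: "real \<Rightarrow> real"
  proof -
    define J where "J = integral {0..1} \<phi>"
    obtain \<psi> where \<psi>: "test_function \<psi>" "nth_vderiv 1 \<psi> = (\<lambda>t. \<phi> t + (- J) *\<^sub>R \<phi>0 t)"
      using dec[OF \<phi>] by (auto simp: J_def)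
    have d2: "nth_vderiv 2 \<psi> = (\<lambda>t. nth_vderiv 1 \<phi> t + (- J) *\<^sub>R nth_vderiv 1 \<phi>0 t)"
    proof -
      have "nth_vderiv 2 \<psi> = nth_vderiv 1 (nth_vderiv 1 \<psi>)"
        using nth_vderiv_add[of 1 1 \<psi>] by (simp only: one_add_one)
      also have "\<dots> = (\<lambda>t. nth_vderiv 1 \<phi> t + (- J) *\<^sub>R nth_vderiv 1 \<phi>0 t)"
        unfolding \<psi>(2) by (intro nth_vderiv_add_scaled test_function_smooth \<phi> \<phi>0)
      finally show ?thesis .
    qed
    have 1: "(\<lambda>t. nth_vderiv 1 \<phi> t *\<^sub>R h t) integrable_on {0..1}" "(\<lambda>t. nth_vderiv 1 \<phi>0 t *\<^sub>R h t) integrable_on {0..1}"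
      by (intro abs1 test_function_times_integrable h test_function_nth_vderiv \<phi> \<phi>0)+
    have "0 = integral {0..1} (\<lambda>t. nth_vderiv 1 \<phi> t *\<^sub>R h t + (- J) *\<^sub>R (nth_vderiv 1 \<phi>0 t *\<^sub>R h t))"
      using 0[OF \<psi>(1)] unfolding d2 by (simp add: algebra_simps)
    also have "\<dots> = integral {0..1} (\<lambda>t. nth_vderiv 1 \<phi> t *\<^sub>R h t) + (- J) *\<^sub>R integral {0..1} (\<lambda>t. nth_vderiv 1 \<phi>0 t *\<^sub>R h t)"
      by (rule integral_add_scaled[OF 1])
    also have "\<dots> = integral {0..1} (\<lambda>t. nth_vderiv 1 \<phi> t *\<^sub>R h t) - J *\<^sub>R a"
      by (simp add: a_def)
    finally show ?thesis by (simp add: J_def)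
  qed
  from du_bois_reymond_constant[OF h this] show ?thesis using that by blast
qed

lemma is_weak_deriv_integral:
  fixes f g :: "real \<Rightarrow> 'a::euclidean_space"
  assumes fg: "is_weak_deriv n f g" and f: "f absolutely_integrable_on {0..1}"
    and g: "g absolutely_integrable_on {0..1}" and \<phi>: "test_function (\<phi> :: real \<Rightarrow> real)"
  shows "integral {0..1} (\<lambda>t. nth_vderiv n \<phi> t *\<^sub>R f t) = (-1) ^ n *\<^sub>R integral {0..1} (\<lambda>t. \<phi> t *\<^sub>R g t)"
proof -
  have "(LINT t|lebesgue_on {0<..<1}. nth_vderiv n \<phi> t *\<^sub>R f t)
      = (-1) ^ n *\<^sub>R (LINT t|lebesgue_on {0<..<1}. \<phi> t *\<^sub>R g t)"
    using fg \<phi> by (simp add: is_weak_deriv_def)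
  then show ?thesis
    by (simp add: lint_open01[OF test_function_times_integrable[OF f test_function_nth_vderiv[OF \<phi>]]]
        lint_open01[OF test_function_times_integrable[OF g \<phi>]])
qed

lemma is_weak_derivI:
  fixes f g :: "real \<Rightarrow> 'a::euclidean_space"
  assumes f: "f absolutely_integrable_on {0..1}" and g: "g absolutely_integrable_on {0..1}"
    and "\<And>\<phi> :: real \<Rightarrow> real. test_function \<phi> \<Longrightarrow>
      integral {0..1} (\<lambda>t. nth_vderiv n \<phi> t *\<^sub>R f t) = (-1) ^ n *\<^sub>R integral {0..1} (\<lambda>t. \<phi> t *\<^sub>R g t)"
  shows "is_weak_deriv n f g"
  unfolding is_weak_deriv_def
proof (intro conjI allI impI locally_integrable_if_integrable f g)
  fix \<phi> :: "real \<Rightarrow> real" assume \<phi>: "test_function \<phi>"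
  show "(LINT t|lebesgue_on {0<..<1}. nth_vderiv n \<phi> t *\<^sub>R f t)
      = (-1) ^ n *\<^sub>R (LINT t|lebesgue_on {0<..<1}. \<phi> t *\<^sub>R g t)"
    using assms(3)[OF \<phi>]
    by (simp add: lint_open01[OF test_function_times_integrable[OF f test_function_nth_vderiv[OF \<phi>]]]
      lint_open01[OF test_function_times_integrable[OF g \<phi>]])
qed

lemma is_weak_deriv_unique:
  fixes f g h :: "real \<Rightarrow> 'a::euclidean_space"
  assumes g: "is_weak_deriv n f g" and h: "is_weak_deriv n f h"
  shows "negligible {t\<in>{0..1}. g t \<noteq> h t}"
proof -
  have gh: "locally_integrable g" "locally_integrable h" using g h by (auto simp: is_weak_deriv_def)
  have "negligible {t\<in>{0<..<1}. g t - h t \<noteq> 0}"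
  proof (rule fundamental_lemma)
    show "locally_integrable (\<lambda>t. g t - h t)" using gh by (simp add: locally_integrable_def)
    fix \<phi> :: "real \<Rightarrow> real" assume \<phi>: "test_function \<phi>"
    have i: "integrable (lebesgue_on {0<..<1}) (\<lambda>t. \<phi> t *\<^sub>R g t)"
      "integrable (lebesgue_on {0<..<1}) (\<lambda>t. \<phi> t *\<^sub>R h t)"
      using locally_integrable_times_test_function[OF gh(1) \<phi>] locally_integrable_times_test_function[OF gh(2) \<phi>]
      by (auto intro: absolutely_integrable_imp_integrable)
    have "(-1) ^ n *\<^sub>R (LINT t|lebesgue_on {0<..<1}. \<phi> t *\<^sub>R g t) = (-1) ^ n *\<^sub>R (LINT t|lebesgue_on {0<..<1}. \<phi> t *\<^sub>R h t)"
      using g h \<phi> by (simp add: is_weak_deriv_def)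
    then have "(LINT t|lebesgue_on {0<..<1}. \<phi> t *\<^sub>R g t) = (LINT t|lebesgue_on {0<..<1}. \<phi> t *\<^sub>R h t)"
      by simp
    then show "(LINT t|lebesgue_on {0<..<1}. \<phi> t *\<^sub>R (g t - h t)) = 0"
      using Bochner_Integration.integral_diff[OF i] by (simp add: scaleR_diff_right)
  qed
  then show ?thesis using negligible_open01_iff[of "\<lambda>t. g t \<noteq> h t"] by simp
qed

lemma in_Lp_integrable:
  fixes f :: "real \<Rightarrow> 'a::euclidean_space"
  assumes p: "1 \<le> p" and f: "in_Lp p f"
  shows "f absolutely_integrable_on {0..1}" "(\<lambda>t. norm (f t) powr p) absolutely_integrable_on {0..1}"
proof -
  show 1: "(\<lambda>t. norm (f t) powr p) absolutely_integrable_on {0..1}"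
    using f by (simp add: in_Lp_def integrable_lebesgue_on_open01)
  have "f absolutely_integrable_on {0<..<1}"
  proof (rule measurable_bounded_by_integrable_imp_absolutely_integrable)
    show "f \<in> borel_measurable (lebesgue_on {0<..<1})" using f by (simp add: in_Lp_def)
    have "(\<lambda>t. 1 + norm (f t) powr p) absolutely_integrable_on {0..1}"
      by (intro set_integral_add 1) (auto intro: absolutely_integrable_on_const)
    then show "(\<lambda>t. 1 + norm (f t) powr p) integrable_on {0<..<1}"
      by (metis absolutely_integrable_on_def absolutely_integrable_open01)
    show "norm (f t) \<le> 1 + norm (f t) powr p" for t
    proof (cases "norm (f t) \<le> 1")
      case False
      then have "norm (f t) powr 1 \<le> norm (f t) powr p" using p by (intro powr_mono) auto
      then show ?thesis using False by simp
    qed (smt (verit) powr_ge_zero)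
  qed simp
  then show "f absolutely_integrable_on {0..1}" by (simp add: absolutely_integrable_open01)
qed

text \<open>Testing against \<open>\<phi>'\<close> shows that the second weak derivative is the weak
  derivative of the first. Hence the first has an absolutely continuous representative
  \<open>V\<close>, and the continuous \<open>\<gamma>\<close>, being a primitive of it, is C^1 up
  to the endpoints.\<close>

lemma Sobolev_regularity:
  fixes \<gamma> :: "real \<Rightarrow> 'a::euclidean_space"
  assumes p: "1 \<le> p" and \<gamma>: "in_Sobolev 2 p \<gamma>" and cont: "continuous_on {0..1} \<gamma>"
  obtains V g where "primitive_on {0..1} V g" "in_Lp p g" "is_weak_deriv 2 \<gamma> g"
    "\<And>t. t \<in> {0..1} \<Longrightarrow> (\<gamma> has_vector_derivative V t) (at t within {0..1})"
proof -
  obtain g1 where g1: "is_weak_deriv 1 \<gamma> g1" "in_Lp p g1"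
    using \<gamma> unfolding in_Sobolev_def by (meson one_le_numeral)
  obtain g where g: "is_weak_deriv 2 \<gamma> g" "in_Lp p g"
    using \<gamma> unfolding in_Sobolev_def by (meson order_refl)
  have \<gamma>a: "\<gamma> absolutely_integrable_on {0..1}" using cont by (rule absolutely_integrable_continuous_real)
  have g1a: "g1 absolutely_integrable_on {0..1}" and ga: "g absolutely_integrable_on {0..1}"
    using in_Lp_integrable(1)[OF p] g1(2) g(2) by blast+
  have w1: "integral {0..1} (\<lambda>t. nth_vderiv 1 \<phi> t *\<^sub>R \<gamma> t) = - integral {0..1} (\<lambda>t. \<phi> t *\<^sub>R g1 t)"
    if "test_function \<phi>" for \<phi> :: "real \<Rightarrow> real"
    using is_weak_deriv_integral[OF g1(1) \<gamma>a g1a that] by simp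
  have w2: "integral {0..1} (\<lambda>t. nth_vderiv 1 \<phi> t *\<^sub>R g1 t) = - integral {0..1} (\<lambda>t. \<phi> t *\<^sub>R g t)"
    if \<phi>: "test_function \<phi>" for \<phi> :: "real \<Rightarrow> real"
  proof -
    have "nth_vderiv 1 (nth_vderiv 1 \<phi>) = nth_vderiv 2 \<phi>"
      using nth_vderiv_add[of 1 1 \<phi>] by (simp only: one_add_one)
    then show ?thesis
      using is_weak_deriv_integral[OF g(1) \<gamma>a ga \<phi>] w1[OF test_function_nth_vderiv[OF \<phi>, of 1]] by simp
  qed
  from primitive_on_if_weak[OF g1a ga w2]
  obtain V where V: "primitive_on {0..1} V g" "negligible {t\<in>{0..1}. g1 t \<noteq> V t}" by blast
  from primitive_on_if_weak[OF \<gamma>a g1a w1]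
  obtain F where F: "primitive_on {0..1} F g1" "negligible {t\<in>{0..1}. \<gamma> t \<noteq> F t}" by blast
  have FV: "primitive_on {0..1} F V"
    by (rule primitive_on_spike[OF F(1) V(2)]) auto
  have \<gamma>F: "\<gamma> t = F t" if "t \<in> {0..1}" for t
    by (rule continuous_eq_if_negligible[OF cont primitive_on_continuous[OF F(1)] F(2) that])
  have "(\<gamma> has_vector_derivative V t) (at t within {0..1})" if t: "t \<in> {0..1}" for t
    by (rule has_vector_derivative_transform[OF t \<gamma>F])
      (use primitive_on_has_vector_derivative[OF FV primitive_on_continuous[OF V(1)] t] in auto)
  then show ?thesis using that V(1) g by blast
qed

lemma is_weak_deriv_add_test_function:
  fixes f g \<eta> :: "real \<Rightarrow> 'a::euclidean_space"
  assumes fg: "is_weak_deriv 2 f g" and f: "f absolutely_integrable_on {0..1}"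
    and g: "g absolutely_integrable_on {0..1}" and \<eta>: "test_function \<eta>"
  shows "is_weak_deriv 2 (\<lambda>t. f t + c *\<^sub>R \<eta> t) (\<lambda>t. g t + c *\<^sub>R nth_vderiv 2 \<eta> t)"
proof (rule is_weak_derivI)
  have \<eta>a: "nth_vderiv n \<eta> absolutely_integrable_on {0..1}" for n
    by (intro test_function_absolutely_integrable test_function_nth_vderiv \<eta>)
  have \<eta>a0: "\<eta> absolutely_integrable_on {0..1}"
    by (intro test_function_absolutely_integrable \<eta>)
  show "(\<lambda>t. f t + c *\<^sub>R \<eta> t) absolutely_integrable_on {0..1}"
    "(\<lambda>t. g t + c *\<^sub>R nth_vderiv 2 \<eta> t) absolutely_integrable_on {0..1}"
    using f g \<eta>a \<eta>a0 by (auto intro!: set_integral_add absolutely_integrable_scaleR_left)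
  fix \<phi> :: "real \<Rightarrow> real" assume \<phi>: "test_function \<phi>"
  have prim: "primitive_on {0..1} (nth_vderiv n \<eta>) (nth_vderiv (Suc n) \<eta>)" for n
    by (rule primitive_on_if_has_vector_derivative)
       (auto intro!: has_vector_derivative_at_within smooth_has_vector_derivative
          smooth_continuous_on test_function_smooth \<eta>)
  have abs1: "u absolutely_integrable_on {0..1} \<Longrightarrow> u integrable_on {0..1}" for u :: "real \<Rightarrow> 'a"
    using absolutely_integrable_on_def by blast
  have ii: "(\<lambda>t. nth_vderiv n \<phi> t *\<^sub>R u t) integrable_on {0..1}"
    if "u absolutely_integrable_on {0..1}" for u :: "real \<Rightarrow> 'a" and n
    by (intro abs1 test_function_times_integrable test_function_nth_vderiv \<phi> that)
  have dd: "nth_vderiv 2 \<phi> = nth_vderiv 1 (nth_vderiv 1 \<phi>)"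
    using nth_vderiv_add[of 1 1 \<phi>] by (simp only: one_add_one)
  have "integral {0..1} (\<lambda>t. nth_vderiv 2 \<phi> t *\<^sub>R \<eta> t) = - integral {0..1} (\<lambda>t. nth_vderiv 1 \<phi> t *\<^sub>R nth_vderiv 1 \<eta> t)"
    unfolding dd using integral_by_parts_test_function[OF prim[of 0] test_function_nth_vderiv[OF \<phi>, of 1]]
    by simp
  also have "\<dots> = integral {0..1} (\<lambda>t. \<phi> t *\<^sub>R nth_vderiv 2 \<eta> t)"
    using integral_by_parts_test_function[OF prim[of 1] \<phi>] by (simp add: numeral_2_eq_2)
  finally have e: "integral {0..1} (\<lambda>t. nth_vderiv 2 \<phi> t *\<^sub>R \<eta> t) = integral {0..1} (\<lambda>t. \<phi> t *\<^sub>R nth_vderiv 2 \<eta> t)" .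
  have "integral {0..1} (\<lambda>t. nth_vderiv 2 \<phi> t *\<^sub>R (f t + c *\<^sub>R \<eta> t))
      = integral {0..1} (\<lambda>t. nth_vderiv 2 \<phi> t *\<^sub>R f t + c *\<^sub>R (nth_vderiv 2 \<phi> t *\<^sub>R \<eta> t))"
    by (simp add: algebra_simps)
  also have "\<dots> = integral {0..1} (\<lambda>t. nth_vderiv 2 \<phi> t *\<^sub>R f t) + c *\<^sub>R integral {0..1} (\<lambda>t. nth_vderiv 2 \<phi> t *\<^sub>R \<eta> t)"
    by (rule integral_add_scaled[OF ii[OF f] ii[OF \<eta>a0]])
  also have "\<dots> = integral {0..1} (\<lambda>t. \<phi> t *\<^sub>R g t) + c *\<^sub>R integral {0..1} (\<lambda>t. \<phi> t *\<^sub>R nth_vderiv 2 \<eta> t)"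
    using is_weak_deriv_integral[OF fg f g \<phi>] e by simp
  also have "\<dots> = integral {0..1} (\<lambda>t. \<phi> t *\<^sub>R g t + c *\<^sub>R (\<phi> t *\<^sub>R nth_vderiv 2 \<eta> t))"
    using integral_add_scaled[OF ii[OF g, of 0] ii[OF \<eta>a, of 0 2], of c] by simp
  also have "\<dots> = integral {0..1} (\<lambda>t. \<phi> t *\<^sub>R (g t + c *\<^sub>R nth_vderiv 2 \<eta> t))"
    by (simp add: algebra_simps)
  finally show "integral {0..1} (\<lambda>t. nth_vderiv 2 \<phi> t *\<^sub>R (f t + c *\<^sub>R \<eta> t))
      = (-1) ^ 2 *\<^sub>R integral {0..1} (\<lambda>t. \<phi> t *\<^sub>R (g t + c *\<^sub>R nth_vderiv 2 \<eta> t))" by simp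
qed

text \<open>Differentiation under the integral sign: the mean value inequality bounds all difference
  quotients by \<open>h\<close>, so dominated convergence applies along every sequence tending to
  0.\<close>

lemma has_real_derivative_integral:
  fixes f f' :: "real \<Rightarrow> real \<Rightarrow> real"
  assumes \<delta>: "0 < \<delta>"
    and f: "\<And>\<epsilon>. \<bar>\<epsilon>\<bar> < \<delta> \<Longrightarrow> f \<epsilon> absolutely_integrable_on {0..1}"
    and deriv: "\<And>\<epsilon> t. \<bar>\<epsilon>\<bar> < \<delta> \<Longrightarrow> t \<in> {0..1} \<Longrightarrow> ((\<lambda>\<epsilon>. f \<epsilon> t) has_real_derivative f' \<epsilon> t) (at \<epsilon>)"
    and bound: "\<And>\<epsilon> t. \<bar>\<epsilon>\<bar> < \<delta> \<Longrightarrow> t \<in> {0..1} \<Longrightarrow> \<bar>f' \<epsilon> t\<bar> \<le> h t"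
    and h: "h absolutely_integrable_on {0..1}"
  shows "((\<lambda>\<epsilon>. integral {0..1} (f \<epsilon>)) has_real_derivative integral {0..1} (f' 0)) (at 0)"
    and "f' 0 absolutely_integrable_on {0..1}"
proof -
  have int: "f \<epsilon> integrable_on {0..1}" if "\<bar>\<epsilon>\<bar> < \<delta>" for \<epsilon>
    using f[OF that] absolutely_integrable_on_def by blast
  have hi: "h integrable_on {0..1}" using h absolutely_integrable_on_def by blast
  have quot: "\<bar>(f \<epsilon> t - f 0 t) / \<epsilon>\<bar> \<le> h t" if \<epsilon>: "\<bar>\<epsilon>\<bar> < \<delta>" "\<epsilon> \<noteq> 0" and t: "t \<in> {0..1}" for \<epsilon> t
  proof -
    have "norm (f \<epsilon> t - f 0 t) \<le> h t * norm (\<epsilon> - 0)"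
    proof (rule field_differentiable_bound[where S="{-\<delta><..<\<delta>}" and f'="\<lambda>\<epsilon>. f' \<epsilon> t"])
      show "((\<lambda>\<epsilon>. f \<epsilon> t) has_field_derivative f' z t) (at z within {-\<delta><..<\<delta>})" if "z \<in> {-\<delta><..<\<delta>}" for z
        using deriv[of z t] that t by (auto intro: has_field_derivative_at_within)
      show "norm (f' z t) \<le> h t" if "z \<in> {-\<delta><..<\<delta>}" for z
        using bound[of z t] that t by auto
    qed (use \<epsilon> \<delta> in auto)
    then show ?thesis using \<epsilon> by (simp add: field_simps abs_divide)
  qed
  have seq: "(\<lambda>n. integral {0..1} (\<lambda>t. (f (X n) t - f 0 t) / X n)) \<longlonglongrightarrow> integral {0..1} (f' 0) \<and> f' 0 integrable_on {0..1}"
    if X: "X \<longlonglongrightarrow> 0" "\<And>n. \<bar>X n\<bar> < \<delta>" "\<And>n. X n \<noteq> 0" for X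
  proof (rule conjI)
    have 1: "(\<lambda>t. (f (X n) t - f 0 t) / X n) integrable_on {0..1}" for n
      by (intro integrable_on_divide Henstock_Kurzweil_Integration.integrable_diff int X(2)) (simp add: \<delta>)
    have 2: "(\<lambda>n. (f (X n) t - f 0 t) / X n) \<longlonglongrightarrow> f' 0 t" if t: "t \<in> {0..1}" for t
    proof -
      have "((\<lambda>\<epsilon>. (f \<epsilon> t - f 0 t) / (\<epsilon> - 0)) \<longlongrightarrow> f' 0 t) (at 0)"
        using deriv[of 0 t] t \<delta> by (simp add: has_field_derivative_iff)
      then show ?thesis
        using X(1,3) unfolding tendsto_at_iff_sequentially by (auto simp: o_def)
    qed
    show "f' 0 integrable_on {0..1}"
      by (rule dominated_convergence(1)[OF 1 hi _ 2]) (use quot X in auto)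
    show "(\<lambda>n. integral {0..1} (\<lambda>t. (f (X n) t - f 0 t) / X n)) \<longlonglongrightarrow> integral {0..1} (f' 0)"
      by (rule dominated_convergence(2)[OF 1 hi _ 2]) (use quot X in auto)
  qed
  \<comment> \<open>One explicit admissible sequence suffices here; \<open>f' 0\<close> is
    integrable as a dominated limit of difference quotients.\<close>
  have "f' 0 integrable_on {0..1}"
  proof (rule conjunct2[OF seq[of "\<lambda>n. \<delta> / 2 * inverse (real (Suc n))"]])
    have "(\<lambda>n. \<delta> / 2 * inverse (real (Suc n))) \<longlonglongrightarrow> \<delta> / 2 * 0"
      by (intro tendsto_intros LIMSEQ_inverse_real_of_nat)
    then show "(\<lambda>n. \<delta> / 2 * inverse (real (Suc n))) \<longlonglongrightarrow> 0" by simp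
    fix n
    have "inverse (real (Suc n)) \<le> 1" "0 < inverse (real (Suc n))" by (auto simp: field_simps)
    then have "\<delta> / 2 * inverse (real (Suc n)) \<le> \<delta> / 2 * 1" "0 < \<delta> / 2 * inverse (real (Suc n))"
      using \<delta> by (auto intro: mult_left_mono)
    then show "\<bar>\<delta> / 2 * inverse (real (Suc n))\<bar> < \<delta>" "\<delta> / 2 * inverse (real (Suc n)) \<noteq> 0"
      using \<delta> by linarith+
  qed
  then show "f' 0 absolutely_integrable_on {0..1}"
    by (rule absolutely_integrable_integrable_bound[OF _ _ hi, rotated]) (use bound \<delta> in auto)
  have "((\<lambda>\<epsilon>. (integral {0..1} (f \<epsilon>) - integral {0..1} (f 0)) / (\<epsilon> - 0)) \<longlongrightarrow> integral {0..1} (f' 0)) (at 0)"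
    unfolding tendsto_at_iff_sequentially
  proof (intro allI impI)
    fix X :: "nat \<Rightarrow> real" assume X: "\<forall>i. X i \<in> UNIV - {0}" "X \<longlonglongrightarrow> 0"
    have "\<forall>\<^sub>F n in sequentially. \<bar>X n\<bar> < \<delta>"
      using X(2) \<delta> by (auto simp: tendsto_iff dist_real_def)
    then obtain k where k: "\<And>n. k \<le> n \<Longrightarrow> \<bar>X n\<bar> < \<delta>" by (auto simp: eventually_sequentially)
    have "(\<lambda>n. integral {0..1} (\<lambda>t. (f (X (n + k)) t - f 0 t) / X (n + k))) \<longlonglongrightarrow> integral {0..1} (f' 0)"
      using X k by (intro conjunct1[OF seq[of "\<lambda>n. X (n + k)"]]) (auto intro: LIMSEQ_ignore_initial_segment)
    moreover have eq: "integral {0..1} (\<lambda>t. (f (X (n + k)) t - f 0 t) / X (n + k)) =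
        (integral {0..1} (f (X (n + k))) - integral {0..1} (f 0)) / X (n + k)" for n
      using Henstock_Kurzweil_Integration.integral_diff[OF int[OF k] int[of 0], of "n + k"] \<delta> by simp
    ultimately have "(\<lambda>n. (integral {0..1} (f (X (n + k))) - integral {0..1} (f 0)) / X (n + k)) \<longlonglongrightarrow> integral {0..1} (f' 0)"
      unfolding eq by simp
    then have "(\<lambda>n. (integral {0..1} (f (X n)) - integral {0..1} (f 0)) / X n) \<longlonglongrightarrow> integral {0..1} (f' 0)"
      by (rule LIMSEQ_offset)
    then show "((\<lambda>\<epsilon>. (integral {0..1} (f \<epsilon>) - integral {0..1} (f 0)) / (\<epsilon> - 0)) \<circ> X) \<longlonglongrightarrow> integral {0..1} (f' 0)"
      by (simp add: o_def)
  qed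
  then show "((\<lambda>\<epsilon>. integral {0..1} (f \<epsilon>)) has_real_derivative integral {0..1} (f' 0)) (at 0)"
    by (simp add: has_field_derivative_iff)
qed

section \<open>First variation and Euler--Lagrange equation\<close>

definition spow :: "real \<Rightarrow> real \<Rightarrow> real" where
  "spow a x = sgn x * \<bar>x\<bar> powr a"

text \<open>Away from 0 this is the usual rule on each side; at 0 the quotient is bounded by
  \<open>\<bar>h\<bar> powr (p - 1)\<close>, which tends to 0 because \<open>1 < p\<close>.\<close>

lemma abs_powr_has_derivative:
  assumes p: "1 < p"
  shows "((\<lambda>x. \<bar>x\<bar> powr p) has_real_derivative p * spow (p - 1) x) (at x)"
proof -
  consider "x < 0" | "x = 0" | "0 < x" by linarith
  then show ?thesis
  proof cases
    case 1
    have "((\<lambda>x. (- x) powr p) has_real_derivative p * (- x) powr (p - 1) * (- 1)) (at x)"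
      using 1 by (auto intro!: derivative_eq_intros)
    then have "((\<lambda>x. \<bar>x\<bar> powr p) has_real_derivative p * (- x) powr (p - 1) * (- 1)) (at x)"
      by (rule has_field_derivative_transform_within_open[of _ _ _ "{..<0}"]) (use 1 in auto)
    then show ?thesis using 1 by (simp add: spow_def)
  next
    case 2
    have "((\<lambda>h. \<bar>h\<bar> powr p / h) \<longlongrightarrow> 0) (at 0)"
    proof (rule Lim_null_comparison)
      show "\<forall>\<^sub>F h in at 0. norm (\<bar>h\<bar> powr p / h) \<le> \<bar>h\<bar> powr (p - 1)"
        unfolding eventually_at_filter
        by (intro always_eventually) (auto simp: abs_divide powr_diff)
      have "((\<lambda>h. \<bar>h\<bar> powr (p - 1)) \<longlongrightarrow> \<bar>0\<bar> powr (p - 1)) (at (0::real))"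
        using p by (intro tendsto_powr' tendsto_intros) auto
      then show "((\<lambda>h. \<bar>h\<bar> powr (p - 1)) \<longlongrightarrow> 0) (at (0::real))" by simp
    qed
    then show ?thesis using 2 by (simp add: DERIV_def spow_def)
  next
    case 3
    have "((\<lambda>x. x powr p) has_real_derivative p * x powr (p - 1)) (at x)"
      using 3 by (auto intro!: derivative_eq_intros)
    then have "((\<lambda>x. \<bar>x\<bar> powr p) has_real_derivative p * x powr (p - 1)) (at x)"
      by (rule has_field_derivative_transform_within_open[of _ _ _ "{0<..}"]) (use 3 in auto)
    then show ?thesis using 3 by (simp add: spow_def)
  qed
qed

lemma abs_spow_le: "\<bar>spow a x\<bar> \<le> \<bar>x\<bar> powr a"
  by (auto simp: spow_def abs_mult sgn_if)

text \<open>The quarter turn. Through it \<open>rot u \<bullet> v\<close> is the determinant of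
  \<open>u\<close> and \<open>v\<close>, and the curvature becomes a bilinear expression divided by
  a power of the speed.\<close>

definition rot :: "real^2 \<Rightarrow> real^2" where
  "rot v = vector [- v $ 2, v $ 1]"

lemma rot_nth [simp]: "rot v $ 1 = - v $ 2" "rot v $ 2 = v $ 1"
  by (simp_all add: rot_def)

lemma bounded_linear_rot: "bounded_linear rot"
  by (rule linear_conv_bounded_linear[THEN iffD1]) (auto intro!: linearI simp: vec_eq_iff forall_2)

lemma inner_real2: "u \<bullet> v = u $ 1 * v $ 1 + u $ 2 * (v $ 2 :: real)" for u v :: "real^2"
  by (simp add: inner_vec_def sum_2)

lemma norm_rot [simp]: "norm (rot v) = norm v"
  by (simp add: norm_eq_sqrt_inner inner_real2)

lemma rot_inner_self [simp]: "rot v \<bullet> v = 0" "v \<bullet> rot v = 0"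
  by (simp_all add: inner_real2)

lemma rot_inner_rot [simp]: "rot u \<bullet> rot v = u \<bullet> v"
  by (simp add: inner_real2)

lemma rot_rot [simp]: "rot (rot v) = - v"
  by (simp add: vec_eq_iff forall_2)

lemma bounded_bilinear_cross: "bounded_bilinear (\<lambda>u v. rot u \<bullet> v)"
  using bounded_bilinear.comp1[OF bounded_bilinear_inner bounded_linear_rot] by simp

lemma abs_cross_le: "\<bar>rot u \<bullet> v\<bar> \<le> norm u * norm v"
  using Cauchy_Schwarz_ineq2[of "rot u" v] by simp

lemma curvature_eq:
  "curvature \<gamma> t = rot (velocity \<gamma> t) \<bullet> weak_deriv 2 \<gamma> t / norm (velocity \<gamma> t) ^ 3"
  by (simp add: curvature_def inner_real2)

lemma norm_powr_eq_inner_powr: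
  fixes v :: "'a::real_inner"
  shows "norm v powr (2 * b) = (v \<bullet> v) powr b"
proof (cases "v = 0")
  case False
  have "v \<bullet> v = norm v powr 2" using False by (simp add: power2_norm_eq_inner)
  then show ?thesis by (simp only: powr_powr)
qed simp

text \<open>Along a variation of the curve, the determinant and \<open>v \<bullet> v\<close> are
  polynomials in \<epsilon>, so this form can be differentiated. The exponent collects one factor
  \<open>norm v\<close> from the line element and \<open>3 * p\<close> from the denominator.\<close>

lemma energy_integrand:
  fixes v w :: "real^2"
  assumes "v \<noteq> 0"
  shows "\<bar>rot v \<bullet> w / norm v ^ 3\<bar> powr p * norm v = \<bar>rot v \<bullet> w\<bar> powr p * (v \<bullet> v) powr ((1 - 3 * p) / 2)"
proof -
  have "\<bar>rot v \<bullet> w / norm v ^ 3\<bar> powr p * norm v = \<bar>rot v \<bullet> w\<bar> powr p * (norm v powr 1 / (norm v powr 3) powr p)"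
    using assms by (simp add: abs_divide powr_divide)
  also have "norm v powr 1 / (norm v powr 3) powr p = norm v powr (2 * ((1 - 3 * p) / 2))"
  proof -
    have e: "2 * ((1 - 3 * p) / 2) = 1 - 3 * p" by simp
    show ?thesis unfolding e by (simp only: powr_powr powr_diff[symmetric])
  qed
  finally show ?thesis by (simp only: norm_powr_eq_inner_powr)
qed

text \<open>\<open>weak_deriv\<close> selects some representative. The explicit one shows that there
  is something to select, and uniqueness makes the two agree off a null set, which may depend on
  \<open>c\<close>.\<close>

lemma weak_deriv_2_add_test_function:
  fixes \<gamma> g \<eta> :: "real \<Rightarrow> real^2"
  assumes "is_weak_deriv 2 \<gamma> g" "\<gamma> absolutely_integrable_on {0..1}" "g absolutely_integrable_on {0..1}"
    and "test_function \<eta>"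
  shows "negligible {t\<in>{0..1}. weak_deriv 2 (\<lambda>t. \<gamma> t + c *\<^sub>R \<eta> t) t \<noteq> g t + c *\<^sub>R nth_vderiv 2 \<eta> t}"
proof -
  have w: "is_weak_deriv 2 (\<lambda>t. \<gamma> t + c *\<^sub>R \<eta> t) (\<lambda>t. g t + c *\<^sub>R nth_vderiv 2 \<eta> t)"
    by (rule is_weak_deriv_add_test_function[OF assms])
  then have "is_weak_deriv 2 (\<lambda>t. \<gamma> t + c *\<^sub>R \<eta> t) (weak_deriv 2 (\<lambda>t. \<gamma> t + c *\<^sub>R \<eta> t))"
    unfolding weak_deriv_def by (rule someI[of "is_weak_deriv 2 (\<lambda>t. \<gamma> t + c *\<^sub>R \<eta> t)"])
  then show ?thesis using w by (rule is_weak_deriv_unique)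
qed

lemma velocity_add_test_function:
  fixes \<gamma> \<eta> :: "real \<Rightarrow> real^2"
  assumes "(\<gamma> has_vector_derivative V t) (at t within {0..1})" "test_function \<eta>" "t \<in> {0..1}"
  shows "velocity (\<lambda>t. \<gamma> t + c *\<^sub>R \<eta> t) t = V t + c *\<^sub>R nth_vderiv 1 \<eta> t"
proof (rule vector_derivative_within_closed_interval)
  have "(\<eta> has_vector_derivative nth_vderiv 1 \<eta> t) (at t within {0..1})"
    using smooth_has_vector_derivative[OF test_function_smooth[OF assms(2)], of 0 t]
    by (simp add: has_vector_derivative_at_within)
  then show "((\<lambda>t. \<gamma> t + c *\<^sub>R \<eta> t) has_vector_derivative V t + c *\<^sub>R nth_vderiv 1 \<eta> t) (at t within {0..1})"
    by (intro has_vector_derivative_add assms(1)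
        bounded_linear.has_vector_derivative[OF bounded_linear_scaleR_right])
qed (use assms(3) in auto)

lemma cross_measurable:
  fixes u v :: "real \<Rightarrow> real^2"
  assumes "u \<in> borel_measurable (lebesgue_on {0..1})" "v \<in> borel_measurable (lebesgue_on {0..1})"
  shows "(\<lambda>t. rot (u t) \<bullet> v t) \<in> borel_measurable (lebesgue_on {0..1})"
  by (rule borel_measurable_bilinear[of "\<lambda>u v. rot u \<bullet> v"])
     (use assms in \<open>auto simp: bilinear_conv_bounded_bilinear bounded_bilinear_cross\<close>)

lemma abs_measurable_bound:
  fixes f :: "real \<Rightarrow> 'a::euclidean_space"
  assumes "f \<in> borel_measurable (lebesgue_on {0..1})" "h absolutely_integrable_on {0..1}"
    and "\<And>t. t \<in> {0..1} \<Longrightarrow> norm (f t) \<le> h t"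
  shows "f absolutely_integrable_on {0..1}"
  by (rule measurable_bounded_by_integrable_imp_absolutely_integrable[of _ _ h])
     (use assms absolutely_integrable_on_def in auto)

text \<open>Differentiation under the integral sign. The delicate point is the majorant: for small
  \<epsilon> the speed stays away from 0, and every term of the derivative grows at most like a
  power \<open>p\<close> of \<open>1 + norm (g t)\<close>. \<open>A\<close> collects the coefficient
  of \<open>\<eta>2\<close>, \<open>B\<close> that of \<open>\<eta>1\<close>.\<close>

lemma first_variation:
  fixes V g \<eta>1 \<eta>2 :: "real \<Rightarrow> real^2" and p \<mu> :: real
  defines "b \<equiv> (1 - 3 * p) / 2"
  defines "f \<equiv> \<lambda>\<epsilon> t. \<bar>rot (V t + \<epsilon> *\<^sub>R \<eta>1 t) \<bullet> (g t + \<epsilon> *\<^sub>R \<eta>2 t)\<bar> powr p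
        * ((V t + \<epsilon> *\<^sub>R \<eta>1 t) \<bullet> (V t + \<epsilon> *\<^sub>R \<eta>1 t)) powr b
      + \<mu> * ((V t + \<epsilon> *\<^sub>R \<eta>1 t) \<bullet> (V t + \<epsilon> *\<^sub>R \<eta>1 t)) powr (1/2)"
  defines "A \<equiv> \<lambda>t. (p * spow (p - 1) (rot (V t) \<bullet> g t) * (V t \<bullet> V t) powr b) *\<^sub>R rot (V t)"
  defines "B \<equiv> \<lambda>t. (\<bar>rot (V t) \<bullet> g t\<bar> powr p * (2 * b * (V t \<bullet> V t) powr (b - 1)) + \<mu> * (V t \<bullet> V t) powr (- 1/2)) *\<^sub>R V t
      - (p * spow (p - 1) (rot (V t) \<bullet> g t) * (V t \<bullet> V t) powr b) *\<^sub>R rot (g t)"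
  assumes p: "1 < p" and V: "continuous_on {0..1} V" "\<And>t. t \<in> {0..1} \<Longrightarrow> V t \<noteq> 0"
    and g: "in_Lp p g"
    and \<eta>: "continuous_on {0..1} \<eta>1" "continuous_on {0..1} \<eta>2"
  shows "((\<lambda>\<epsilon>. integral {0..1} (f \<epsilon>)) has_real_derivative
      integral {0..1} (\<lambda>t. A t \<bullet> \<eta>2 t + B t \<bullet> \<eta>1 t)) (at 0)"
    and "A absolutely_integrable_on {0..1}" "B absolutely_integrable_on {0..1}"
    and "\<exists>\<delta>>0. \<forall>\<epsilon>. \<bar>\<epsilon>\<bar> < \<delta> \<longrightarrow> f \<epsilon> absolutely_integrable_on {0..1} \<and> (\<forall>t\<in>{0..1}. V t + \<epsilon> *\<^sub>R \<eta>1 t \<noteq> 0)"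
proof -
  have ga: "g absolutely_integrable_on {0..1}" "(\<lambda>t. norm (g t) powr p) absolutely_integrable_on {0..1}"
    using in_Lp_integrable[OF _ g] p by auto
  have gm: "g \<in> borel_measurable (lebesgue_on {0..1})"
    using ga(1) absolutely_integrable_measurable[of "{0..1}" g] by simp
  have cm: "u \<in> borel_measurable (lebesgue_on {0..1})" if "continuous_on {0..1} u" for u :: "real \<Rightarrow> real^2"
    by (rule continuous_imp_measurable_on_sets_lebesgue[OF that]) simp
  have bdd: "\<exists>M\<ge>1. \<forall>t\<in>{0..1}. norm (u t) \<le> M" if u: "continuous_on {0..1} u" for u :: "real \<Rightarrow> real^2"
  proof -
    have "bounded (u ` {0..1})" by (intro compact_imp_bounded compact_continuous_image u) simp
    then obtain M where "\<forall>x\<in>u ` {0..1}. norm x \<le> M" by (auto simp only: bounded_iff)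
    then show ?thesis by (intro exI[of _ "max 1 M"]) (auto simp: le_max_iff_disj)
  qed
  obtain M1 M2 M3 where M0: "M1 \<ge> 1" "\<forall>t\<in>{0..1}. norm (V t) \<le> M1" "M2 \<ge> 1" "\<forall>t\<in>{0..1}. norm (\<eta>1 t) \<le> M2"
    "M3 \<ge> 1" "\<forall>t\<in>{0..1}. norm (\<eta>2 t) \<le> M3"
    using bdd[OF V(1)] bdd[OF \<eta>(1)] bdd[OF \<eta>(2)] by blast
  define M where "M = M1 + M2 + M3"
  have M: "1 \<le> M" "\<And>t. t \<in> {0..1} \<Longrightarrow> norm (V t) \<le> M" "\<And>t. t \<in> {0..1} \<Longrightarrow> norm (\<eta>1 t) \<le> M"
      "\<And>t. t \<in> {0..1} \<Longrightarrow> norm (\<eta>2 t) \<le> M"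
    using M0 by (force simp: M_def)+
  obtain t0 where t0: "t0 \<in> {0..1}" "\<And>t. t \<in> {0..1} \<Longrightarrow> norm (V t0) \<le> norm (V t)"
  proof -
    have "continuous_on {0..1} (\<lambda>t. norm (V t))" by (intro continuous_on_norm V)
    then have "\<exists>x\<in>{0..1}. \<forall>y\<in>{0..1}. norm (V x) \<le> norm (V y)"
      by (intro continuous_attains_inf) auto
    then show ?thesis using that by blast
  qed
  \<comment> \<open>Half of the least speed, so that a perturbation of the velocity by at most
    \<open>m\<close> leaves a speed of at least \<open>m\<close>.\<close>
  define m where "m = norm (V t0) / 2"
  have m: "0 < m" "\<And>t. t \<in> {0..1} \<Longrightarrow> 2 * m \<le> norm (V t)"
    using t0 V(2) by (auto simp: m_def)
  \<comment> \<open>Keeps \<open>\<epsilon> *\<^sub>R \<eta>1 t\<close> below \<open>m\<close>,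
    hence the varied speed above \<open>m\<close>; the bound 1 serves the upper estimates.\<close>
  define \<delta> where "\<delta> = min 1 (m / M)"
  have \<delta>: "0 < \<delta>" using m(1) M(1) by (simp add: \<delta>_def)
  define W where "W = (\<lambda>\<epsilon> t. V t + \<epsilon> *\<^sub>R \<eta>1 t)"
  define n where "n = (\<lambda>\<epsilon> t. W \<epsilon> t \<bullet> W \<epsilon> t)"
  define D where "D = (\<lambda>\<epsilon> t. rot (W \<epsilon> t) \<bullet> (g t + \<epsilon> *\<^sub>R \<eta>2 t))"
  define D' where "D' = (\<lambda>\<epsilon> t. rot (\<eta>1 t) \<bullet> (g t + \<epsilon> *\<^sub>R \<eta>2 t) + rot (W \<epsilon> t) \<bullet> \<eta>2 t)"
  define n' where "n' = (\<lambda>\<epsilon> t. 2 * (W \<epsilon> t \<bullet> \<eta>1 t))"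
  define f' where "f' = (\<lambda>\<epsilon> t. (p * spow (p - 1) (D \<epsilon> t) * D' \<epsilon> t) * n \<epsilon> t powr b
      + \<bar>D \<epsilon> t\<bar> powr p * (b * n \<epsilon> t powr (b - 1) * n' \<epsilon> t) + \<mu> * (1/2 * n \<epsilon> t powr (- 1/2) * n' \<epsilon> t))"
  have f: "f = (\<lambda>\<epsilon> t. \<bar>D \<epsilon> t\<bar> powr p * n \<epsilon> t powr b + \<mu> * n \<epsilon> t powr (1/2))"
    by (simp add: f_def D_def n_def W_def)
  have b: "b < 0" using p by (simp add: b_def)
  \<comment> \<open>The summand 1 makes powers of \<open>G\<close> increase with the exponent, so
    that \<open>G t powr p\<close> dominates all lower powers and constants.\<close>
  define G where "G = (\<lambda>t. 1 + norm (g t))"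
  have G1: "1 \<le> G t" "norm (g t) \<le> G t" for t by (simp_all add: G_def)
  have Gm: "G \<in> borel_measurable (lebesgue_on {0..1})" unfolding G_def using gm by measurable
  have Gp: "(\<lambda>t. G t powr p) absolutely_integrable_on {0..1}"
  proof (rule abs_measurable_bound)
    show "(\<lambda>t. G t powr p) \<in> borel_measurable (lebesgue_on {0..1})" using Gm by measurable
    show "(\<lambda>t. 2 powr p * (1 + norm (g t) powr p)) absolutely_integrable_on {0..1}"
      by (intro set_integrable_mult_right set_integral_add ga(2)) (auto intro: absolutely_integrable_on_const)
    fix t
    have "G t \<le> 2 * max 1 (norm (g t))" by (simp add: G_def)
    then have "G t powr p \<le> (2 * max 1 (norm (g t))) powr p"
      using p G1(1)[of t] by (intro powr_mono2) auto
    also have "\<dots> = 2 powr p * max 1 (norm (g t)) powr p" by (simp add: powr_mult)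
    also have "max 1 (norm (g t)) powr p \<le> 1 + norm (g t) powr p" by (auto simp: max_def)
    finally show "norm (G t powr p) \<le> 2 powr p * (1 + norm (g t) powr p)" by simp
  qed
  have Wb: "m \<le> norm (W \<epsilon> t)" "norm (W \<epsilon> t) \<le> 2 * M" if "\<bar>\<epsilon>\<bar> < \<delta>" "t \<in> {0..1}" for \<epsilon> t
  proof -
    have "norm (\<epsilon> *\<^sub>R \<eta>1 t) \<le> \<bar>\<epsilon>\<bar> * M" using M(3)[OF that(2)] by (simp add: mult_left_mono)
    moreover have "\<bar>\<epsilon>\<bar> * M \<le> \<delta> * M" using that M(1) by (intro mult_right_mono) auto
    moreover have "\<delta> * M \<le> m" "\<delta> * M \<le> M"
      using M(1) by (auto simp: \<delta>_def min_def field_simps)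
    ultimately show "m \<le> norm (W \<epsilon> t)" "norm (W \<epsilon> t) \<le> 2 * M"
      using norm_triangle_ineq2[of "V t" "- \<epsilon> *\<^sub>R \<eta>1 t"] norm_triangle_ineq[of "V t" "\<epsilon> *\<^sub>R \<eta>1 t"]
        m(2)[OF that(2)] M(2)[OF that(2)]
      by (auto simp: W_def)
  qed
  have nb: "m\<^sup>2 \<le> n \<epsilon> t" "n \<epsilon> t \<le> 4 * M\<^sup>2" "0 < n \<epsilon> t" if "\<bar>\<epsilon>\<bar> < \<delta>" "t \<in> {0..1}" for \<epsilon> t
  proof -
    have e: "n \<epsilon> t = (norm (W \<epsilon> t))\<^sup>2" by (simp add: n_def power2_norm_eq_inner)
    show 1: "m\<^sup>2 \<le> n \<epsilon> t" unfolding e using Wb[OF that] m(1) by (intro power_mono) auto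
    show "n \<epsilon> t \<le> 4 * M\<^sup>2" unfolding e using power_mono[OF Wb(2)[OF that], of 2] by (simp add: power_mult_distrib)
    show "0 < n \<epsilon> t" using 1 m(1) by (smt (verit) zero_less_power)
  qed
  have npow: "n \<epsilon> t powr r \<le> m\<^sup>2 powr r" if "\<bar>\<epsilon>\<bar> < \<delta>" "t \<in> {0..1}" "r \<le> 0" for \<epsilon> t r
    using nb[OF that(1,2)] m(1) that(3) by (intro powr_mono2') auto
  have n'b: "\<bar>n' \<epsilon> t\<bar> \<le> 4 * M\<^sup>2" if "\<bar>\<epsilon>\<bar> < \<delta>" "t \<in> {0..1}" for \<epsilon> t
  proof -
    have "\<bar>W \<epsilon> t \<bullet> \<eta>1 t\<bar> \<le> norm (W \<epsilon> t) * norm (\<eta>1 t)" by (rule Cauchy_Schwarz_ineq2)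
    also have "\<dots> \<le> (2 * M) * M" using Wb[OF that] M(1) M(3)[OF that(2)] by (intro mult_mono) auto
    finally show ?thesis by (simp add: n'_def power2_eq_square)
  qed
  define C where "C = 4 * M\<^sup>2"
  have C: "1 \<le> C" using one_le_power[OF M(1), of 2] by (simp add: C_def)
  have geb: "norm (g t + \<epsilon> *\<^sub>R \<eta>2 t) \<le> M * G t" if "\<bar>\<epsilon>\<bar> < \<delta>" "t \<in> {0..1}" for \<epsilon> t
  proof -
    have "\<bar>\<epsilon>\<bar> * norm (\<eta>2 t) \<le> 1 * M" using that M(1) M(4)[OF that(2)] by (intro mult_mono) (auto simp: \<delta>_def)
    then have "norm (g t + \<epsilon> *\<^sub>R \<eta>2 t) \<le> norm (g t) + M"
      using norm_triangle_ineq[of "g t" "\<epsilon> *\<^sub>R \<eta>2 t"] by simp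
    also have "\<dots> \<le> M * norm (g t) + M" using M(1) mult_right_mono[of 1 M "norm (g t)"] by simp
    finally show ?thesis by (simp add: G_def algebra_simps)
  qed
  have Db: "\<bar>D \<epsilon> t\<bar> \<le> C * G t" if "\<bar>\<epsilon>\<bar> < \<delta>" "t \<in> {0..1}" for \<epsilon> t
  proof -
    have "\<bar>D \<epsilon> t\<bar> \<le> norm (W \<epsilon> t) * norm (g t + \<epsilon> *\<^sub>R \<eta>2 t)" unfolding D_def by (rule abs_cross_le)
    also have "\<dots> \<le> (2 * M) * (M * G t)" using Wb[OF that] geb[OF that] M(1) by (intro mult_mono) auto
    also have "\<dots> \<le> C * G t" using M(1) G1(1)[of t] by (simp add: C_def power2_eq_square)
    finally show ?thesis .
  qed
  have D'b: "\<bar>D' \<epsilon> t\<bar> \<le> C * G t" if "\<bar>\<epsilon>\<bar> < \<delta>" "t \<in> {0..1}" for \<epsilon> t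
  proof -
    have "\<bar>rot (\<eta>1 t) \<bullet> (g t + \<epsilon> *\<^sub>R \<eta>2 t)\<bar> \<le> norm (\<eta>1 t) * norm (g t + \<epsilon> *\<^sub>R \<eta>2 t)" by (rule abs_cross_le)
    also have "\<dots> \<le> M * (M * G t)" using M(1) M(3)[OF that(2)] geb[OF that] by (intro mult_mono) auto
    finally have 1: "\<bar>rot (\<eta>1 t) \<bullet> (g t + \<epsilon> *\<^sub>R \<eta>2 t)\<bar> \<le> M\<^sup>2 * G t" by (simp add: power2_eq_square)
    have "\<bar>rot (W \<epsilon> t) \<bullet> \<eta>2 t\<bar> \<le> norm (W \<epsilon> t) * norm (\<eta>2 t)" by (rule abs_cross_le)
    also have "\<dots> \<le> (2 * M) * M" using Wb[OF that] M(1) M(4)[OF that(2)] by (intro mult_mono) auto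
    also have "\<dots> \<le> (2 * M\<^sup>2) * G t" using M(1) G1(1)[of t] by (simp add: power2_eq_square)
    finally have "\<bar>D' \<epsilon> t\<bar> \<le> M\<^sup>2 * G t + (2 * M\<^sup>2) * G t"
      unfolding D'_def using 1 by (intro order_trans[OF abs_triangle_ineq] add_mono)
    also have "\<dots> \<le> C * G t" using G1(1)[of t] by (simp add: C_def)
    finally show ?thesis .
  qed
  have Dp: "\<bar>D \<epsilon> t\<bar> powr p \<le> C powr p * G t powr p" if "\<bar>\<epsilon>\<bar> < \<delta>" "t \<in> {0..1}" for \<epsilon> t
    using Db[OF that] p C G1(1)[of t] powr_mono2[of p "\<bar>D \<epsilon> t\<bar>" "C * G t"] by (simp add: powr_mult)
  have Dp1: "\<bar>spow (p - 1) (D \<epsilon> t)\<bar> \<le> C powr (p - 1) * G t powr (p - 1)" if "\<bar>\<epsilon>\<bar> < \<delta>" "t \<in> {0..1}" for \<epsilon> t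
    using Db[OF that] p C G1(1)[of t] powr_mono2[of "p - 1" "\<bar>D \<epsilon> t\<bar>" "C * G t"] abs_spow_le[of "p - 1" "D \<epsilon> t"]
    by (simp add: powr_mult)
  \<comment> \<open>The factor from differentiating the power has degree \<open>p - 1\<close> in
    \<open>G\<close>, the inner derivative \<open>D'\<close> has degree 1; together they are again
    of degree \<open>p\<close>.\<close>
  have CG: "C powr (p - 1) * G t powr (p - 1) * (C * G t) = C powr p * G t powr p" for t
  proof -
    have "C powr (p - 1) * C powr 1 = C powr p" "G t powr (p - 1) * G t powr 1 = G t powr p"
      unfolding powr_add[symmetric] by simp_all
    then show ?thesis using C G1(1)[of t] by (simp add: algebra_simps) (metis mult.assoc mult.left_commute)
  qed
  define h where "h = (\<lambda>t. (p * m\<^sup>2 powr b + \<bar>b\<bar> * m\<^sup>2 powr (b - 1) * C) * (C powr p * G t powr p)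
      + \<bar>\<mu>\<bar> * (1/2 * m\<^sup>2 powr (- 1/2) * C))"
  have hint: "h absolutely_integrable_on {0..1}"
    unfolding h_def
    by (intro set_integral_add set_integrable_mult_right Gp) (auto intro: absolutely_integrable_on_const)
  have meas: "V \<in> borel_measurable (lebesgue_on {0..1})" "\<eta>1 \<in> borel_measurable (lebesgue_on {0..1})"
     "\<eta>2 \<in> borel_measurable (lebesgue_on {0..1})"
    by (intro cm V \<eta>)+
  have Wm: "(\<lambda>t. W \<epsilon> t) \<in> borel_measurable (lebesgue_on {0..1})" for \<epsilon>
    unfolding W_def using meas by measurable
  have Dm: "(\<lambda>t. D \<epsilon> t) \<in> borel_measurable (lebesgue_on {0..1})" for \<epsilon>
    unfolding D_def by (rule cross_measurable[OF Wm]) (use gm meas in measurable)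
  have nm: "(\<lambda>t. n \<epsilon> t) \<in> borel_measurable (lebesgue_on {0..1})" for \<epsilon>
    unfolding n_def using Wm by measurable
  have fint: "f \<epsilon> absolutely_integrable_on {0..1}" if \<epsilon>: "\<bar>\<epsilon>\<bar> < \<delta>" for \<epsilon>
  proof (rule abs_measurable_bound)
    show "f \<epsilon> \<in> borel_measurable (lebesgue_on {0..1})"
      unfolding f using Dm[of \<epsilon>] nm[of \<epsilon>] by measurable
    show "(\<lambda>t. m\<^sup>2 powr b * (C powr p * G t powr p) + \<bar>\<mu>\<bar> * (4 * M\<^sup>2) powr (1/2)) absolutely_integrable_on {0..1}"
      by (intro set_integral_add set_integrable_mult_right Gp) (auto intro: absolutely_integrable_on_const)
    fix t :: real assume t: "t \<in> {0..1}"
    have "\<bar>D \<epsilon> t\<bar> powr p * n \<epsilon> t powr b \<le> (C powr p * G t powr p) * m\<^sup>2 powr b"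
      using Dp[OF \<epsilon> t] npow[OF \<epsilon> t] b by (intro mult_mono) auto
    moreover have "\<bar>\<mu> * n \<epsilon> t powr (1/2)\<bar> \<le> \<bar>\<mu>\<bar> * (4 * M\<^sup>2) powr (1/2)"
      using nb[OF \<epsilon> t] by (auto simp: abs_mult intro!: mult_left_mono powr_mono2)
    ultimately show "norm (f \<epsilon> t) \<le> m\<^sup>2 powr b * (C powr p * G t powr p) + \<bar>\<mu>\<bar> * (4 * M\<^sup>2) powr (1/2)"
      unfolding f real_norm_def
      by (intro order_trans[OF abs_triangle_ineq] add_mono) (auto simp: mult.commute)
  qed
  have deriv: "((\<lambda>\<epsilon>. f \<epsilon> t) has_real_derivative f' \<epsilon> t) (at \<epsilon>)" if "\<bar>\<epsilon>\<bar> < \<delta>" "t \<in> {0..1}" for \<epsilon> t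
  proof -
    have dn: "((\<lambda>\<epsilon>. n \<epsilon> t) has_real_derivative n' \<epsilon> t) (at \<epsilon>)"
      unfolding n_def n'_def W_def inner_real2
      by (auto intro!: derivative_eq_intros simp: algebra_simps)
    have dD: "((\<lambda>\<epsilon>. D \<epsilon> t) has_real_derivative D' \<epsilon> t) (at \<epsilon>)"
      unfolding D_def D'_def W_def inner_real2 rot_nth
      by (auto intro!: derivative_eq_intros simp: algebra_simps)
    have d1: "((\<lambda>\<epsilon>. \<bar>D \<epsilon> t\<bar> powr p) has_real_derivative p * spow (p - 1) (D \<epsilon> t) * D' \<epsilon> t) (at \<epsilon>)"
      by (rule DERIV_chain2[OF abs_powr_has_derivative[OF p] dD])
    have d2: "((\<lambda>\<epsilon>. n \<epsilon> t powr r) has_real_derivative r * n \<epsilon> t powr (r - 1) * n' \<epsilon> t) (at \<epsilon>)" for r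
      using DERIV_fun_powr[OF dn nb(3)[OF that], of r] by simp
    have "((\<lambda>\<epsilon>. \<bar>D \<epsilon> t\<bar> powr p * n \<epsilon> t powr b + \<mu> * n \<epsilon> t powr (1/2)) has_real_derivative
        (p * spow (p - 1) (D \<epsilon> t) * D' \<epsilon> t) * n \<epsilon> t powr b + (b * n \<epsilon> t powr (b - 1) * n' \<epsilon> t) * \<bar>D \<epsilon> t\<bar> powr p
        + \<mu> * (1/2 * n \<epsilon> t powr (1/2 - 1) * n' \<epsilon> t)) (at \<epsilon>)"
      by (intro DERIV_add DERIV_mult DERIV_cmult d1 d2)
    then show ?thesis by (simp add: f f'_def mult.commute mult.left_commute)
  qed
  have bound: "\<bar>f' \<epsilon> t\<bar> \<le> h t" if et: "\<bar>\<epsilon>\<bar> < \<delta>" "t \<in> {0..1}" for \<epsilon> t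
  proof -
    have "\<bar>spow (p - 1) (D \<epsilon> t)\<bar> * \<bar>D' \<epsilon> t\<bar> \<le> (C powr (p - 1) * G t powr (p - 1)) * (C * G t)"
      using Dp1[OF et] D'b[OF et] by (intro mult_mono) auto
    then have 0: "\<bar>spow (p - 1) (D \<epsilon> t)\<bar> * \<bar>D' \<epsilon> t\<bar> \<le> C powr p * G t powr p" unfolding CG .
    have "\<bar>(p * spow (p - 1) (D \<epsilon> t) * D' \<epsilon> t) * n \<epsilon> t powr b\<bar>
        = p * (\<bar>spow (p - 1) (D \<epsilon> t)\<bar> * \<bar>D' \<epsilon> t\<bar>) * n \<epsilon> t powr b"
      using p by (simp add: abs_mult)
    also have "\<dots> \<le> p * (C powr p * G t powr p) * m\<^sup>2 powr b"
      by (rule mult_mono[OF mult_left_mono[OF 0]]) (use npow[OF et, of b] b p in auto)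
    finally have 1: "\<bar>(p * spow (p - 1) (D \<epsilon> t) * D' \<epsilon> t) * n \<epsilon> t powr b\<bar> \<le> p * (C powr p * G t powr p) * m\<^sup>2 powr b" .
    have "\<bar>\<bar>D \<epsilon> t\<bar> powr p * (b * n \<epsilon> t powr (b - 1) * n' \<epsilon> t)\<bar> = \<bar>D \<epsilon> t\<bar> powr p * (\<bar>b\<bar> * n \<epsilon> t powr (b - 1) * \<bar>n' \<epsilon> t\<bar>)"
      by (simp add: abs_mult)
    also have "\<dots> \<le> (C powr p * G t powr p) * (\<bar>b\<bar> * m\<^sup>2 powr (b - 1) * C)"
    proof -
      have "n \<epsilon> t powr (b - 1) \<le> m\<^sup>2 powr (b - 1)" "\<bar>n' \<epsilon> t\<bar> \<le> C"
        using npow[OF et, of "b - 1"] b n'b[OF et] by (auto simp: C_def)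
      then show ?thesis using Dp[OF et] C by (intro mult_mono) auto
    qed
    finally have 2: "\<bar>\<bar>D \<epsilon> t\<bar> powr p * (b * n \<epsilon> t powr (b - 1) * n' \<epsilon> t)\<bar> \<le> (C powr p * G t powr p) * (\<bar>b\<bar> * m\<^sup>2 powr (b - 1) * C)" .
    have "\<bar>\<mu> * (1/2 * n \<epsilon> t powr (- 1/2) * n' \<epsilon> t)\<bar> = \<bar>\<mu>\<bar> * (1/2 * n \<epsilon> t powr (- 1/2) * \<bar>n' \<epsilon> t\<bar>)"
      by (simp add: abs_mult)
    also have "\<dots> \<le> \<bar>\<mu>\<bar> * (1/2 * m\<^sup>2 powr (- 1/2) * C)"
      using npow[OF et, of "- 1/2"] n'b[OF et] by (intro mult_mono mult_left_mono) (auto simp: C_def)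
    finally have 3: "\<bar>\<mu> * (1/2 * n \<epsilon> t powr (- 1/2) * n' \<epsilon> t)\<bar> \<le> \<bar>\<mu>\<bar> * (1/2 * m\<^sup>2 powr (- 1/2) * C)" .
    have "\<bar>f' \<epsilon> t\<bar> \<le> p * (C powr p * G t powr p) * m\<^sup>2 powr b + (C powr p * G t powr p) * (\<bar>b\<bar> * m\<^sup>2 powr (b - 1) * C)
        + \<bar>\<mu>\<bar> * (1/2 * m\<^sup>2 powr (- 1/2) * C)"
      unfolding f'_def using 1 2 3 by linarith
    then show ?thesis by (simp add: h_def algebra_simps)
  qed
  \<comment> \<open>At \<epsilon> = 0 the turn is moved to the other factor, \<open>rot (\<eta>1 t)
    \<bullet> g t = - (\<eta>1 t \<bullet> rot (g t))\<close>; hence the minus sign in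
    \<open>B\<close>.\<close>
  have f'0: "f' 0 t = A t \<bullet> \<eta>2 t + B t \<bullet> \<eta>1 t" for t
    by (simp add: f'_def A_def B_def D_def D'_def n_def n'_def W_def inner_real2 algebra_simps)
  show "((\<lambda>\<epsilon>. integral {0..1} (f \<epsilon>)) has_real_derivative
      integral {0..1} (\<lambda>t. A t \<bullet> \<eta>2 t + B t \<bullet> \<eta>1 t)) (at 0)"
    using has_real_derivative_integral(1)[of \<delta> f f', OF \<delta> fint deriv bound hint]
    unfolding ext[of "f' 0" "\<lambda>t. A t \<bullet> \<eta>2 t + B t \<bullet> \<eta>1 t", OF f'0] .
  show "\<exists>\<delta>>0. \<forall>\<epsilon>. \<bar>\<epsilon>\<bar> < \<delta> \<longrightarrow> f \<epsilon> absolutely_integrable_on {0..1} \<and> (\<forall>t\<in>{0..1}. V t + \<epsilon> *\<^sub>R \<eta>1 t \<noteq> 0)"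
    using \<delta> fint nb(3) by (intro exI[of _ \<delta>]) (auto simp: n_def W_def)
  have D0: "D 0 t = rot (V t) \<bullet> g t" "n 0 t = V t \<bullet> V t" for t by (simp_all add: D_def n_def W_def)
  have rotm: "(\<lambda>t. rot (u t)) \<in> borel_measurable (lebesgue_on {0..1})" if "u \<in> borel_measurable (lebesgue_on {0..1})" for u
    using measurable_compose[OF that borel_measurable_continuous_onI[OF linear_continuous_on[OF bounded_linear_rot]]] .
  have spm: "(\<lambda>t. spow (p - 1) (rot (V t) \<bullet> g t)) \<in> borel_measurable (lebesgue_on {0..1})"
    unfolding spow_def using Dm[of 0] unfolding D0 by measurable
  have Gp1: "G t powr (p - 1) * G t = G t powr p" for t
    using G1(1)[of t] powr_add[of "G t" "p - 1" 1] by simp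
  have 00: "\<bar>0\<bar> < \<delta>" using \<delta> by simp
  have coef: "norm (p * spow (p - 1) (rot (V t) \<bullet> g t) * (V t \<bullet> V t) powr b)
      \<le> p * (C powr (p - 1) * G t powr (p - 1)) * m\<^sup>2 powr b" if "t \<in> {0..1}" for t
  proof -
    have 1: "\<bar>spow (p - 1) (rot (V t) \<bullet> g t)\<bar> \<le> C powr (p - 1) * G t powr (p - 1)"
      and 2: "(V t \<bullet> V t) powr b \<le> m\<^sup>2 powr b"
      using Dp1[OF 00 that] npow[OF 00 that, of b] b unfolding D0 by auto
    have "norm (p * spow (p - 1) (rot (V t) \<bullet> g t) * (V t \<bullet> V t) powr b)
        = p * \<bar>spow (p - 1) (rot (V t) \<bullet> g t)\<bar> * (V t \<bullet> V t) powr b"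
      using p by (simp add: abs_mult)
    also have "\<dots> \<le> p * (C powr (p - 1) * G t powr (p - 1)) * m\<^sup>2 powr b"
      by (rule mult_mono[OF mult_left_mono[OF 1] 2]) (use p C in auto)
    finally show ?thesis .
  qed
  show "A absolutely_integrable_on {0..1}"
  proof (rule abs_measurable_bound)
    show "A \<in> borel_measurable (lebesgue_on {0..1})"
      unfolding A_def using spm nm[of 0] rotm[OF meas(1)] unfolding D0 by measurable
    show "(\<lambda>t. (p * C powr (p - 1) * m\<^sup>2 powr b * M) * G t powr p) absolutely_integrable_on {0..1}"
      by (intro set_integrable_mult_right Gp)
    fix t :: real assume t: "t \<in> {0..1}"
    have "norm (A t) \<le> p * (C powr (p - 1) * G t powr (p - 1)) * m\<^sup>2 powr b * M"
      unfolding A_def norm_scaleR norm_rot using coef[OF t] M(2)[OF t] M(1) p by (intro mult_mono) auto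
    also have "\<dots> \<le> p * (C powr (p - 1) * G t powr p) * m\<^sup>2 powr b * M"
      using G1(1)[of t] p M(1) by (intro mult_left_mono mult_right_mono powr_mono) auto
    finally show "norm (A t) \<le> (p * C powr (p - 1) * m\<^sup>2 powr b * M) * G t powr p" by (simp add: algebra_simps)
  qed
  show "B absolutely_integrable_on {0..1}"
  proof (rule abs_measurable_bound)
    show "B \<in> borel_measurable (lebesgue_on {0..1})"
      unfolding B_def using spm nm[of 0] Dm[of 0] rotm[OF gm] meas(1) unfolding D0 by measurable
    show "(\<lambda>t. (C powr p * (2 * \<bar>b\<bar> * m\<^sup>2 powr (b - 1)) * M + p * C powr (p - 1) * m\<^sup>2 powr b) * G t powr p
        + \<bar>\<mu>\<bar> * m\<^sup>2 powr (- 1/2) * M) absolutely_integrable_on {0..1}"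
      by (intro set_integral_add set_integrable_mult_right Gp) (auto intro: absolutely_integrable_on_const)
    fix t :: real assume t: "t \<in> {0..1}"
    have 1: "\<bar>rot (V t) \<bullet> g t\<bar> powr p * (2 * \<bar>b\<bar> * (V t \<bullet> V t) powr (b - 1)) \<le> (C powr p * G t powr p) * (2 * \<bar>b\<bar> * m\<^sup>2 powr (b - 1))"
    proof -
      have "(V t \<bullet> V t) powr (b - 1) \<le> m\<^sup>2 powr (b - 1)" "\<bar>rot (V t) \<bullet> g t\<bar> powr p \<le> C powr p * G t powr p"
        using npow[OF 00 t, of "b - 1"] Dp[OF 00 t] b unfolding D0 by auto
      then show ?thesis by (intro mult_mono) auto
    qed
    have 2: "\<bar>\<mu>\<bar> * (V t \<bullet> V t) powr (- 1/2) \<le> \<bar>\<mu>\<bar> * m\<^sup>2 powr (- 1/2)"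
      using npow[OF 00 t, of "- 1/2"] unfolding D0 by (intro mult_left_mono) auto
    have "\<bar>\<bar>rot (V t) \<bullet> g t\<bar> powr p * (2 * b * (V t \<bullet> V t) powr (b - 1)) + \<mu> * (V t \<bullet> V t) powr (- 1/2)\<bar>
        \<le> \<bar>rot (V t) \<bullet> g t\<bar> powr p * (2 * \<bar>b\<bar> * (V t \<bullet> V t) powr (b - 1)) + \<bar>\<mu>\<bar> * (V t \<bullet> V t) powr (- 1/2)"
      by (intro order_trans[OF abs_triangle_ineq]) (simp add: abs_mult)
    also have "\<dots> \<le> (C powr p * G t powr p) * (2 * \<bar>b\<bar> * m\<^sup>2 powr (b - 1)) + \<bar>\<mu>\<bar> * m\<^sup>2 powr (- 1/2)"
      using 1 2 by linarith
    finally have 3: "\<bar>\<bar>rot (V t) \<bullet> g t\<bar> powr p * (2 * b * (V t \<bullet> V t) powr (b - 1)) + \<mu> * (V t \<bullet> V t) powr (- 1/2)\<bar> * norm (V t)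
        \<le> ((C powr p * G t powr p) * (2 * \<bar>b\<bar> * m\<^sup>2 powr (b - 1)) + \<bar>\<mu>\<bar> * m\<^sup>2 powr (- 1/2)) * M"
      using M(2)[OF t] by (intro mult_mono) (auto intro: order_trans[OF abs_ge_zero])
    have "norm (p * spow (p - 1) (rot (V t) \<bullet> g t) * (V t \<bullet> V t) powr b) * norm (g t)
        \<le> p * (C powr (p - 1) * G t powr (p - 1)) * m\<^sup>2 powr b * G t"
      using coef[OF t] G1(2)[of t] p by (intro mult_mono) auto
    also have "\<dots> = p * C powr (p - 1) * m\<^sup>2 powr b * G t powr p"
      unfolding Gp1[symmetric] by simp
    finally have 4: "norm (p * spow (p - 1) (rot (V t) \<bullet> g t) * (V t \<bullet> V t) powr b) * norm (g t)
        \<le> p * C powr (p - 1) * m\<^sup>2 powr b * G t powr p" .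
    have "norm (B t) \<le> ((C powr p * G t powr p) * (2 * \<bar>b\<bar> * m\<^sup>2 powr (b - 1)) + \<bar>\<mu>\<bar> * m\<^sup>2 powr (- 1/2)) * M
        + p * C powr (p - 1) * m\<^sup>2 powr b * G t powr p"
      unfolding B_def
      by (rule order_trans[OF norm_triangle_ineq4], rule add_mono)
         (use 3 4 in \<open>simp_all only: norm_scaleR norm_rot real_norm_def\<close>)
    then show "norm (B t) \<le> (C powr p * (2 * \<bar>b\<bar> * m\<^sup>2 powr (b - 1)) * M + p * C powr (p - 1) * m\<^sup>2 powr b) * G t powr p
        + \<bar>\<mu>\<bar> * m\<^sup>2 powr (- 1/2) * M"
      by (simp add: algebra_simps)
  qed
qed

text \<open>The first variation in direction \<open>\<eta>\<close> is the integral of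
  \<open>EL_A \<bullet> \<eta>'' + EL_B \<bullet> \<eta>'\<close>, where \<open>V\<close> and \<open>g\<close> are the first and second derivative of the curve.\<close>

definition EL_A :: "real \<Rightarrow> (real \<Rightarrow> real^2) \<Rightarrow> (real \<Rightarrow> real^2) \<Rightarrow> real \<Rightarrow> real^2" where
  "EL_A p V g t =
     (p * spow (p - 1) (rot (V t) \<bullet> g t) * (V t \<bullet> V t) powr ((1 - 3 * p) / 2)) *\<^sub>R rot (V t)"

definition EL_B :: "real \<Rightarrow> real \<Rightarrow> (real \<Rightarrow> real^2) \<Rightarrow> (real \<Rightarrow> real^2) \<Rightarrow> real \<Rightarrow> real^2" where
  "EL_B p \<mu> V g t =
     (\<bar>rot (V t) \<bullet> g t\<bar> powr p * (2 * ((1 - 3 * p) / 2) * (V t \<bullet> V t) powr ((1 - 3 * p) / 2 - 1))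
       + \<mu> * (V t \<bullet> V t) powr (- 1/2)) *\<^sub>R V t
     - (p * spow (p - 1) (rot (V t) \<bullet> g t) * (V t \<bullet> V t) powr ((1 - 3 * p) / 2)) *\<^sub>R rot (g t)"

lemma lint_Icc01:
  fixes f :: "real \<Rightarrow> 'a::euclidean_space"
  assumes "f absolutely_integrable_on {0..1}"
  shows "(LINT t|lebesgue_on {0..1}. f t) = integral {0..1} f"
  by (rule lebesgue_integral_eq_integral) (use assms in \<open>auto intro: absolutely_integrable_imp_integrable\<close>)

text \<open>Testing with \<open>\<phi> t *\<^sub>R e\<close> and integrating the term with
  \<open>\<phi>'\<close> by parts shows that \<open>EL_A\<close> minus a primitive of
  \<open>EL_B\<close> is weakly affine. The linear part of that affine function supplies
  \<open>a\<close>, so \<open>EL_A\<close> has an absolutely continuous representative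
  \<open>A0\<close> with density \<open>EL_B - a\<close>.\<close>

lemma weak_Euler_Lagrange:
  assumes p: "1 < p" and el: "p_elastica p \<gamma>"
  obtains V g \<mu> A0 a where "primitive_on {0..1} V g" "\<And>t. t \<in> {0..1} \<Longrightarrow> V t \<noteq> 0"
    "\<And>t. t \<in> {0..1} \<Longrightarrow> (\<gamma> has_vector_derivative V t) (at t within {0..1})"
    "primitive_on {0..1} A0 (\<lambda>t. EL_B p \<mu> V g t - a)"
    "negligible {t\<in>{0..1}. EL_A p V g t \<noteq> A0 t}"
proof -
  have im: "immersed_W2p p \<gamma>" using el by (simp add: p_elastica_def)
  obtain \<mu> where \<mu>: "\<And>\<eta> :: real \<Rightarrow> real^2. test_function \<eta> \<Longrightarrow>
        ((\<lambda>\<epsilon>. bending_energy p (\<lambda>t. \<gamma> t + \<epsilon> *\<^sub>R \<eta> t) + \<mu> * curve_length (\<lambda>t. \<gamma> t + \<epsilon> *\<^sub>R \<eta> t))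
          has_real_derivative 0) (at 0)"
    using el unfolding p_elastica_def by blast
  have S: "in_Sobolev 2 p \<gamma>" "continuous_on {0..1} \<gamma>" using im by (auto simp: immersed_W2p_def)
  obtain V g where V: "primitive_on {0..1} V g" and g: "in_Lp p g" and w: "is_weak_deriv 2 \<gamma> g"
    and dV: "\<And>t. t \<in> {0..1} \<Longrightarrow> (\<gamma> has_vector_derivative V t) (at t within {0..1})"
    using Sobolev_regularity[OF less_imp_le[OF p] S] by metis
  have V0: "V t \<noteq> 0" if "t \<in> {0..1}" for t
    using im vector_derivative_within_closed_interval[OF _ that dV[OF that]] that
    by (auto simp: immersed_W2p_def)
  have contV: "continuous_on {0..1} V" using V by (rule primitive_on_continuous)
  have \<gamma>a: "\<gamma> absolutely_integrable_on {0..1}" using S(2) by (rule absolutely_integrable_continuous_real)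
  have ga: "g absolutely_integrable_on {0..1}" using in_Lp_integrable(1)[OF _ g] p by simp
  define b where "b = (1 - 3 * p) / 2"
  have test: "integral {0..1} (\<lambda>t. EL_A p V g t \<bullet> nth_vderiv 2 \<eta> t + EL_B p \<mu> V g t \<bullet> nth_vderiv 1 \<eta> t) = 0"
    if \<eta>: "test_function \<eta>" for \<eta> :: "real \<Rightarrow> real^2"
  proof -
    have c\<eta>: "continuous_on {0..1} (nth_vderiv n \<eta>)" for n
      by (intro smooth_continuous_on test_function_smooth \<eta>)
    define n where "n = (\<lambda>\<epsilon> t. (V t + \<epsilon> *\<^sub>R nth_vderiv 1 \<eta> t) \<bullet> (V t + \<epsilon> *\<^sub>R nth_vderiv 1 \<eta> t))"
    define f1 where "f1 = (\<lambda>\<epsilon> t. \<bar>rot (V t + \<epsilon> *\<^sub>R nth_vderiv 1 \<eta> t) \<bullet> (g t + \<epsilon> *\<^sub>R nth_vderiv 2 \<eta> t)\<bar> powr p * n \<epsilon> t powr b)"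
    define f2 where "f2 = (\<lambda>\<epsilon> t. n \<epsilon> t powr (1/2))"
    note fv1 = first_variation(1)[where \<mu>=\<mu>, OF p contV V0 g c\<eta>[of 1] c\<eta>[of 2]]
    note fv4 = first_variation(4)[where \<mu>=\<mu>, OF p contV V0 g c\<eta>[of 1] c\<eta>[of 2]]
    obtain \<delta> where \<delta>: "0 < \<delta>" and fint: "\<And>\<epsilon>. \<bar>\<epsilon>\<bar> < \<delta> \<Longrightarrow> (\<lambda>t. f1 \<epsilon> t + \<mu> * f2 \<epsilon> t) absolutely_integrable_on {0..1}"
      and W0: "\<And>\<epsilon> t. \<bar>\<epsilon>\<bar> < \<delta> \<Longrightarrow> t \<in> {0..1} \<Longrightarrow> V t + \<epsilon> *\<^sub>R nth_vderiv 1 \<eta> t \<noteq> 0"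
      using fv4 unfolding f1_def f2_def n_def b_def by blast
    have f2: "f2 \<epsilon> t = norm (V t + \<epsilon> *\<^sub>R nth_vderiv 1 \<eta> t)" for \<epsilon> t
      using norm_powr_eq_inner_powr[of "V t + \<epsilon> *\<^sub>R nth_vderiv 1 \<eta> t" "1/2"] by (simp add: f2_def n_def)
    have f2int: "f2 \<epsilon> absolutely_integrable_on {0..1}" for \<epsilon>
      unfolding ext[OF f2] by (intro absolutely_integrable_continuous_real continuous_intros contV c\<eta>)
    have energy: "bending_energy p (\<lambda>t. \<gamma> t + \<epsilon> *\<^sub>R \<eta> t) + \<mu> * curve_length (\<lambda>t. \<gamma> t + \<epsilon> *\<^sub>R \<eta> t)
        = integral {0..1} (\<lambda>t. f1 \<epsilon> t + \<mu> * f2 \<epsilon> t)" if \<epsilon>: "\<bar>\<epsilon>\<bar> < \<delta>" for \<epsilon>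
    proof -
      \<comment> \<open>Integrability is known for the sum; the length term is continuous and can be
        split off.\<close>
      have "(\<lambda>t. (f1 \<epsilon> t + \<mu> * f2 \<epsilon> t) - \<mu> * f2 \<epsilon> t) absolutely_integrable_on {0..1}"
        by (intro set_integral_diff fint[OF \<epsilon>] set_integrable_mult_right f2int)
      then have f1int: "f1 \<epsilon> absolutely_integrable_on {0..1}" by simp
      have vel: "velocity (\<lambda>t. \<gamma> t + \<epsilon> *\<^sub>R \<eta> t) t = V t + \<epsilon> *\<^sub>R nth_vderiv 1 \<eta> t" if "t \<in> {0..1}" for t
        by (rule velocity_add_test_function[where V=V, OF dV[OF that] \<eta> that])
      \<comment> \<open>This null set depends on \<epsilon>, which is harmless: the energy is
        rewritten for each \<epsilon> separately.\<close>
      define N where "N = {t\<in>{0..1}. weak_deriv 2 (\<lambda>t. \<gamma> t + \<epsilon> *\<^sub>R \<eta> t) t \<noteq> g t + \<epsilon> *\<^sub>R nth_vderiv 2 \<eta> t}"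
      have N: "negligible N" unfolding N_def by (rule weak_deriv_2_add_test_function[OF w \<gamma>a ga \<eta>])
      let ?u = "\<lambda>t. \<bar>curvature (\<lambda>t. \<gamma> t + \<epsilon> *\<^sub>R \<eta> t) t\<bar> powr p * norm (velocity (\<lambda>t. \<gamma> t + \<epsilon> *\<^sub>R \<eta> t) t)"
      have u: "?u t = f1 \<epsilon> t" if t: "t \<in> {0..1} - N" for t
      proof -
        have "weak_deriv 2 (\<lambda>t. \<gamma> t + \<epsilon> *\<^sub>R \<eta> t) t = g t + \<epsilon> *\<^sub>R nth_vderiv 2 \<eta> t"
          using t by (auto simp: N_def)
        then show ?thesis
          using energy_integrand[OF W0[OF \<epsilon>, of t]] t vel[of t]
          by (simp add: curvature_eq f1_def n_def b_def)
      qed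
      have "bending_energy p (\<lambda>t. \<gamma> t + \<epsilon> *\<^sub>R \<eta> t) = integral {0..1} ?u"
        unfolding bending_energy_def
        by (rule lint_Icc01, rule absolutely_integrable_spike[OF f1int N u])
      also have "\<dots> = integral {0..1} (f1 \<epsilon>)"
        by (rule integral_spike[OF N]) (use u in auto)
      finally have 1: "bending_energy p (\<lambda>t. \<gamma> t + \<epsilon> *\<^sub>R \<eta> t) = integral {0..1} (f1 \<epsilon>)" .
      have v: "norm (velocity (\<lambda>t. \<gamma> t + \<epsilon> *\<^sub>R \<eta> t) t) = f2 \<epsilon> t" if "t \<in> {0..1}" for t
        using vel[OF that] by (simp add: f2)
      have "curve_length (\<lambda>t. \<gamma> t + \<epsilon> *\<^sub>R \<eta> t) = integral {0..1} (\<lambda>t. norm (velocity (\<lambda>t. \<gamma> t + \<epsilon> *\<^sub>R \<eta> t) t))"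
        unfolding arclength_def
        by (rule lint_Icc01, rule absolutely_integrable_spike[OF f2int negligible_empty]) (use v in auto)
      also have "\<dots> = integral {0..1} (f2 \<epsilon>)"
        by (rule Henstock_Kurzweil_Integration.integral_cong) (use v in auto)
      finally have 2: "curve_length (\<lambda>t. \<gamma> t + \<epsilon> *\<^sub>R \<eta> t) = integral {0..1} (f2 \<epsilon>)" .
      have "integral {0..1} (\<lambda>t. f1 \<epsilon> t + \<mu> *\<^sub>R f2 \<epsilon> t) = integral {0..1} (f1 \<epsilon>) + \<mu> *\<^sub>R integral {0..1} (f2 \<epsilon>)"
        by (rule integral_add_scaled) (use f1int f2int absolutely_integrable_on_def in blast)+
      then show ?thesis by (simp add: 1 2)
    qed
    have "((\<lambda>\<epsilon>. integral {0..1} (\<lambda>t. f1 \<epsilon> t + \<mu> * f2 \<epsilon> t)) has_real_derivative 0) (at 0)"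
      by (rule has_field_derivative_transform_within_open[OF \<mu>[OF \<eta>], of "{-\<delta><..<\<delta>}"])
         (use \<delta> energy in auto)
    moreover have "((\<lambda>\<epsilon>. integral {0..1} (\<lambda>t. f1 \<epsilon> t + \<mu> * f2 \<epsilon> t)) has_real_derivative
        integral {0..1} (\<lambda>t. EL_A p V g t \<bullet> nth_vderiv 2 \<eta> t + EL_B p \<mu> V g t \<bullet> nth_vderiv 1 \<eta> t)) (at 0)"
      using fv1 unfolding EL_A_def EL_B_def b_def[symmetric] f1_def f2_def n_def .
    ultimately show ?thesis by (rule DERIV_unique[symmetric])
  qed
  have Aint: "EL_A p V g absolutely_integrable_on {0..1}" and Bint: "EL_B p \<mu> V g absolutely_integrable_on {0..1}"
    using first_variation(2)[OF p contV V0 g continuous_on_const continuous_on_const]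
      first_variation(3)[where \<mu>=\<mu>, OF p contV V0 g continuous_on_const continuous_on_const]
    unfolding EL_A_def[abs_def] EL_B_def[abs_def] by auto
  define A where "A = EL_A p V g"
  define B where "B = EL_B p \<mu> V g"
  note AB = Aint[folded A_def] Bint[folded B_def]
  have abs1: "u absolutely_integrable_on {0..1} \<Longrightarrow> u integrable_on {0..1}" for u :: "real \<Rightarrow> real^2"
    using absolutely_integrable_on_def by blast
  have weak: "integral {0..1} (\<lambda>t. nth_vderiv 2 \<phi> t *\<^sub>R A t) = - integral {0..1} (\<lambda>t. nth_vderiv 1 \<phi> t *\<^sub>R B t)"
    if \<phi>: "test_function \<phi>" for \<phi> :: "real \<Rightarrow> real"
  proof -
    have i: "(\<lambda>t. nth_vderiv 2 \<phi> t *\<^sub>R A t) integrable_on {0..1}" "(\<lambda>t. nth_vderiv 1 \<phi> t *\<^sub>R B t) integrable_on {0..1}"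
      by (intro abs1 test_function_times_integrable test_function_nth_vderiv AB \<phi>)+
    define U where "U = (\<lambda>t. nth_vderiv 2 \<phi> t *\<^sub>R A t + nth_vderiv 1 \<phi> t *\<^sub>R B t)"
    have U: "U integrable_on {0..1}" unfolding U_def by (intro Henstock_Kurzweil_Integration.integrable_add i)
    have "integral {0..1} U \<bullet> e = 0" for e :: "real^2"
    proof -
      have "integral {0..1} U \<bullet> e = integral {0..1} (\<lambda>t. U t \<bullet> e)"
        by (rule integral_component_eq[OF U, symmetric])
      also have "\<dots> = integral {0..1} (\<lambda>t. A t \<bullet> nth_vderiv 2 (\<lambda>t. \<phi> t *\<^sub>R e) t + B t \<bullet> nth_vderiv 1 (\<lambda>t. \<phi> t *\<^sub>R e) t)"
        by (simp add: nth_vderiv_scaleR_const[OF test_function_smooth[OF \<phi>]] U_def inner_add_left)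
      also have "\<dots> = 0"
        using test[OF test_function_scaleR_const[OF \<phi>, of e]] by (simp add: A_def B_def)
      finally show ?thesis .
    qed
    then have "integral {0..1} U = 0" by (metis inner_eq_zero_iff)
    then show ?thesis
      using Henstock_Kurzweil_Integration.integral_add[OF i] by (simp add: U_def eq_neg_iff_add_eq_0)
  qed
  define \<beta> where "\<beta> = (\<lambda>t. 0 + integral {0..t} B)"
  have \<beta>: "primitive_on {0..1} \<beta> B" unfolding \<beta>_def by (rule primitive_on_integral[OF AB(2)])
  have \<beta>a: "\<beta> absolutely_integrable_on {0..1}"
    by (intro absolutely_integrable_continuous_real primitive_on_continuous[OF \<beta>])
  have A\<beta>: "(\<lambda>t. A t - \<beta> t) absolutely_integrable_on {0..1}"
    by (intro set_integral_diff AB \<beta>a)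
  have "integral {0..1} (\<lambda>t. nth_vderiv 2 \<phi> t *\<^sub>R (A t - \<beta> t)) = 0" if \<phi>: "test_function \<phi>" for \<phi> :: "real \<Rightarrow> real"
  proof -
    have i: "(\<lambda>t. nth_vderiv 2 \<phi> t *\<^sub>R A t) integrable_on {0..1}" "(\<lambda>t. nth_vderiv 2 \<phi> t *\<^sub>R \<beta> t) integrable_on {0..1}"
      by (intro abs1 test_function_times_integrable test_function_nth_vderiv AB \<beta>a \<phi>)+
    have "nth_vderiv 2 \<phi> = nth_vderiv 1 (nth_vderiv 1 \<phi>)"
      using nth_vderiv_add[of 1 1 \<phi>] by (simp only: one_add_one)
    then have "integral {0..1} (\<lambda>t. nth_vderiv 2 \<phi> t *\<^sub>R \<beta> t) = - integral {0..1} (\<lambda>t. nth_vderiv 1 \<phi> t *\<^sub>R B t)"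
      using integral_by_parts_test_function[OF \<beta> test_function_nth_vderiv[OF \<phi>, of 1]] by simp
    then show ?thesis
      using weak[OF \<phi>] Henstock_Kurzweil_Integration.integral_diff[OF i] by (simp add: scaleR_diff_right)
  qed
  from weakly_affine[OF A\<beta> this]
  obtain a c where ac: "negligible {t\<in>{0..1}. A t - \<beta> t \<noteq> c - t *\<^sub>R a}" by blast
  have Ba: "(\<lambda>t. B t - a) absolutely_integrable_on {0..1}"
    by (intro set_integral_diff AB) (auto intro: absolutely_integrable_on_const)
  have int: "integral {0..t} (\<lambda>t. B t - a) = \<beta> t - t *\<^sub>R a" if t: "t \<in> {0..1}" for t
  proof -
    have "B integrable_on {0..t}"
      by (rule integrable_subinterval_real[OF abs1[OF AB(2)]]) (use t in auto)
    then show ?thesis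
      using t by (subst Henstock_Kurzweil_Integration.integral_diff) (auto simp: \<beta>_def)
  qed
  have "{t\<in>{0..1}. A t \<noteq> c + integral {0..t} (\<lambda>t. B t - a)} \<subseteq> {t\<in>{0..1}. A t - \<beta> t \<noteq> c - t *\<^sub>R a}"
    by (auto simp: int algebra_simps)
  then have neg: "negligible {t\<in>{0..1}. EL_A p V g t \<noteq> c + integral {0..t} (\<lambda>t. B t - a)}"
    using negligible_subset[OF ac] by (simp add: A_def)
  show ?thesis
    by (rule that[OF V V0 dV primitive_on_integral[OF Ba[unfolded B_def]] neg[unfolded B_def]])
qed

section \<open>The Euler-Lagrange equation in pointwise form\<close>

lemma spow_eq_max: "0 < a \<Longrightarrow> spow a x = max x 0 powr a - max (- x) 0 powr a"
  by (auto simp: spow_def max_def sgn_if)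

text \<open>\<open>sgn\<close> jumps at 0; written with positive and negative parts, the signed
  power is a difference of continuous functions.\<close>

lemma continuous_on_spow:
  assumes "0 < a" "continuous_on S f"
  shows "continuous_on S (\<lambda>t. spow a (f t))"
  unfolding spow_eq_max[OF assms(1)]
  using assms by (intro continuous_intros continuous_on_powr') auto

lemma spow_spow: "a \<noteq> 0 \<Longrightarrow> spow (1 / a) (spow a x) = x"
  by (auto simp: spow_def abs_mult sgn_if powr_powr)

lemma abs_spow: "\<bar>spow a x\<bar> = \<bar>x\<bar> powr a"
  by (auto simp: spow_def abs_mult sgn_if)

lemma spow_mult_self: "spow (p - 1) x * x = \<bar>x\<bar> powr p"
proof (cases "x = 0")
  case False
  have "spow (p - 1) x * x = \<bar>x\<bar> powr (p - 1) * \<bar>x\<bar> powr 1"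
    by (auto simp: spow_def sgn_if)
  also have "\<dots> = \<bar>x\<bar> powr p" by (simp only: powr_add[symmetric]) simp
  finally show ?thesis .
qed simp

lemma spow_divide:
  assumes "0 < c"
  shows "spow a (x / c) = spow a x / c powr a"
  using assms by (auto simp: spow_def powr_divide sgn_divide)

lemma has_vector_derivative_zero_unique:
  fixes f :: "real \<Rightarrow> 'a::euclidean_space"
  assumes "(f has_vector_derivative d) (at t within {0..1})" "t \<in> {0..1}" "\<And>s. s \<in> {0..1} \<Longrightarrow> f s = c"
  shows "d = 0"
proof -
  have c0: "((\<lambda>_. c) has_vector_derivative 0) (at t within {0..1})" by simp
  have "(f has_vector_derivative 0) (at t within {0..1})"
    by (rule has_vector_derivative_transform[OF assms(2) _ c0]) (use assms(3) in simp)
  then show ?thesis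
    using vector_derivative_within_closed_interval[OF zero_less_one assms(2,1)]
      vector_derivative_within_closed_interval[OF zero_less_one assms(2), of f 0] by simp
qed

lemma real2_decomposition:
  fixes v w :: "real^2"
  shows "(v \<bullet> v) *\<^sub>R w = (v \<bullet> w) *\<^sub>R v + (rot v \<bullet> w) *\<^sub>R rot v"
  by (simp add: vec_eq_iff forall_2 inner_real2 algebra_simps)

lemma has_derivative_norm_sgn:
  fixes x :: "'a::real_inner"
  assumes "x \<noteq> 0"
  shows "(norm has_derivative (\<lambda>v. sgn x \<bullet> v)) (at x)"
  using has_derivative_norm[OF assms] by (simp add: inner_commute)

text \<open>The derivative of normalization is a scaled projection onto the line orthogonal to
  \<open>x\<close>: the component of \<open>v\<close> along \<open>x\<close> does not contribute.
  Applied to the velocity, this produces the Frenet equation.\<close>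

lemma has_derivative_normalize:
  fixes x :: "real^2"
  assumes "x \<noteq> 0"
  shows "((\<lambda>x. (1 / norm x) *\<^sub>R x) has_derivative
    (\<lambda>v. ((rot x \<bullet> v) / norm x ^ 3) *\<^sub>R rot x)) (at x)"
proof -
  note norm_der = has_derivative_norm_sgn[OF assms]
  have 1: "((\<lambda>x. (1 / norm x) *\<^sub>R x) has_derivative
      (\<lambda>v. (1 / norm x) *\<^sub>R v + (- (inverse (norm x) * ((sgn x \<bullet> v) * inverse (norm x)))) *\<^sub>R x)) (at x)"
    unfolding inverse_eq_divide[symmetric]
  proof -
    have i: "((\<lambda>x. inverse (norm x)) has_derivative (\<lambda>v. - (inverse (norm x) * (sgn x \<bullet> v) * inverse (norm x)))) (at x)"
      by (rule Deriv.has_derivative_inverse[OF _ norm_der]) (use assms in simp)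
    have "((\<lambda>x. inverse (norm x) *\<^sub>R x) has_derivative
        (\<lambda>v. inverse (norm x) *\<^sub>R v + (- (inverse (norm x) * (sgn x \<bullet> v) * inverse (norm x))) *\<^sub>R x)) (at x)"
      by (rule bounded_bilinear.FDERIV[OF bounded_bilinear_scaleR i has_derivative_ident])
    then show "((\<lambda>x. inverse (norm x) *\<^sub>R x) has_derivative
        (\<lambda>v. inverse (norm x) *\<^sub>R v + (- (inverse (norm x) * ((sgn x \<bullet> v) * inverse (norm x)))) *\<^sub>R x)) (at x)"
      by (simp only: mult.assoc)
  qed
  have 2: "(1 / norm x) *\<^sub>R v + (- (inverse (norm x) * ((sgn x \<bullet> v) * inverse (norm x)))) *\<^sub>R x
      = ((rot x \<bullet> v) / norm x ^ 3) *\<^sub>R rot x" for v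
  proof -
    have n: "norm x \<noteq> 0" "x \<bullet> x = norm x ^ 2" using assms by (auto simp: power2_norm_eq_inner)
    have "(norm x ^ 3) *\<^sub>R ((1 / norm x) *\<^sub>R v + (- (inverse (norm x) * ((sgn x \<bullet> v) * inverse (norm x)))) *\<^sub>R x)
        = (x \<bullet> x) *\<^sub>R v - (x \<bullet> v) *\<^sub>R x"
      using n by (simp add: scaleR_add_right sgn_div_norm power3_eq_cube power2_eq_square field_simps)
    also have "\<dots> = (rot x \<bullet> v) *\<^sub>R rot x" unfolding real2_decomposition by simp
    finally have "(1 / norm x ^ 3) *\<^sub>R ((norm x ^ 3) *\<^sub>R ((1 / norm x) *\<^sub>R v + (- (inverse (norm x) * ((sgn x \<bullet> v) * inverse (norm x)))) *\<^sub>R x))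
        = (1 / norm x ^ 3) *\<^sub>R ((rot x \<bullet> v) *\<^sub>R rot x)" by simp
    then show ?thesis using n by simp
  qed
  show ?thesis using 1 unfolding 2 .
qed

text \<open>\<open>W\<close>, read off from the absolutely continuous \<open>A0\<close>, equals the
  signed power of the curvature almost everywhere; inverting the signed power gives a continuous
  curvature \<open>K\<close>. The normal and tangential parts of one C^1 vector identity then yield
  the last two conclusions, with \<open>- a\<close> in the role of \<open>c\<close>.\<close>

lemma Euler_Lagrange_ode:
  assumes p: "1 < p" and el: "p_elastica p \<gamma>"
  obtains \<sigma> T K \<mu> c where "continuous_on {0..1} \<sigma>" "continuous_on {0..1} K"
    "\<And>t. t \<in> {0..1} \<Longrightarrow> 0 < \<sigma> t" "\<And>t. t \<in> {0..1} \<Longrightarrow> norm (T t) = 1"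
    "\<And>t. t \<in> {0..1} \<Longrightarrow> (\<gamma> has_vector_derivative \<sigma> t *\<^sub>R T t) (at t within {0..1})"
    "\<And>t. t \<in> {0..1} \<Longrightarrow> (T has_vector_derivative (\<sigma> t * K t) *\<^sub>R rot (T t)) (at t within {0..1})"
    "\<And>t. t \<in> {0..1} \<Longrightarrow> ((\<lambda>t. spow (p - 1) (K t)) has_real_derivative \<sigma> t / p * (c \<bullet> rot (T t))) (at t within {0..1})"
    "\<And>t. t \<in> {0..1} \<Longrightarrow> (p - 1) * \<bar>K t\<bar> powr p = \<mu> + c \<bullet> T t"
proof -
  obtain V g \<mu> A0 a where V: "primitive_on {0..1} V g" and V0: "\<And>t. t \<in> {0..1} \<Longrightarrow> V t \<noteq> 0"
    and d\<gamma>: "\<And>t. t \<in> {0..1} \<Longrightarrow> (\<gamma> has_vector_derivative V t) (at t within {0..1})"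
    and A0: "primitive_on {0..1} A0 (\<lambda>t. EL_B p \<mu> V g t - a)"
    and neg: "negligible {t\<in>{0..1}. EL_A p V g t \<noteq> A0 t}"
    by (rule weak_Euler_Lagrange[OF p el], rule that)
  define N where "N = {t\<in>{0..1}. EL_A p V g t \<noteq> A0 t}"
  have N: "negligible N" using neg by (simp add: N_def)
  define \<sigma> where "\<sigma> = (\<lambda>t. norm (V t))"
  define T where "T = (\<lambda>t. (1 / norm (V t)) *\<^sub>R V t)"
  define W where "W = (\<lambda>t. (A0 t \<bullet> rot (V t)) / p)"
  define K where "K = (\<lambda>t. spow (1 / (p - 1)) (W t))"
  define k where "k = (\<lambda>t. (rot (V t) \<bullet> g t) / \<sigma> t ^ 3)"
  have contV: "continuous_on {0..1} V" using V by (rule primitive_on_continuous)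
  have contA0: "continuous_on {0..1} A0" using A0 by (rule primitive_on_continuous)
  have \<sigma>0: "0 < \<sigma> t" if "t \<in> {0..1}" for t using V0[OF that] by (simp add: \<sigma>_def)
  have VT: "V t = \<sigma> t *\<^sub>R T t" if "t \<in> {0..1}" for t using V0[OF that] by (simp add: \<sigma>_def T_def)
  have cont\<sigma>: "continuous_on {0..1} \<sigma>" unfolding \<sigma>_def by (intro continuous_intros contV)
  have controt: "continuous_on {0..1} (\<lambda>t. rot (u t))" if "continuous_on {0..1} u" for u
    using bounded_linear.continuous_on[OF bounded_linear_rot that] .
  have contW: "continuous_on {0..1} W"
    unfolding W_def using p by (intro continuous_intros contA0 controt contV) auto
  have contK: "continuous_on {0..1} K"
    unfolding K_def by (intro continuous_on_spow contW) (use p in auto)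
  have contT: "continuous_on {0..1} T"
    unfolding T_def using V0 by (intro continuous_intros contV) auto
  have normT: "norm (T t) = 1" if "t \<in> {0..1}" for t using V0[OF that] by (simp add: T_def)
  have WK: "W t = spow (p - 1) (K t)" for t
    using spow_spow[of "1 / (p - 1)" "W t"] p by (simp add: K_def)
  have inner\<sigma>: "V t \<bullet> V t = \<sigma> t ^ 2" for t by (simp add: \<sigma>_def power2_norm_eq_inner)
  have npow: "(V t \<bullet> V t) powr r = \<sigma> t powr (2 * r)" for t r
    by (simp only: \<sigma>_def norm_powr_eq_inner_powr)
  \<comment> \<open>The powers of the speed balance: \<open>1 - 3 * p\<close> from
    \<open>EL_A\<close> and 2 from the inner product with \<open>rot (V t)\<close> add up to
    \<open>- 3 * (p - 1)\<close>, exactly what turns the determinant into the curvature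
    \<open>k\<close> inside \<open>spow (p - 1)\<close>.\<close>
  have Wae: "W t = spow (p - 1) (k t)" and A0ae: "A0 t = (p * W t / \<sigma> t ^ 2) *\<^sub>R rot (V t)" if t: "t \<in> {0..1} - N" for t
  proof -
    have s: "0 < \<sigma> t" using \<sigma>0 t by auto
    have A: "A0 t = (p * spow (p - 1) (rot (V t) \<bullet> g t) * \<sigma> t powr (1 - 3 * p)) *\<^sub>R rot (V t)"
    proof -
      have "2 * ((1 - 3 * p) / 2) = 1 - 3 * p" by simp
      then have "(V t \<bullet> V t) powr ((1 - 3 * p) / 2) = \<sigma> t powr (1 - 3 * p)" using npow by metis
      then show ?thesis using t by (auto simp: N_def EL_A_def)
    qed
    have "W t = spow (p - 1) (rot (V t) \<bullet> g t) * (\<sigma> t powr (1 - 3 * p) * \<sigma> t ^ 2)"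
      using p inner\<sigma>[of t] by (simp add: W_def A)
    also have "\<sigma> t powr (1 - 3 * p) * \<sigma> t ^ 2 = \<sigma> t powr (- 3 * (p - 1))"
    proof -
      have "\<sigma> t powr (1 - 3 * p) * \<sigma> t powr 2 = \<sigma> t powr (- 3 * (p - 1))"
        by (simp only: powr_add[symmetric]) (simp add: algebra_simps)
      then show ?thesis using s by simp
    qed
    finally have W1: "W t = spow (p - 1) (rot (V t) \<bullet> g t) * \<sigma> t powr (- 3 * (p - 1))" .
    have "spow (p - 1) (k t) = spow (p - 1) (rot (V t) \<bullet> g t) / (\<sigma> t powr 3) powr (p - 1)"
      using s by (simp add: k_def spow_divide)
    also have "\<dots> = spow (p - 1) (rot (V t) \<bullet> g t) * \<sigma> t powr (- 3 * (p - 1))"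
    proof -
      have e: "- 3 * (p - 1) = - (3 * (p - 1))" by simp
      show ?thesis unfolding e by (simp only: powr_powr powr_minus divide_inverse)
    qed
    finally show "W t = spow (p - 1) (k t)" using W1 by simp
    have "p * W t / \<sigma> t ^ 2 = p * spow (p - 1) (rot (V t) \<bullet> g t) * \<sigma> t powr (1 - 3 * p)"
      using s p inner\<sigma>[of t] by (simp add: W_def A)
    then show "A0 t = (p * W t / \<sigma> t ^ 2) *\<^sub>R rot (V t)" using A by simp
  qed
  have Kae: "K t = k t" if t: "t \<in> {0..1} - N" for t
    using spow_spow[of "p - 1" "k t"] p by (simp add: K_def Wae[OF t])
  have "primitive_on {0..1} (\<lambda>t. (1 / norm (V t)) *\<^sub>R V t) (\<lambda>t. ((rot (V t) \<bullet> g t) / norm (V t) ^ 3) *\<^sub>R rot (V t))"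
  proof (rule primitive_on_chain[OF V, of "- {0}"])
    show "continuous_on (- {0}) (\<lambda>x. (rot x \<bullet> v / norm x ^ 3) *\<^sub>R rot x)" for v
      by (intro continuous_intros bounded_linear.continuous_on[OF bounded_linear_rot]) auto
  qed (use V0 has_derivative_normalize in auto)
  then have "primitive_on {0..1} T (\<lambda>t. (\<sigma> t * K t) *\<^sub>R rot (T t))"
    unfolding T_def[symmetric]
  proof (rule primitive_on_spike[OF _ N])
    fix t assume t: "t \<in> {0..1} - N"
    have s: "0 < \<sigma> t" using \<sigma>0 t by auto
    have "(\<sigma> t * K t) *\<^sub>R rot (T t) = (\<sigma> t * K t * (1 / \<sigma> t)) *\<^sub>R rot (V t)"
      by (simp add: T_def \<sigma>_def linear_cmul[OF bounded_linear.linear[OF bounded_linear_rot]])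
    then show "(\<sigma> t * K t) *\<^sub>R rot (T t) = ((rot (V t) \<bullet> g t) / norm (V t) ^ 3) *\<^sub>R rot (V t)"
      using s by (simp add: Kae[OF t] k_def \<sigma>_def)
  qed
  then have dT: "(T has_vector_derivative (\<sigma> t * K t) *\<^sub>R rot (T t)) (at t within {0..1})" if "t \<in> {0..1}" for t
    by (rule primitive_on_has_vector_derivative[OF _ _ that])
       (intro continuous_intros cont\<sigma> contK controt contT)
  have "primitive_on {0..1} (\<lambda>t. norm (V t)) (\<lambda>t. sgn (V t) \<bullet> g t)"
  proof (rule primitive_on_chain[OF V, of "- {0}"])
    show "(norm has_derivative (\<lambda>v. sgn x \<bullet> v)) (at x)" if "x \<in> - {0}" for x :: "real^2"
      using has_derivative_norm_sgn[of x] that by simp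
    show "continuous_on (- {0}) (\<lambda>x. sgn x \<bullet> v)" for v :: "real^2"
      by (intro continuous_intros) auto
  qed (use V0 in auto)
  from primitive_on_bilinear[OF bounded_bilinear_scaleR this A0]
  have Z: "primitive_on {0..1} (\<lambda>t. \<sigma> t *\<^sub>R A0 t) (\<lambda>t. \<sigma> t *\<^sub>R (EL_B p \<mu> V g t - a) + (sgn (V t) \<bullet> g t) *\<^sub>R A0 t)"
    by (simp add: \<sigma>_def)
  (* The normal field p W N equals |V| A0. Its derivative loses all terms containing the
     tangential part of g, which is merely integrable, and so is continuous. *)
  define Z' where "Z' = (\<lambda>t. \<sigma> t *\<^sub>R (((1 - 2 * p) * \<bar>K t\<bar> powr p + \<mu>) *\<^sub>R T t - a))"
  \<comment> \<open>Both sides are continuous, so the equality off \<open>N\<close> extends to all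
    of \<open>{0..1}\<close>.\<close>
  have Zeq: "\<sigma> t *\<^sub>R A0 t = (p * W t) *\<^sub>R rot (T t)" if "t \<in> {0..1}" for t
  proof (rule continuous_eq_if_negligible[OF _ _ negligible_subset[OF N] that])
    show "continuous_on {0..1} (\<lambda>t. \<sigma> t *\<^sub>R A0 t)" by (intro continuous_intros cont\<sigma> contA0)
    show "continuous_on {0..1} (\<lambda>t. (p * W t) *\<^sub>R rot (T t))" by (intro continuous_intros contW controt contT)
    have "\<sigma> t *\<^sub>R A0 t = (p * W t) *\<^sub>R rot (T t)" if t: "t \<in> {0..1} - N" for t
    proof -
      have s: "0 < \<sigma> t" "t \<in> {0..1}" using \<sigma>0 t by auto
      have "rot (V t) = \<sigma> t *\<^sub>R rot (T t)"
        using VT[OF s(2)] linear_cmul[OF bounded_linear.linear[OF bounded_linear_rot], of "\<sigma> t" "T t"] by metis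
      then show ?thesis using s by (simp add: A0ae[OF t] power2_eq_square)
    qed
    then show "{t\<in>{0..1}. \<sigma> t *\<^sub>R A0 t \<noteq> (p * W t) *\<^sub>R rot (T t)} \<subseteq> N" by auto
  qed
  have "primitive_on {0..1} (\<lambda>t. \<sigma> t *\<^sub>R A0 t) Z'"
  proof (rule primitive_on_spike[OF Z N])
    fix t assume t: "t \<in> {0..1} - N"
    have s: "0 < \<sigma> t" "t \<in> {0..1}" using \<sigma>0 t by auto
    define w where "w = p * W t / \<sigma> t ^ 2"
    define S where "S = (1 - 3 * p) * \<bar>k t\<bar> powr p + \<mu>"
    have coef: "p * spow (p - 1) (rot (V t) \<bullet> g t) * (V t \<bullet> V t) powr ((1 - 3 * p) / 2) = w"
    proof -
      have "(p * spow (p - 1) (rot (V t) \<bullet> g t) * (V t \<bullet> V t) powr ((1 - 3 * p) / 2)) *\<^sub>R rot (V t) = w *\<^sub>R rot (V t)"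
        using A0ae[OF t] t by (auto simp: N_def EL_A_def w_def)
      moreover have "rot (V t) \<noteq> 0" using V0[OF s(2)] norm_rot[of "V t"] by (metis norm_eq_zero)
      ultimately show ?thesis by (simp only: scaleR_cancel_right) blast
    qed
    have D: "\<bar>rot (V t) \<bullet> g t\<bar> = \<bar>k t\<bar> * \<sigma> t powr 3" using s by (simp add: k_def abs_divide)
    have pw: "\<bar>rot (V t) \<bullet> g t\<bar> powr p * (V t \<bullet> V t) powr ((1 - 3 * p) / 2 - 1) = \<bar>k t\<bar> powr p / \<sigma> t"
    proof -
      have "\<bar>rot (V t) \<bullet> g t\<bar> powr p = \<bar>k t\<bar> powr p * \<sigma> t powr (3 * p)"
        unfolding D by (simp add: powr_mult powr_powr)
      moreover have "(V t \<bullet> V t) powr ((1 - 3 * p) / 2 - 1) = \<sigma> t powr (- 3 * p - 1)"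
      proof -
        have "2 * ((1 - 3 * p) / 2 - 1) = - 3 * p - 1" by (simp add: field_simps)
        then show ?thesis unfolding npow by (simp only:)
      qed
      moreover have "\<sigma> t powr (3 * p) * \<sigma> t powr (- 3 * p - 1) = 1 / \<sigma> t"
        using s by (simp only: powr_add[symmetric]) (simp add: powr_minus_divide)
      ultimately show ?thesis by (simp add: field_simps)
    qed
    have pm: "(V t \<bullet> V t) powr (- 1/2) = 1 / \<sigma> t"
      unfolding npow using s by (simp add: powr_minus_divide)
    have "EL_B p \<mu> V g t = (S / \<sigma> t) *\<^sub>R V t - w *\<^sub>R rot (g t)"
    proof -
      have "\<bar>rot (V t) \<bullet> g t\<bar> powr p * (2 * ((1 - 3 * p) / 2) * (V t \<bullet> V t) powr ((1 - 3 * p) / 2 - 1)) + \<mu> * (V t \<bullet> V t) powr (- 1/2)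
          = (1 - 3 * p) * (\<bar>rot (V t) \<bullet> g t\<bar> powr p * (V t \<bullet> V t) powr ((1 - 3 * p) / 2 - 1)) + \<mu> * (V t \<bullet> V t) powr (- 1/2)"
        by simp
      also have "\<dots> = S / \<sigma> t" unfolding pw pm S_def by (simp add: add_divide_distrib)
      finally show ?thesis unfolding EL_B_def coef by (simp only:)
    qed
    then have e1: "\<sigma> t *\<^sub>R (EL_B p \<mu> V g t - a) = S *\<^sub>R V t - (\<sigma> t * w) *\<^sub>R rot (g t) - \<sigma> t *\<^sub>R a"
      using s by (simp add: scaleR_diff_right)
    have e2: "(sgn (V t) \<bullet> g t) *\<^sub>R A0 t = ((V t \<bullet> g t) / \<sigma> t * w) *\<^sub>R rot (V t)"
      unfolding A0ae[OF t] by (simp add: sgn_div_norm \<sigma>_def w_def divide_inverse)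
    have "(\<sigma> t ^ 2) *\<^sub>R rot (g t) = rot ((V t \<bullet> V t) *\<^sub>R g t)"
      unfolding inner\<sigma> by (simp add: linear_cmul[OF bounded_linear.linear[OF bounded_linear_rot]])
    also have "\<dots> = (V t \<bullet> g t) *\<^sub>R rot (V t) - (rot (V t) \<bullet> g t) *\<^sub>R V t"
      unfolding real2_decomposition[of "V t" "g t"]
      by (simp add: linear_cmul[OF bounded_linear.linear[OF bounded_linear_rot]]
          linear_add[OF bounded_linear.linear[OF bounded_linear_rot]])
    finally have r: "(w / \<sigma> t) *\<^sub>R ((\<sigma> t ^ 2) *\<^sub>R rot (g t)) = (w / \<sigma> t) *\<^sub>R ((V t \<bullet> g t) *\<^sub>R rot (V t) - (rot (V t) \<bullet> g t) *\<^sub>R V t)"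
      by simp
    \<comment> \<open>The first term is the one in \<open>e2\<close>: it carries the tangential part
      of \<open>g\<close> and cancels in the sum.\<close>
    have e3: "(\<sigma> t * w) *\<^sub>R rot (g t) = ((V t \<bullet> g t) / \<sigma> t * w) *\<^sub>R rot (V t) - (w * (rot (V t) \<bullet> g t) / \<sigma> t) *\<^sub>R V t"
    proof -
      have "w / \<sigma> t * \<sigma> t ^ 2 = \<sigma> t * w" using s by (simp add: power2_eq_square)
      then show ?thesis using r by (simp add: scaleR_diff_right mult.commute)
    qed
    have "w * (rot (V t) \<bullet> g t) / \<sigma> t = p * (W t * k t)"
      using s by (simp add: w_def k_def power2_eq_square power3_eq_cube)
    also have "W t * k t = \<bar>k t\<bar> powr p" unfolding Wae[OF t] by (rule spow_mult_self)
    finally have e4: "w * (rot (V t) \<bullet> g t) / \<sigma> t = p * \<bar>k t\<bar> powr p" .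
    have "\<sigma> t *\<^sub>R (EL_B p \<mu> V g t - a) + (sgn (V t) \<bullet> g t) *\<^sub>R A0 t = (S + p * \<bar>k t\<bar> powr p) *\<^sub>R V t - \<sigma> t *\<^sub>R a"
      unfolding e1 e2 e3 e4 by (simp add: algebra_simps)
    also have "\<dots> = Z' t"
      unfolding Z'_def Kae[OF t] VT[OF s(2)] S_def by (simp add: algebra_simps)
    finally show "Z' t = \<sigma> t *\<^sub>R (EL_B p \<mu> V g t - a) + (sgn (V t) \<bullet> g t) *\<^sub>R A0 t" ..
  qed
  moreover have "continuous_on {0..1} Z'"
  proof -
    have "continuous_on {0..1} (\<lambda>t. \<bar>K t\<bar> powr p)"
      using p by (intro continuous_on_powr' continuous_intros contK) auto
    then show ?thesis unfolding Z'_def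
      by (intro continuous_on_scaleR continuous_on_diff continuous_on_add continuous_on_mult
          continuous_on_const cont\<sigma> contT)
  qed
  ultimately have dZ0: "((\<lambda>t. \<sigma> t *\<^sub>R A0 t) has_vector_derivative Z' t) (at t within {0..1})" if "t \<in> {0..1}" for t
    by (rule primitive_on_has_vector_derivative[OF _ _ that])
  have dZ: "((\<lambda>t. (p * W t) *\<^sub>R rot (T t)) has_vector_derivative Z' t) (at t within {0..1})" if "t \<in> {0..1}" for t
    by (rule has_vector_derivative_transform[OF that _ dZ0[OF that]]) (use Zeq in auto)
  have dN: "((\<lambda>t. rot (T t)) has_vector_derivative - ((\<sigma> t * K t) *\<^sub>R T t)) (at t within {0..1})" if "t \<in> {0..1}" for t
    using bounded_linear.has_vector_derivative[OF bounded_linear_rot dT[OF that]]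
    by (simp add: linear_cmul[OF bounded_linear.linear[OF bounded_linear_rot]])
  have TT: "T t \<bullet> T t = 1" if "t \<in> {0..1}" for t using normT[OF that] by (simp add: dot_square_norm)
  \<comment> \<open>Normal component: \<open>rot (T t)\<close> is a unit vector, so pairing with it
    recovers \<open>p * W t\<close>, and the tangential terms drop out.\<close>
  have dW: "((\<lambda>t. spow (p - 1) (K t)) has_real_derivative \<sigma> t / p * (- a \<bullet> rot (T t))) (at t within {0..1})" if t: "t \<in> {0..1}" for t
  proof -
    have "((\<lambda>t. ((p * W t) *\<^sub>R rot (T t)) \<bullet> rot (T t)) has_vector_derivative
        ((p * W t) *\<^sub>R rot (T t)) \<bullet> (- ((\<sigma> t * K t) *\<^sub>R T t)) + Z' t \<bullet> rot (T t)) (at t within {0..1})"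
      by (rule bounded_bilinear.has_vector_derivative[OF bounded_bilinear_inner dZ[OF t] dN[OF t]])
    then have "((\<lambda>t. ((p * W t) *\<^sub>R rot (T t)) \<bullet> rot (T t)) has_vector_derivative \<sigma> t * (- a \<bullet> rot (T t))) (at t within {0..1})"
      by (simp add: Z'_def inner_diff_left inner_diff_right algebra_simps)
    then have "((\<lambda>t. p * W t) has_vector_derivative \<sigma> t * (- a \<bullet> rot (T t))) (at t within {0..1})"
      by (rule has_vector_derivative_transform[OF t, rotated]) (use TT in simp)
    then have "((\<lambda>t. p * W t) has_real_derivative \<sigma> t * (- a \<bullet> rot (T t))) (at t within {0..1})"
      by (simp add: has_real_derivative_iff_has_vector_derivative)
    from DERIV_cmult[OF this, of "1 / p"] show ?thesis
      using p by (simp add: WK[symmetric])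
  qed
  \<comment> \<open>Tangential component: \<open>rot (T t) \<bullet> T t\<close> is constantly 0, so
    the derivative supplied by the product rule must vanish. This is the first integral.\<close>
  have en: "(p - 1) * \<bar>K t\<bar> powr p = \<mu> + (- a) \<bullet> T t" if t: "t \<in> {0..1}" for t
  proof -
    have "((\<lambda>t. ((p * W t) *\<^sub>R rot (T t)) \<bullet> T t) has_vector_derivative
        ((p * W t) *\<^sub>R rot (T t)) \<bullet> ((\<sigma> t * K t) *\<^sub>R rot (T t)) + Z' t \<bullet> T t) (at t within {0..1})"
      by (rule bounded_bilinear.has_vector_derivative[OF bounded_bilinear_inner dZ[OF t] dT[OF t]])
    then have "((p * W t) *\<^sub>R rot (T t)) \<bullet> ((\<sigma> t * K t) *\<^sub>R rot (T t)) + Z' t \<bullet> T t = 0"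
      by (rule has_vector_derivative_zero_unique[OF _ t]) simp
    then have "\<sigma> t * (p * (W t * K t) + ((1 - 2 * p) * \<bar>K t\<bar> powr p + \<mu> - a \<bullet> T t)) = 0"
      using TT[OF t] by (simp add: Z'_def inner_diff_left algebra_simps)
    then have "p * (W t * K t) + ((1 - 2 * p) * \<bar>K t\<bar> powr p + \<mu> - a \<bullet> T t) = 0"
      using \<sigma>0[OF t] by simp
    moreover have "W t * K t = \<bar>K t\<bar> powr p" unfolding WK by (rule spow_mult_self)
    ultimately show ?thesis by (simp add: algebra_simps)
  qed
  show ?thesis
    by (rule that[OF cont\<sigma> contK \<sigma>0 normT _ dT dW en]) (use d\<gamma> VT in auto)
qed

section \<open>Closed curves\<close>

text \<open>The difference quotient of the inverse is the reciprocal of that of \<open>s\<close>.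
  Working within \<open>A\<close> covers the one-sided derivatives at endpoints.\<close>

lemma inverse_has_real_derivative_within:
  fixes s g :: "real \<Rightarrow> real"
  assumes s: "(s has_real_derivative d) (at t within A)" and d: "d \<noteq> 0"
    and g: "\<And>x. x \<in> A \<Longrightarrow> g (s x) = x" and cont: "continuous_on (s ` A) g" and t: "t \<in> A"
  shows "(g has_real_derivative 1 / d) (at (s t) within s ` A)"
proof -
  have "((\<lambda>x. (s x - s t) / (x - t)) \<longlongrightarrow> d) (at t within A)"
    using s by (simp add: has_field_derivative_iff)
  then have lim: "((\<lambda>x. inverse ((s x - s t) / (x - t))) \<longlongrightarrow> inverse d) (at t within A)"
    using d by (rule tendsto_inverse)
  have "(g \<longlongrightarrow> g (s t)) (at (s t) within s ` A)"
    using cont t by (auto simp: continuous_on_def)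
  moreover have ev: "\<forall>\<^sub>F y in at (s t) within s ` A. y \<in> s ` A \<and> y \<noteq> s t"
    unfolding eventually_at_filter by (rule always_eventually) auto
  ultimately have "filterlim g (at t within A) (at (s t) within s ` A)"
    unfolding filterlim_at using g t by (auto elim!: eventually_mono)
  from filterlim_compose[OF lim this]
  have "((\<lambda>y. inverse ((s (g y) - s t) / (g y - t))) \<longlongrightarrow> inverse d) (at (s t) within s ` A)" .
  then have "((\<lambda>y. (g y - g (s t)) / (y - s t)) \<longlongrightarrow> inverse d) (at (s t) within s ` A)"
    by (rule Lim_transform_eventually) (use ev g t in \<open>auto elim!: eventually_mono\<close>)
  then show ?thesis by (simp add: has_field_derivative_iff inverse_eq_divide)
qed

lemma strict_mono_on_if_positive_derivative:
  fixes h :: "real \<Rightarrow> real"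
  assumes "\<And>t. t \<in> {0..1} \<Longrightarrow> (h has_real_derivative h' t) (at t within {0..1})"
    and "\<And>t. t \<in> {0..1} \<Longrightarrow> 0 < h' t"
  shows "strict_mono_on {0..1} h"
proof (rule strict_mono_onI)
  fix r s :: real assume rs: "r \<in> {0..1}" "s \<in> {0..1}" "r < s"
  show "h r < h s"
  proof (rule DERIV_pos_imp_increasing_open[OF rs(3)])
    fix x assume x: "r < x" "x < s"
    then have "x \<in> interior {0..1}" and x01: "x \<in> {0..1}"
      using rs by (auto simp: interior_atLeastAtMost_real)
    then have "(h has_real_derivative h' x) (at x)"
      using assms(1)[OF x01] at_within_interior[of x "{0..1}"] by (simp only:)
    then show "\<exists>y. DERIV h x :> y \<and> y > 0" using assms(2)[of x] x rs by auto
  next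
    have "continuous_on {0..1} h"
      by (rule DERIV_continuous_on[OF assms(1)])
    then show "continuous_on {r..s} h" by (rule continuous_on_subset) (use rs in auto)
  qed
qed

lemma reparametrization_if_positive_derivative:
  fixes h :: "real \<Rightarrow> real"
  assumes d: "\<And>t. t \<in> {0..1} \<Longrightarrow> (h has_real_derivative h' t) (at t within {0..1})"
    and pos: "\<And>t. t \<in> {0..1} \<Longrightarrow> 0 < h' t" and cont: "continuous_on {0..1} h'"
    and h0: "h 0 = 0"
  shows "reparametrization (h 1) h" "0 < h 1" "bij_betw h {0..1} {0..h 1}"
proof -
  have sm: "strict_mono_on {0..1} h" by (rule strict_mono_on_if_positive_derivative[OF d pos])
  have ch: "continuous_on {0..1} h"
    by (rule DERIV_continuous_on[OF d])
  have "h ` {0..1} = {0..h 1}"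
  proof
    show "h ` {0..1} \<subseteq> {0..h 1}"
    proof clarify
      fix t :: real assume "t \<in> {0..1}"
      then show "h t \<in> {0..h 1}"
        using strict_mono_on_leD[OF sm, of 0 t] strict_mono_on_leD[OF sm, of t 1] h0 by auto
    qed
    show "{0..h 1} \<subseteq> h ` {0..1}"
    proof
      fix y assume "y \<in> {0..h 1}"
      then obtain x where "0 \<le> x" "x \<le> 1" "h x = y"
        using IVT'[of h 0 y 1] ch h0 by auto
      then show "y \<in> h ` {0..1}" by auto
    qed
  qed
  then show bij: "bij_betw h {0..1} {0..h 1}"
    using strict_mono_on_imp_inj_on[OF sm] by (simp add: bij_betw_def)
  show "0 < h 1" using strict_mono_onD[OF sm, of 0 1] h0 by simp
  show "reparametrization (h 1) h"
    unfolding reparametrization_def using bij cont d pos by (intro conjI exI[of _ h']) force+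
qed

text \<open>The arclength parametrization has velocity \<open>T\<close>, so equality of its
  one-sided end derivatives compares unit tangents; the speeds \<sigma> at the two ends may
  differ.\<close>

lemma closed_curve_endpoints:
  fixes \<gamma> T :: "real \<Rightarrow> real^2"
  assumes closed: "closed_curve \<gamma>"
    and \<sigma>: "continuous_on {0..1} \<sigma>" "\<And>t. t \<in> {0..1} \<Longrightarrow> 0 < \<sigma> t"
    and T: "\<And>t. t \<in> {0..1} \<Longrightarrow> norm (T t) = 1"
    and d\<gamma>: "\<And>t. t \<in> {0..1} \<Longrightarrow> (\<gamma> has_vector_derivative \<sigma> t *\<^sub>R T t) (at t within {0..1})"
  shows "\<gamma> 0 = \<gamma> 1" "T 0 = T 1"
proof -
  define s where "s = arclength \<gamma>"
  have nv: "norm (velocity \<gamma> t) = \<sigma> t" if "t \<in> {0..1}" for t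
    using vector_derivative_within_closed_interval[OF zero_less_one that d\<gamma>[OF that]] T[OF that] \<sigma>(2)[OF that]
    by simp
  have s_eq: "s t = integral {0..t} \<sigma>" if t: "t \<in> {0..1}" for t
  proof -
    have c: "continuous_on {0..t} \<sigma>" by (rule continuous_on_subset[OF \<sigma>(1)]) (use t in auto)
    have a: "(\<lambda>\<tau>. norm (velocity \<gamma> \<tau>)) absolutely_integrable_on {0..t}"
      by (rule absolutely_integrable_spike[OF absolutely_integrable_continuous_real[OF c] negligible_empty])
         (use nv t in auto)
    have "s t = integral {0..t} (\<lambda>\<tau>. norm (velocity \<gamma> \<tau>))"
      unfolding s_def arclength_def
      by (rule lebesgue_integral_eq_integral) (use a in \<open>auto intro: absolutely_integrable_imp_integrable\<close>)
    also have "\<dots> = integral {0..t} \<sigma>"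
      by (rule Henstock_Kurzweil_Integration.integral_cong) (use nv t in auto)
    finally show ?thesis .
  qed
  have ds: "(s has_real_derivative \<sigma> t) (at t within {0..1})" if t: "t \<in> {0..1}" for t
  proof -
    have "((\<lambda>u. integral {0..u} \<sigma>) has_vector_derivative \<sigma> t) (at t within {0..1})"
      by (rule integral_has_vector_derivative[OF \<sigma>(1) t])
    then have "(s has_vector_derivative \<sigma> t) (at t within {0..1})"
      by (rule has_vector_derivative_transform[OF t, rotated]) (use s_eq in auto)
    then show ?thesis by (simp add: has_real_derivative_iff_has_vector_derivative)
  qed
  have s0: "s 0 = 0" using s_eq[of 0] by simp
  note rep = reparametrization_if_positive_derivative[OF ds \<sigma>(2) \<sigma>(1) s0]
  define L where "L = s 1"
  define g where "g = the_inv_into {0..1} s"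
  have inj: "inj_on s {0..1}" and im: "s ` {0..1} = {0..L}"
    using rep(3) by (auto simp: bij_betw_def L_def)
  have gs: "g (s t) = t" if "t \<in> {0..1}" for t
    using the_inv_into_f_f[OF inj that] by (simp add: g_def)
  have cs: "continuous_on {0..1} s"
    by (rule DERIV_continuous_on[OF ds])
  have cg: "continuous_on (s ` {0..1}) g" using cs gs by (intro continuous_on_inv) auto
  define c where "c = arclength_param \<gamma>"
  have c: "c = \<gamma> \<circ> g" by (auto simp: c_def arclength_param_def g_def s_def fun_eq_iff)
  have dc: "vector_derivative c (at (s t) within {0..L}) = T t" if t: "t \<in> {0..1}" for t
  proof (rule vector_derivative_within_closed_interval)
    show "0 < L" using rep(2) by (simp add: L_def)
    show "s t \<in> {0..L}" using im t by blast
    have dg: "(g has_vector_derivative 1 / \<sigma> t) (at (s t) within {0..L})"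
      using inverse_has_real_derivative_within[OF ds[OF t] _ gs cg t] \<sigma>(2)[OF t]
      by (simp add: im has_real_derivative_iff_has_vector_derivative)
    have "g ` {0..L} \<subseteq> {0..1}" unfolding im[symmetric] using gs by auto
    then have "(\<gamma> has_vector_derivative \<sigma> t *\<^sub>R T t) (at (g (s t)) within g ` {0..L})"
      unfolding gs[OF t] using has_vector_derivative_within_subset[OF d\<gamma>[OF t]] by blast
    from vector_diff_chain_within[OF dg this]
    show "(c has_vector_derivative T t) (at (s t) within {0..L})"
      using \<sigma>(2)[OF t] by (simp add: c)
  qed
  have "c 0 = c L" and v: "vector_derivative c (at 0 within {0..L}) = vector_derivative c (at L within {0..L})"
    using closed by (auto simp: closed_curve_def Let_def c_def L_def s_def)
  then show "\<gamma> 0 = \<gamma> 1" using gs[of 0] gs[of 1] s0 by (simp add: c L_def)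
  show "T 0 = T 1" using v dc[of 0] dc[of 1] s0 by (simp add: L_def)
qed

section \<open>Constant curvature, and exclusion of curves that drift\<close>

lemma constant_if_vector_derivative_zero:
  fixes f :: "real \<Rightarrow> 'a::real_normed_vector"
  assumes "\<And>t. t \<in> {0..1} \<Longrightarrow> (f has_vector_derivative 0) (at t within {0..1})" "t \<in> {0..1}"
  shows "f t = f 0"
proof -
  obtain c where "\<And>x. x \<in> {0..1} \<Longrightarrow> f x = c"
    using has_vector_derivative_zero_constant[of "{0..1}" f] assms(1) by auto
  then show ?thesis using assms(2) by auto
qed

lemma constant_if_real_derivative_zero:
  fixes f :: "real \<Rightarrow> real"
  assumes "\<And>t. t \<in> {0..1} \<Longrightarrow> (f has_real_derivative 0) (at t within {0..1})" "t \<in> {0..1}"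
  shows "f t = f 0"
  by (rule constant_if_vector_derivative_zero)
     (use assms in \<open>auto simp: has_real_derivative_iff_has_vector_derivative[symmetric]\<close>)

lemma orthogonal_transformation_frame:
  fixes u v :: "real^2"
  assumes "norm u = 1" "norm v = 1" "u \<bullet> v = 0"
  shows "orthogonal_transformation (\<lambda>z :: real^2. z $ 1 *\<^sub>R u + z $ 2 *\<^sub>R v)"
  unfolding orthogonal_transformation
proof (intro conjI allI)
  show "linear (\<lambda>z :: real^2. z $ 1 *\<^sub>R u + z $ 2 *\<^sub>R v)"
    by (rule linearI) (auto simp: algebra_simps)
  fix z :: "real^2"
  have "(z $ 1 *\<^sub>R u + z $ 2 *\<^sub>R v) \<bullet> (z $ 1 *\<^sub>R u + z $ 2 *\<^sub>R v)
      = z $ 1 ^ 2 * (u \<bullet> u) + z $ 2 ^ 2 * (v \<bullet> v) + 2 * (z $ 1 * z $ 2) * (u \<bullet> v)"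
    by (simp add: inner_add_left inner_add_right inner_commute power2_eq_square algebra_simps)
  also have "\<dots> = z $ 1 ^ 2 + z $ 2 ^ 2" using assms by (simp add: dot_square_norm)
  also have "\<dots> = z \<bullet> z" by (simp add: inner_real2 power2_eq_square)
  finally show "norm (z $ 1 *\<^sub>R u + z $ 2 *\<^sub>R v) = norm z" by (simp add: norm_eq_sqrt_inner)
qed

text \<open>Constancy of the signed power makes the curvature a constant \<open>\<kappa>\<close>.
  For \<open>\<kappa> = 0\<close> the tangent is constant and the curve cannot return; otherwise
  outward normal and tangent rotate uniformly, and closing forces a whole number of turns.\<close>

lemma circle_case:
  fixes \<gamma> T :: "real \<Rightarrow> real^2"
  assumes p: "1 < p"
    and \<sigma>: "continuous_on {0..1} \<sigma>" "\<And>t. t \<in> {0..1} \<Longrightarrow> 0 < \<sigma> t"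
    and T: "\<And>t. t \<in> {0..1} \<Longrightarrow> norm (T t) = 1"
    and d\<gamma>: "\<And>t. t \<in> {0..1} \<Longrightarrow> (\<gamma> has_vector_derivative \<sigma> t *\<^sub>R T t) (at t within {0..1})"
    and dT: "\<And>t. t \<in> {0..1} \<Longrightarrow> (T has_vector_derivative (\<sigma> t * K t) *\<^sub>R rot (T t)) (at t within {0..1})"
    and dW: "\<And>t. t \<in> {0..1} \<Longrightarrow> ((\<lambda>t. spow (p - 1) (K t)) has_real_derivative 0) (at t within {0..1})"
    and closed: "\<gamma> 0 = \<gamma> 1" "T 0 = T 1"
  shows "\<exists>N\<ge>1. N_fold_circle N \<gamma>"
proof -
  define \<kappa> where "\<kappa> = K 0"
  have K: "K t = \<kappa>" if "t \<in> {0..1}" for t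
  proof -
    have "spow (p - 1) (K t) = spow (p - 1) (K 0)"
      by (rule constant_if_real_derivative_zero[OF dW that])
    then show ?thesis using spow_spow[of "p - 1"] p unfolding \<kappa>_def
      by (metis diff_gt_0_iff_gt less_irrefl)
  qed
  define s where "s = (\<lambda>t. integral {0..t} \<sigma>)"
  have ds: "(s has_real_derivative \<sigma> t) (at t within {0..1})" if "t \<in> {0..1}" for t
    unfolding s_def has_real_derivative_iff_has_vector_derivative
    by (rule integral_has_vector_derivative[OF \<sigma>(1) that])
  have s0: "s 0 = 0" by (simp add: s_def)
  have "\<kappa> \<noteq> 0"
  proof
    assume \<kappa>: "\<kappa> = 0"
    have Tc: "T t = T 0" if "t \<in> {0..1}" for t
      by (rule constant_if_vector_derivative_zero[OF _ that]) (use dT K \<kappa> in auto)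
    have "((\<lambda>t. \<gamma> t \<bullet> T 0) has_vector_derivative \<sigma> t) (at t within {0..1})" if t: "t \<in> {0..1}" for t
      using bounded_linear.has_vector_derivative[OF bounded_linear_inner_left d\<gamma>[OF t], of "T 0"] Tc[OF t] T[of 0]
      by (simp add: dot_square_norm)
    then have "strict_mono_on {0..1} (\<lambda>t. \<gamma> t \<bullet> T 0)"
      by (intro strict_mono_on_if_positive_derivative[of _ \<sigma>])
         (auto simp: has_real_derivative_iff_has_vector_derivative \<sigma>)
    from strict_mono_onD[OF this, of 0 1] show False using closed by simp
  qed
  define \<tau> where "\<tau> = (\<lambda>t. \<bar>\<kappa>\<bar> * s t)"
  have d\<tau>: "(\<tau> has_real_derivative \<bar>\<kappa>\<bar> * \<sigma> t) (at t within {0..1})" if "t \<in> {0..1}" for t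
    unfolding \<tau>_def by (rule DERIV_cmult[OF ds[OF that]])
  have rep: "reparametrization (\<tau> 1) \<tau>" "0 < \<tau> 1"
    by (rule reparametrization_if_positive_derivative[OF d\<tau>];
        use \<open>\<kappa> \<noteq> 0\<close> \<sigma> s0 in \<open>auto simp: \<tau>_def intro!: continuous_intros\<close>)+
  \<comment> \<open>The outward unit normal for either sign of \<open>\<kappa>\<close>. For
    clockwise curves the frame \<open>M 0\<close>, \<open>T 0\<close> is negatively oriented, and
    the similarity built from it at the end contains a reflection.\<close>
  define M where "M = (\<lambda>t. (- sgn \<kappa>) *\<^sub>R rot (T t))"
  note lin = linear_cmul[OF bounded_linear.linear[OF bounded_linear_rot]]
  have dM: "(M has_vector_derivative (\<bar>\<kappa>\<bar> * \<sigma> t) *\<^sub>R T t) (at t within {0..1})" if t: "t \<in> {0..1}" for t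
  proof -
    have "((\<lambda>t. rot (T t)) has_vector_derivative rot ((\<sigma> t * \<kappa>) *\<^sub>R rot (T t))) (at t within {0..1})"
      using bounded_linear.has_vector_derivative[OF bounded_linear_rot dT[OF t]] K[OF t] by simp
    from bounded_linear.has_vector_derivative[OF bounded_linear_scaleR_right this, of "- sgn \<kappa>"]
    show ?thesis by (simp add: M_def lin abs_sgn mult.commute mult.left_commute)
  qed
  have dT': "(T has_vector_derivative - ((\<bar>\<kappa>\<bar> * \<sigma> t) *\<^sub>R M t)) (at t within {0..1})" if t: "t \<in> {0..1}" for t
  proof -
    have "(\<sigma> t * K t) *\<^sub>R rot (T t) = - ((\<bar>\<kappa>\<bar> * \<sigma> t) *\<^sub>R M t)"
      using \<open>\<kappa> \<noteq> 0\<close> by (simp add: M_def K[OF t] abs_sgn sgn_if)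
    then show ?thesis using dT[OF t] by simp
  qed
  have dcs: "((\<lambda>t. cos (\<tau> t)) has_real_derivative - sin (\<tau> t) * (\<bar>\<kappa>\<bar> * \<sigma> t)) (at t within {0..1})"
    "((\<lambda>t. sin (\<tau> t)) has_real_derivative cos (\<tau> t) * (\<bar>\<kappa>\<bar> * \<sigma> t)) (at t within {0..1})" if t: "t \<in> {0..1}" for t
    by (rule DERIV_chain2[OF DERIV_cos d\<tau>[OF t]] DERIV_chain2[OF DERIV_sin d\<tau>[OF t]])+
  have \<tau>0: "\<tau> 0 = 0" by (simp add: \<tau>_def s0)
  \<comment> \<open>Turning the frame back by the angle \<open>\<tau>\<close> gives constant
    vectors. Solving \<open>e1\<close> and \<open>e2\<close> for \<open>M\<close> takes the place of
    a uniqueness theorem for the frame equations.\<close>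
  have e1: "cos (\<tau> t) *\<^sub>R M t - sin (\<tau> t) *\<^sub>R T t = M 0" if t: "t \<in> {0..1}" for t
  proof -
    have "((\<lambda>t. cos (\<tau> t) *\<^sub>R M t - sin (\<tau> t) *\<^sub>R T t) has_vector_derivative 0) (at t within {0..1})" if t: "t \<in> {0..1}" for t
    proof -
      have "((\<lambda>t. cos (\<tau> t) *\<^sub>R M t - sin (\<tau> t) *\<^sub>R T t) has_vector_derivative
          (cos (\<tau> t) *\<^sub>R ((\<bar>\<kappa>\<bar> * \<sigma> t) *\<^sub>R T t) + (- sin (\<tau> t) * (\<bar>\<kappa>\<bar> * \<sigma> t)) *\<^sub>R M t)
          - (sin (\<tau> t) *\<^sub>R (- ((\<bar>\<kappa>\<bar> * \<sigma> t) *\<^sub>R M t)) + (cos (\<tau> t) * (\<bar>\<kappa>\<bar> * \<sigma> t)) *\<^sub>R T t)) (at t within {0..1})"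
        by (intro has_vector_derivative_diff has_vector_derivative_scaleR dcs dM dT' t)
      then show ?thesis by (simp add: algebra_simps)
    qed
    from constant_if_vector_derivative_zero[OF this t] show ?thesis by (simp add: \<tau>0)
  qed
  have e2: "sin (\<tau> t) *\<^sub>R M t + cos (\<tau> t) *\<^sub>R T t = T 0" if t: "t \<in> {0..1}" for t
  proof -
    have "((\<lambda>t. sin (\<tau> t) *\<^sub>R M t + cos (\<tau> t) *\<^sub>R T t) has_vector_derivative 0) (at t within {0..1})" if t: "t \<in> {0..1}" for t
    proof -
      have "((\<lambda>t. sin (\<tau> t) *\<^sub>R M t + cos (\<tau> t) *\<^sub>R T t) has_vector_derivative
          (sin (\<tau> t) *\<^sub>R ((\<bar>\<kappa>\<bar> * \<sigma> t) *\<^sub>R T t) + (cos (\<tau> t) * (\<bar>\<kappa>\<bar> * \<sigma> t)) *\<^sub>R M t)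
          + (cos (\<tau> t) *\<^sub>R (- ((\<bar>\<kappa>\<bar> * \<sigma> t) *\<^sub>R M t)) + (- sin (\<tau> t) * (\<bar>\<kappa>\<bar> * \<sigma> t)) *\<^sub>R T t)) (at t within {0..1})"
        by (intro has_vector_derivative_add has_vector_derivative_scaleR dcs dM dT' t)
      then show ?thesis by (simp add: algebra_simps)
    qed
    from constant_if_vector_derivative_zero[OF this t] show ?thesis by (simp add: \<tau>0)
  qed
  have M: "M t = cos (\<tau> t) *\<^sub>R M 0 + sin (\<tau> t) *\<^sub>R T 0" if t: "t \<in> {0..1}" for t
  proof -
    have "cos (\<tau> t) *\<^sub>R M 0 + sin (\<tau> t) *\<^sub>R T 0 = (cos (\<tau> t) * cos (\<tau> t) + sin (\<tau> t) * sin (\<tau> t)) *\<^sub>R M t"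
      unfolding e1[OF t, symmetric] e2[OF t, symmetric]
      by (simp add: scaleR_add_left scaleR_add_right scaleR_diff_right mult.commute)
         (simp only: scaleR_add_left[symmetric] sin_cos_squared_add3 scaleR_one)
    then show ?thesis by (simp only: sin_cos_squared_add3 scaleR_one)
  qed
  \<comment> \<open>The difference is the centre of the circle.\<close>
  have d\<gamma>0: "((\<lambda>t. \<gamma> t - (1 / \<bar>\<kappa>\<bar>) *\<^sub>R M t) has_vector_derivative 0) (at t within {0..1})" if t: "t \<in> {0..1}" for t
  proof -
    have "((\<lambda>t. \<gamma> t - (1 / \<bar>\<kappa>\<bar>) *\<^sub>R M t) has_vector_derivative
        \<sigma> t *\<^sub>R T t - (1 / \<bar>\<kappa>\<bar>) *\<^sub>R ((\<bar>\<kappa>\<bar> * \<sigma> t) *\<^sub>R T t)) (at t within {0..1})"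
      by (intro has_vector_derivative_diff d\<gamma> t
          bounded_linear.has_vector_derivative[OF bounded_linear_scaleR_right] dM)
    then show ?thesis using \<open>\<kappa> \<noteq> 0\<close> by simp
  qed
  define b where "b = \<gamma> 0 - (1 / \<bar>\<kappa>\<bar>) *\<^sub>R M 0"
  have \<gamma>: "\<gamma> t = b + (1 / \<bar>\<kappa>\<bar>) *\<^sub>R M t" if t: "t \<in> {0..1}" for t
    using constant_if_vector_derivative_zero[OF d\<gamma>0 t] by (simp add: b_def algebra_simps)
  have n0: "norm (M 0) = 1" "norm (T 0) = 1" "M 0 \<bullet> T 0 = 0"
    using T[of 0] \<open>\<kappa> \<noteq> 0\<close> by (auto simp: M_def abs_sgn_eq)
  have "M 1 = M 0" using closed by (simp add: M_def)
  then have "M 0 \<bullet> M 0 = cos (\<tau> 1) * (M 0 \<bullet> M 0)"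
    using M[of 1] n0(3) by (metis (no_types, lifting) add.right_neutral atLeastAtMost_iff inner_add_right
        inner_commute inner_scaleR_left inner_scaleR_right mult_zero_right order_refl zero_le_one)
  then have "cos (\<tau> 1) = 1" using n0(1) by (simp add: dot_square_norm)
  then obtain n :: int where n: "\<tau> 1 = of_int n * 2 * pi" using cos_one_2pi_int by blast
  have "0 < n" using rep(2) unfolding n by (simp add: zero_less_mult_iff)
  define N where "N = nat n"
  have N: "1 \<le> N" "real N = of_int n" using \<open>0 < n\<close> by (auto simp: N_def)
  define Q where "Q = (\<lambda>z :: real^2. z $ 1 *\<^sub>R M 0 + z $ 2 *\<^sub>R T 0)"
  have "represented_by (\<lambda>s. vector [cos s, sin s]) (2 * real N * pi) \<gamma>"
    unfolding represented_by_def
  proof (intro exI conjI ballI)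
    show "similarity (\<lambda>x. (1 / \<bar>\<kappa>\<bar>) *\<^sub>R Q x + b)"
      unfolding similarity_def using \<open>\<kappa> \<noteq> 0\<close> orthogonal_transformation_frame[OF n0]
      by (intro exI[of _ "1 / \<bar>\<kappa>\<bar>"] exI[of _ Q] exI[of _ b]) (auto simp: Q_def)
    have "2 * real N * pi = \<tau> 1" using N n by simp
    then show "reparametrization (2 * real N * pi) \<tau>" using rep(1) by simp
    fix t :: real assume t: "t \<in> {0..1}"
    show "\<gamma> t = (1 / \<bar>\<kappa>\<bar>) *\<^sub>R Q (vector [cos (\<tau> t + 0), sin (\<tau> t + 0)]) + b"
      using \<gamma>[OF t] M[OF t] by (simp add: Q_def)
  qed
  then show ?thesis using N(1) by (auto simp: N_fold_circle_def)
qed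

text \<open>The curves with \<open>\<mu> \<ge> l\<close> (orbitlike, borderline and flat-core) drift: \<open>X - sgn K * y / k0\<close> is
  decreasing, because \<open>\<bar>K\<bar> \<le> k0\<close> exactly when \<open>x \<le> 0\<close>.\<close>

lemma closed_implies_wavelike:
  fixes X Y x y \<sigma> K :: "real \<Rightarrow> real"
  assumes p: "1 < p" and l: "0 < l"
    and \<sigma>: "\<And>t. t \<in> {0..1} \<Longrightarrow> 0 < \<sigma> t" and contK: "continuous_on {0..1} K"
    and xy: "\<And>t. t \<in> {0..1} \<Longrightarrow> (x t)\<^sup>2 + (y t)\<^sup>2 = 1"
    and dX: "\<And>t. t \<in> {0..1} \<Longrightarrow> (X has_real_derivative \<sigma> t * x t) (at t within {0..1})"
    and dx: "\<And>t. t \<in> {0..1} \<Longrightarrow> (x has_real_derivative - (\<sigma> t * K t * y t)) (at t within {0..1})"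
    and dy: "\<And>t. t \<in> {0..1} \<Longrightarrow> (y has_real_derivative \<sigma> t * K t * x t) (at t within {0..1})"
    and en: "\<And>t. t \<in> {0..1} \<Longrightarrow> (p - 1) * \<bar>K t\<bar> powr p = \<mu> + l * x t"
    and X01: "X 0 = X 1" and K01: "K 0 = K 1" and y01: "y 0 = y 1"
  shows "- l < \<mu>" "\<mu> < l"
proof -
  have xb: "- 1 \<le> x t" "x t \<le> 1" if "t \<in> {0..1}" for t
    using xy[OF that] by (smt (verit, ccfv_SIG) power2_le_iff_abs_le zero_le_power2 one_power2 abs_le_iff)+
  have e0: "0 \<le> \<mu> + l * x t" if "t \<in> {0..1}" for t
    using en[OF that] p by (metis diff_ge_0_iff_ge less_imp_le mult_nonneg_nonneg powr_ge_zero)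
  show "- l < \<mu>"
  proof (rule ccontr)
    assume "\<not> - l < \<mu>"
    then have "0 < \<sigma> t * x t" if t: "t \<in> {0..1}" for t
    proof -
      have "l * 1 \<le> l * x t" using e0[OF t] \<open>\<not> - l < \<mu>\<close> by simp
      then have "1 \<le> x t" using l by (simp only: mult_le_cancel_left_pos)
      then show ?thesis using \<sigma>[OF t] by simp
    qed
    then have "strict_mono_on {0..1} X" by (intro strict_mono_on_if_positive_derivative[OF dX])
    from strict_mono_onD[OF this, of 0 1] show False using X01 by simp
  qed
  show "\<mu> < l"
  proof (rule ccontr)
    assume "\<not> \<mu> < l"
    then have \<mu>: "l \<le> \<mu>" "0 < \<mu>" using l by auto
    \<comment> \<open>The absolute curvature at which the first integral gives
      \<open>x t = 0\<close>.\<close>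
    define k0 where "k0 = (\<mu> / (p - 1)) powr (1 / p)"
    have k0: "0 < k0" "(p - 1) * k0 powr p = \<mu>" using \<mu> p by (auto simp: k0_def powr_powr)
    have cmp: "(p - 1) * (\<bar>K t\<bar> powr p - k0 powr p) = l * x t" if "t \<in> {0..1}" for t
      using en[OF that] k0(2) by (simp add: right_diff_distrib)
    have sgnx: "x t * (1 - \<bar>K t\<bar> / k0) \<le> 0" "x t * (1 - \<bar>K t\<bar> / k0) = 0 \<Longrightarrow> x t = 0" if t: "t \<in> {0..1}" for t
    proof -
      consider "x t < 0" | "x t = 0" | "0 < x t" by linarith
      then have "x t * (1 - \<bar>K t\<bar> / k0) < 0 \<or> x t = 0"
      proof cases
        case 1
        then have "\<bar>K t\<bar> powr p < k0 powr p" using cmp[OF t] l p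
          by (smt (verit) mult_pos_neg mult_nonneg_nonneg)
        then have "\<bar>K t\<bar> < k0" using p k0(1) by (smt (verit) powr_mono2)
        then have "0 < 1 - \<bar>K t\<bar> / k0" using k0(1) by (simp add: field_simps)
        then show ?thesis using 1 by (simp add: mult_neg_pos)
      next
        case 3
        then have "k0 powr p < \<bar>K t\<bar> powr p" using cmp[OF t] l p
          by (smt (verit) mult_pos_pos mult_nonneg_nonpos)
        then have "k0 < \<bar>K t\<bar>" using p k0(1) by (smt (verit) powr_mono2 abs_ge_zero)
        then have "1 - \<bar>K t\<bar> / k0 < 0" using k0(1) by (simp add: field_simps)
        then show ?thesis using 3 by (simp add: mult_pos_neg)
      qed simp
      then show "x t * (1 - \<bar>K t\<bar> / k0) \<le> 0" "x t * (1 - \<bar>K t\<bar> / k0) = 0 \<Longrightarrow> x t = 0" by auto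
    qed
    have dsy: "((\<lambda>t. sgn (K t) * y t) has_real_derivative \<sigma> t * \<bar>K t\<bar> * x t) (at t within {0..1})" if t: "t \<in> {0..1}" for t
    proof (cases "K t = 0")
      case False
      have "\<forall>\<^sub>F s in at t within {0..1}. dist (K s) (K t) < \<bar>K t\<bar>"
        using contK t False unfolding continuous_on_def tendsto_iff by auto
      then have ev: "\<forall>\<^sub>F s in at t within {0..1}. sgn (K t) * y s = sgn (K s) * y s"
        by eventually_elim (auto simp: dist_real_def sgn_if)
      have "((\<lambda>s. sgn (K t) * y s) has_real_derivative sgn (K t) * (\<sigma> t * K t * x t)) (at t within {0..1})"
        by (rule DERIV_cmult[OF dy[OF t]])
      then have "((\<lambda>t. sgn (K t) * y t) has_real_derivative sgn (K t) * (\<sigma> t * K t * x t)) (at t within {0..1})"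
        using has_field_derivative_cong_eventually[OF ev refl] by blast
      then show ?thesis by (simp add: abs_sgn mult.commute mult.left_commute)
    next
      \<comment> \<open>Zero curvature is possible only for \<open>\<mu> = l\<close> with the
        tangent opposite to the axis; there \<open>y\<close> and its derivative vanish, so the jump
        of \<open>sgn\<close> does no harm.\<close>
      case True
      then have "\<mu> + l * x t = 0" using en[OF t] by simp
      then have "l * x t \<le> l * (- 1)" using \<mu> by simp
      then have "x t \<le> - 1" using l by (simp only: mult_le_cancel_left_pos)
      then have "x t = - 1" using xb[OF t] by simp
      then have y0: "y t = 0" using xy[OF t] by simp
      have "((\<lambda>s. (y s - y t) / (s - t)) \<longlongrightarrow> 0) (at t within {0..1})"
        using dy[OF t] True by (simp add: has_field_derivative_iff)
      then have "((\<lambda>s. (sgn (K s) * y s - sgn (K t) * y t) / (s - t)) \<longlongrightarrow> 0) (at t within {0..1})"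
        by (rule Lim_null_comparison[rotated, OF tendsto_norm_zero])
           (auto simp: y0 abs_mult abs_divide abs_sgn_eq intro!: always_eventually divide_right_mono)
      then show ?thesis using True by (simp add: has_field_derivative_iff)
    qed
    define H where "H = (\<lambda>t. X t - sgn (K t) * y t / k0)"
    have dH: "(H has_real_derivative \<sigma> t * (x t * (1 - \<bar>K t\<bar> / k0))) (at t within {0..1})" if t: "t \<in> {0..1}" for t
    proof -
      have "(H has_real_derivative \<sigma> t * x t - \<sigma> t * \<bar>K t\<bar> * x t / k0) (at t within {0..1})"
        unfolding H_def by (intro DERIV_diff dX DERIV_cdivide dsy t)
      then show ?thesis by (simp add: algebra_simps)
    qed
    \<comment> \<open>Nonincreasing with equal end values, \<open>H\<close> is constant, so
      \<open>x\<close> vanishes identically. Then its derivative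
      \<open>- (\<sigma> t * K t * y t)\<close> would vanish too, while all three factors are
      nonzero.\<close>
    have H01: "H 0 = H 1" using X01 K01 y01 by (simp add: H_def)
    have anti: "H s \<le> H r" if rs: "r \<in> {0..1}" "s \<in> {0..1}" "r \<le> s" for r s
    proof -
      have c: "continuous_on {0..1} H"
        by (rule DERIV_continuous_on[OF dH])
      show ?thesis
      proof (rule DERIV_nonpos_imp_decreasing_open[OF rs(3)])
        fix z assume z: "r < z" "z < s"
        then have "z \<in> interior {0..1}" and z01: "z \<in> {0..1}"
          using rs by (auto simp: interior_atLeastAtMost_real)
        then have "(H has_real_derivative \<sigma> z * (x z * (1 - \<bar>K z\<bar> / k0))) (at z)"
          using dH[OF z01] at_within_interior[of z "{0..1}"] by (simp only:)
        moreover have "\<sigma> z * (x z * (1 - \<bar>K z\<bar> / k0)) \<le> 0"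
          by (rule mult_nonneg_nonpos[OF less_imp_le[OF \<sigma>[OF z01]] sgnx(1)[OF z01]])
        ultimately show "\<exists>y. DERIV H z :> y \<and> y \<le> 0" by blast
      qed (rule continuous_on_subset[OF c], use rs in auto)
    qed
    have Hc: "H t = H 0" if "t \<in> {0..1}" for t
      using anti[of 0 t] anti[of t 1] that H01 by auto
    have x0: "x t = 0" if t: "t \<in> {0..1}" for t
    proof -
      have "\<sigma> t * (x t * (1 - \<bar>K t\<bar> / k0)) = 0"
        by (rule has_vector_derivative_zero_unique[OF dH[OF t,
              unfolded has_real_derivative_iff_has_vector_derivative] t Hc])
      then show ?thesis using sgnx(2)[OF t] \<sigma>[OF t] by simp
    qed
    have "- (\<sigma> 0 * K 0 * y 0) = 0"
      by (rule has_vector_derivative_zero_unique[OF dx[of 0,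
            unfolded has_real_derivative_iff_has_vector_derivative] _ x0]) simp_all
    moreover have "y 0 \<noteq> 0" using xy[of 0] x0[of 0] by auto
    moreover have "K 0 \<noteq> 0" using en[of 0] x0[of 0] \<mu> by auto
    ultimately show False using \<sigma>[of 0] by simp
  qed
qed

section \<open>The \<open>p\<close>-elliptic integrals\<close>

text \<open>A crude Jordan inequality, enough to compare the cosine near a zero with the distance to
  that zero. Up to \<open>pi / 3\<close> the slope of the sine is at least 1/2; beyond,
  \<open>sin x\<close> is at least 2/3 while \<open>x\<close> is less than 2.\<close>

lemma sin_ge_third:
  assumes "0 \<le> x" "x \<le> pi / 2"
  shows "1 / 3 * x \<le> sin x"
proof (cases "x \<le> pi / 3")
  case True
  have "sin 0 - 0 / 2 \<le> sin x - x / 2"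
  proof (rule DERIV_nonneg_imp_nondecreasing[OF assms(1)])
    fix z assume z: "0 \<le> z" "z \<le> x"
    have "cos (pi / 3) \<le> cos z" using z True pi_gt_zero by (intro cos_monotone_0_pi_le) auto
    then have "0 \<le> cos z - 1 / 2" by (simp add: cos_60)
    moreover have "((\<lambda>x. sin x - x / 2) has_real_derivative cos z - 1 / 2) (at z)"
      by (auto intro!: derivative_eq_intros)
    ultimately show "\<exists>y. ((\<lambda>x. sin x - x / 2) has_real_derivative y) (at z) \<and> 0 \<le> y" by blast
  qed
  then show ?thesis using assms(1) by simp
next
  case False
  have "4 / 3 \<le> sqrt 3" by (rule real_le_rsqrt) (simp add: power2_eq_square)
  then have "2 / 3 \<le> sin (pi / 3)" by (simp add: sin_60)
  also have "\<dots> \<le> sin x" using False assms(2) pi_gt_zero by (intro sin_monotone_2pi_le) auto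
  finally show ?thesis using assms(2) pi_less_4 by simp
qed

text \<open>The integrands of \<open>F1\<close> and \<open>E1\<close>. For \<open>p < 2\<close> the exponent is negative: the weight is unbounded
  near the zeros of the cosine, while \<open>powr\<close> makes it vanish there.\<close>

locale cos_weight =
  fixes \<alpha> :: real and m :: "real \<Rightarrow> real"
  assumes \<alpha>: "- 1 < \<alpha>"
    and cont_m: "continuous_on UNIV m"
    and m_nonneg: "0 \<le> m t"
    and m_pos: "sin t \<noteq> 0 \<Longrightarrow> 0 < m t"
    and m_shift: "m (t + pi) = m t"
    and m_minus: "m (- t) = m t"
begin

definition w :: "real \<Rightarrow> real" where
  "w t = \<bar>cos t\<bar> powr \<alpha> * m t"

definition G :: "real \<Rightarrow> real" where
  "G x = (LBINT t=ereal 0..ereal x. w t)"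

lemma w_nonneg: "0 \<le> w t"
  by (simp add: w_def m_nonneg)

lemma w_shift: "w (t + pi) = w t"
  by (simp add: w_def m_shift)

lemma w_minus: "w (- t) = w t"
  by (simp add: w_def m_minus)

lemma w_measurable [measurable]: "w \<in> borel_measurable borel"
proof -
  have [measurable]: "m \<in> borel_measurable borel"
    using cont_m by (rule borel_measurable_continuous_onI)
  show ?thesis unfolding w_def[abs_def] by measurable
qed

lemma m_bounded:
  obtains M where "0 \<le> M" "\<And>t. t \<in> {a..b} \<Longrightarrow> m t \<le> M"
proof -
  have "compact (m ` {a..b})"
    by (intro compact_continuous_image continuous_on_subset[OF cont_m]) auto
  then have "bounded (m ` {a..b})" by (rule compact_imp_bounded)
  then obtain M where M: "\<forall>x\<in>m ` {a..b}. norm x \<le> M" by (auto simp only: bounded_iff)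
  show ?thesis
    by (rule that[of "max 0 M"]) (use M in force)+
qed

text \<open>The only zero \<open>z\<close> of the cosine lies in the middle of the interval. On the
  interval \<open>\<bar>cos t\<bar>\<close> is at least a third of \<open>\<bar>t - z\<bar>\<close>,
  so for negative \<alpha> the weight is dominated by a multiple of
  \<open>\<bar>t - z\<bar> powr \<alpha>\<close>, integrable because
  \<open>- 1 < \<alpha>\<close>.\<close>

lemma w_integrable_period: "set_integrable lborel {of_int k * pi..of_int k * pi + pi} w"
proof -
  define z where "z = of_int k * pi + pi / 2"
  obtain M where M: "0 \<le> M" "\<And>t. t \<in> {of_int k * pi..of_int k * pi + pi} \<Longrightarrow> m t \<le> M"
    using m_bounded by metis
  \<comment> \<open>A one-sided power function, later placed on both sides of \<open>z\<close>; the
    cutoff 2 exceeds half the length of the interval.\<close>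
  define f where "f = (\<lambda>u. indicator {0..2} u *\<^sub>R u powr \<alpha>)"
  have "(\<lambda>u::real. u powr \<alpha>) absolutely_integrable_on {0..2}"
    using \<alpha> by (intro nonnegative_absolutely_integrable_1 integrable_on_powr_from_0) auto
  then have "integrable lebesgue f" by (simp add: set_integrable_def f_def)
  moreover have "f \<in> borel_measurable lborel" unfolding f_def by measurable
  ultimately have f: "integrable lborel f" by (simp add: integrable_completion)
  have f1: "integrable lborel (\<lambda>t. f (- z + 1 * t))" "integrable lborel (\<lambda>t. f (z + (- 1) * t))"
    by (intro lborel_integrable_real_affine f; simp)+
  have one: "integrable lborel (\<lambda>t. indicator {of_int k * pi..of_int k * pi + pi} t *\<^sub>R (1::real))"
    by simp
  define h where "h = (\<lambda>t. M * ((1 / 3) powr \<alpha> * (f (- z + 1 * t) + f (z + (- 1) * t))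
      + indicator {of_int k * pi..of_int k * pi + pi} t *\<^sub>R 1))"
  have h: "integrable lborel h"
    unfolding h_def by (intro integrable_mult_right Bochner_Integration.integrable_add f1 one)
  show ?thesis
    unfolding set_integrable_def
  proof (rule Bochner_Integration.integrable_bound[OF h])
    show "AE t in lborel. norm (indicator {of_int k * pi..of_int k * pi + pi} t *\<^sub>R w t) \<le> norm (h t)"
    proof (intro always_eventually allI)
      fix t
      have f0: "0 \<le> f u" for u by (simp add: f_def)
      have h0: "0 \<le> h t" unfolding h_def using M(1) by (intro mult_nonneg_nonneg add_nonneg_nonneg f0) auto
      show "norm (indicator {of_int k * pi..of_int k * pi + pi} t *\<^sub>R w t) \<le> norm (h t)"
      proof (cases "t \<in> {of_int k * pi..of_int k * pi + pi}")
        case True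
        have tz: "\<bar>t - z\<bar> \<le> pi / 2" using True unfolding z_def atLeastAtMost_iff by linarith
        have "cos t = cos (z + (t - z))" by simp
        also have "\<dots> = - sin z * sin (t - z)"
        proof -
          have "cos z = 0" unfolding z_def cos_add by (simp add: sin_times_pi_eq_0 mult.commute)
          then show ?thesis unfolding cos_add by simp
        qed
        finally have ct: "\<bar>cos t\<bar> = \<bar>sin z\<bar> * \<bar>sin (t - z)\<bar>" by (simp add: abs_mult)
        have "\<bar>sin z\<bar> = 1"
        proof -
          have "cos z = 0" unfolding z_def cos_add by (simp add: sin_times_pi_eq_0 mult.commute)
          then have "(sin z)\<^sup>2 = 1" using sin_cos_squared_add[of z] by simp
          then show ?thesis by (simp add: power2_eq_1_iff abs_if) linarith
        qed
        moreover have "\<bar>sin (t - z)\<bar> = sin \<bar>t - z\<bar>"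
        proof -
          have "\<bar>sin d\<bar> = sin \<bar>d\<bar>" if "0 \<le> sin \<bar>d\<bar>" for d :: real
            using that by (cases "d < 0") auto
          moreover have "0 \<le> sin \<bar>t - z\<bar>"
            by (intro sin_ge_zero) (use tz pi_gt_zero in linarith)+
          ultimately show ?thesis by blast
        qed
        ultimately have ct: "\<bar>cos t\<bar> = sin \<bar>t - z\<bar>" using ct by simp
        have jordan: "1 / 3 * \<bar>t - z\<bar> \<le> \<bar>cos t\<bar>"
          unfolding ct by (rule sin_ge_third) (use tz in auto)
        have "\<bar>cos t\<bar> powr \<alpha> \<le> (1 / 3) powr \<alpha> * (f (- z + 1 * t) + f (z + (- 1) * t)) + 1"
        proof (cases "0 \<le> \<alpha>")
          case True
          have "\<bar>cos t\<bar> powr \<alpha> \<le> 1" using True by (intro powr_le1) auto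
          then show ?thesis using f0 by (smt (verit) mult_nonneg_nonneg powr_ge_zero)
        next
          case False
          show ?thesis
          proof (cases "t = z")
            case True
            \<comment> \<open>At the zero itself \<open>powr\<close> returns 0.\<close>
            then show ?thesis using ct f0 by (simp add: add_nonneg_nonneg)
          next
            case False
            then have pos: "0 < 1 / 3 * \<bar>t - z\<bar>" by simp
            have "\<bar>cos t\<bar> powr \<alpha> \<le> (1 / 3 * \<bar>t - z\<bar>) powr \<alpha>"
              using jordan pos \<open>\<not> 0 \<le> \<alpha>\<close> by (intro powr_mono2') auto
            also have "\<dots> = (1 / 3) powr \<alpha> * \<bar>t - z\<bar> powr \<alpha>" by (subst powr_mult) auto
            also have "\<bar>t - z\<bar> powr \<alpha> \<le> f (- z + 1 * t) + f (z + (- 1) * t)"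
            proof -
              have "\<bar>t - z\<bar> \<le> 2" using tz pi_less_4 by linarith
              then have "\<bar>t - z\<bar> powr \<alpha> = f \<bar>t - z\<bar>" by (simp add: f_def)
              also have "\<dots> \<le> f (- z + 1 * t) + f (z + (- 1) * t)"
                using f0[of "t - z"] f0[of "z - t"] by (simp add: abs_if)
              finally show ?thesis .
            qed
            finally show ?thesis by (simp add: mult_left_mono)
          qed
        qed
        moreover have "m t \<le> M" using M(2)[OF True] .
        ultimately have "w t \<le> ((1 / 3) powr \<alpha> * (f (- z + 1 * t) + f (z + (- 1) * t)) + 1) * M"
          unfolding w_def using m_nonneg[of t] f0
          by (intro mult_mono) (auto intro!: add_nonneg_nonneg mult_nonneg_nonneg)
        then show ?thesis using True h0 w_nonneg[of t] by (simp add: h_def mult.commute)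
      qed (use h0 in simp)
    qed
  qed simp
qed

lemma w_integrable: "set_integrable lborel {a..b} w"
proof -
  define I where "I = {\<lfloor>a / pi\<rfloor>..\<lfloor>b / pi\<rfloor>}"
  have "set_integrable lborel (\<Union>k\<in>I. {of_int k * pi..of_int k * pi + pi}) w"
    by (rule set_integrable_UN) (auto simp: I_def w_integrable_period)
  moreover have "{a..b} \<subseteq> (\<Union>k\<in>I. {of_int k * pi..of_int k * pi + pi})"
  proof
    fix t assume t: "t \<in> {a..b}"
    have "of_int \<lfloor>t / pi\<rfloor> \<le> t / pi" "t / pi < of_int \<lfloor>t / pi\<rfloor> + 1" by linarith+
    then have "of_int \<lfloor>t / pi\<rfloor> * pi \<le> t / pi * pi" "t / pi * pi \<le> (of_int \<lfloor>t / pi\<rfloor> + 1) * pi"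
      by (intro mult_right_mono; simp)+
    then have "of_int \<lfloor>t / pi\<rfloor> * pi \<le> t" "t \<le> of_int \<lfloor>t / pi\<rfloor> * pi + pi"
      by (simp_all add: distrib_right)
    moreover have "\<lfloor>t / pi\<rfloor> \<in> I"
      using t by (auto simp: I_def intro!: floor_mono divide_right_mono)
    ultimately show "t \<in> (\<Union>k\<in>I. {of_int k * pi..of_int k * pi + pi})" by auto
  qed
  ultimately show ?thesis using set_integrable_subset[of lborel _ w "{a..b}"] by simp
qed

lemma w_interval_integrable: "interval_lebesgue_integrable lborel (ereal a) (ereal b) w"
proof -
  have "set_integrable lborel {a<..<b} w" for a b
    by (rule set_integrable_subset[OF w_integrable[of a b]]) auto
  then show ?thesis by (simp add: interval_lebesgue_integrable_def)
qed

lemma G_diff: "G y - G x = (LBINT t=ereal x..ereal y. w t)"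
proof -
  have "interval_lebesgue_integrable lborel (min (ereal 0) (min (ereal x) (ereal y)))
      (max (ereal 0) (max (ereal x) (ereal y))) w"
    using w_interval_integrable[of "min 0 (min x y)" "max 0 (max x y)"] by (simp only: ereal_min ereal_max)
  from interval_integral_sum[OF this] show ?thesis by (simp add: G_def)
qed

lemma G_diff_integral: "x \<le> y \<Longrightarrow> G y - G x = integral {x..y} w"
  unfolding G_diff by (rule interval_integral_eq_integral[OF _ w_integrable]) simp

lemma w_integrable_on: "w integrable_on {x..y}"
  using w_integrable by (rule set_borel_integral_eq_integral(1))

lemma G_0: "G 0 = 0"
  using G_diff_integral[of 0 0] by (simp add: G_def)

lemma G_continuous: "continuous_on UNIV G"
proof -
  have "isCont G x" for x
  proof -
    have "continuous_on {x - 1..x + 1} (\<lambda>u. G (x - 1) + integral {x - 1..u} w)"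
      by (intro continuous_intros indefinite_integral_continuous_1 w_integrable_on)
    then have "continuous_on {x - 1..x + 1} G"
    proof (rule continuous_on_eq)
      show "G (x - 1) + integral {x - 1..u} w = G u" if "u \<in> {x - 1..x + 1}" for u
        using G_diff_integral[of "x - 1" u] that by simp
    qed
    then show ?thesis
      by (rule continuous_on_interior) (simp add: interior_atLeastAtMost_real)
  qed
  then show ?thesis by (simp add: continuous_at_imp_continuous_on)
qed

lemma w_isCont: "cos x \<noteq> 0 \<Longrightarrow> isCont w x"
  unfolding w_def[abs_def] using cont_m
  by (intro continuous_intros) (auto simp: continuous_on_eq_continuous_at)

lemma G_has_derivative:
  assumes "cos x \<noteq> 0"
  shows "(G has_real_derivative w x) (at x)"
proof -
  have "((\<lambda>u. integral {x - 1..u} w) has_vector_derivative w x) (at x within {x - 1..x + 1} - {})"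
    by (rule integral_has_vector_derivative_continuous_at[OF w_integrable_on])
       (use w_isCont[OF assms] in \<open>auto intro: continuous_at_imp_continuous_within\<close>)
  then have "((\<lambda>u. integral {x - 1..u} w) has_vector_derivative w x) (at x within {x - 1<..<x + 1})"
    by (rule has_vector_derivative_within_subset) auto
  then have "((\<lambda>u. integral {x - 1..u} w) has_vector_derivative w x) (at x)"
    by (subst (asm) at_within_open) auto
  then have "((\<lambda>u. G (x - 1) + integral {x - 1..u} w) has_vector_derivative 0 + w x) (at x)"
    by (intro has_vector_derivative_add has_vector_derivative_const)
  then have "((\<lambda>u. G (x - 1) + integral {x - 1..u} w) has_vector_derivative w x) (at x)" by simp
  then have "(G has_vector_derivative w x) (at x)"
  proof (rule has_vector_derivative_transform_within_open[of _ _ _ "{x - 1<..<x + 1}"])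
    show "G (x - 1) + integral {x - 1..u} w = G u" if "u \<in> {x - 1<..<x + 1}" for u
      using G_diff_integral[of "x - 1" u] that by simp
  qed auto
  then show ?thesis by (simp add: has_real_derivative_iff_has_vector_derivative)
qed

lemma G_mono: "x \<le> y \<Longrightarrow> G x \<le> G y"
  using G_diff_integral[of x y] Henstock_Kurzweil_Integration.integral_nonneg[OF w_integrable_on, of x y]
  by (simp add: w_nonneg)

text \<open>Somewhere in the interval sine and cosine are both nonzero; there \<open>G\<close> has a
  positive derivative, so the monotone \<open>G\<close> cannot be constant.\<close>

lemma G_strict_mono:
  assumes xy: "x < y"
  shows "G x < G y"
proof -
  define v where "v = (x + y) / 2"
  have v: "x < v" "v < y" using xy by (auto simp: v_def)
  \<comment> \<open>\<open>sin (2 * u)\<close> is twice the product of sine and cosine and tests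
    both at once. If the midpoint fails, a shift by at most \<open>pi / 4\<close> succeeds.\<close>
  obtain u where u: "x < u" "u < y" "sin (2 * u) \<noteq> 0"
  proof (cases "sin (2 * v) = 0")
    case False
    then show ?thesis using that v by blast
  next
    case True
    define d where "d = min (pi / 4) ((y - v) / 2)"
    have d: "0 < d" "d \<le> pi / 4" "v + d < y" using v pi_gt_zero unfolding d_def
      by (auto simp: min_def field_simps)
    have "sin (2 * d) \<noteq> 0" using d pi_gt_zero sin_gt_zero[of "2 * d"] by auto
    moreover have "cos (2 * v) \<noteq> 0" using True sin_cos_squared_add[of "2 * v"] by auto
    moreover have "sin (2 * (v + d)) = cos (2 * v) * sin (2 * d)"
      using True by (simp add: distrib_left sin_add)
    ultimately have "sin (2 * (v + d)) \<noteq> 0" by simp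
    then show ?thesis using that[of "v + d"] v d by auto
  qed
  have "sin u \<noteq> 0" "cos u \<noteq> 0" using u(3) by (auto simp: sin_double)
  then have pos: "0 < w u" using m_pos[of u] by (simp add: w_def)
  have d: "(G has_real_derivative w u) (at u)" using \<open>cos u \<noteq> 0\<close> by (rule G_has_derivative)
  show ?thesis
  proof (rule ccontr)
    assume "\<not> G x < G y"
    then have c: "G t = G x" if "t \<in> {x<..<y}" for t
      using G_mono[of x t] G_mono[of t y] that by auto
    have "((\<lambda>_. G x) has_real_derivative 0) (at u)" by simp
    then have "(G has_real_derivative 0) (at u)"
      by (rule has_field_derivative_transform_within_open[of _ _ _ "{x<..<y}"]) (use u c in auto)
    then show False using DERIV_unique[OF d] pos by simp
  qed
qed

lemma inj_G: "inj G"
  by (rule linorder_injI) (use G_strict_mono in force)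

lemma G_shift_diff: "G (y + pi) - G (x + pi) = G y - G x"
proof -
  have *: "G (y + pi) - G (x + pi) = G y - G x" if "x \<le> y" for x y
  proof -
    have "integral {x + pi..y + pi} w = (LBINT t:{x + pi..y + pi}. w t)"
      using set_borel_integral_eq_integral(2)[OF w_integrable] by simp
    also have "\<dots> = \<bar>1\<bar> *\<^sub>R (\<integral>t. indicator {x + pi..y + pi} (pi + 1 * t) *\<^sub>R w (pi + 1 * t) \<partial>lborel)"
      unfolding set_lebesgue_integral_def by (rule lborel_integral_real_affine) simp
    also have "\<dots> = (LBINT t:{x..y}. w t)"
      unfolding set_lebesgue_integral_def
      using w_shift by (simp add: indicator_def add.commute)
    also have "\<dots> = integral {x..y} w"
      using set_borel_integral_eq_integral(2)[OF w_integrable] by simp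
    finally show ?thesis using that by (simp add: G_diff_integral)
  qed
  show ?thesis using *[of x y] *[of y x] by linarith
qed

lemma G_minus: "G (- x) = - G x"
proof -
  have "G (- x) = (LBINT t=ereal 0..ereal (- x). w t)" by (simp add: G_def)
  also have "\<dots> = (LBINT t=- ereal (- x)..- ereal 0. w (- t))" by (rule interval_integral_reflect)
  also have "\<dots> = (LBINT t=ereal x..ereal 0. w t)" by (simp add: w_minus)
  also have "\<dots> = - G x" using G_diff[of 0 x] by (simp add: G_0)
  finally show ?thesis .
qed

text \<open>The weight is even and has period \<open>pi\<close>, so every half turn of the angle
  contributes twice the complete integral.\<close>

lemma G_shift: "G (x + pi) = G x + 2 * G (pi / 2)"
proof -
  have "G pi = 2 * G (pi / 2)"
    using G_shift_diff[of 0 "- pi / 2"] G_minus[of "pi / 2"] by (simp add: G_0)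
  then show ?thesis using G_shift_diff[of x 0] by (simp add: G_0)
qed

lemma G_period: "G (x + 2 * pi * real n) = G x + 4 * real n * G (pi / 2)"
proof (induction n)
  case (Suc n)
  have "G (x + 2 * pi * real (Suc n)) = G ((x + 2 * pi * real n + pi) + pi)" by (simp add: algebra_simps)
  then show ?case using Suc by (simp only: G_shift) (simp add: algebra_simps)
qed simp

lemma G_half_pi_pos: "0 < G (pi / 2)"
  using G_strict_mono[of 0 "pi / 2"] by (simp add: G_0)

end

section \<open>\<open>F1\<close> and \<open>E1\<close> as weighted primitives, and the figure-eight
  modulus\<close>

lemma one_minus_q_sin_pos:
  fixes q t :: real
  assumes "0 \<le> q" "q < 1"
  shows "0 < 1 - q\<^sup>2 * (sin t)\<^sup>2"
proof -
  have "q\<^sup>2 * (sin t)\<^sup>2 \<le> q\<^sup>2 * 1" by (intro mult_left_mono) (auto simp: abs_square_le_1)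
  moreover have "q\<^sup>2 < 1" using assms by (simp add: abs_square_less_1)
  ultimately show ?thesis by simp
qed

lemma cos_weight_F1:
  assumes "1 < p" "0 \<le> q" "q < 1"
  shows "cos_weight (1 - 2 / p) (\<lambda>t. 1 / sqrt (1 - q\<^sup>2 * (sin t)\<^sup>2))"
  using assms one_minus_q_sin_pos[OF assms(2,3)]
  by unfold_locales (auto simp: field_simps less_imp_le less_imp_neq[symmetric] intro!: continuous_intros)

lemma cos_weight_E1:
  assumes "1 < p" "0 \<le> q" "q < 1"
  shows "cos_weight (1 - 2 / p) (\<lambda>t. sqrt (1 - q\<^sup>2 * (sin t)\<^sup>2))"
  using assms one_minus_q_sin_pos[OF assms(2,3)]
  by unfold_locales (auto simp: field_simps less_imp_le less_imp_neq[symmetric] intro!: continuous_intros)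

lemma F1_eq_G:
  assumes "1 < p" "0 \<le> q" "q < 1"
  shows "F1 p x q = cos_weight.G (1 - 2 / p) (\<lambda>t. 1 / sqrt (1 - q\<^sup>2 * (sin t)\<^sup>2)) x"
  unfolding F1_def cos_weight.G_def[OF cos_weight_F1[OF assms]] cos_weight.w_def[OF cos_weight_F1[OF assms]] by simp

lemma E1_eq_G:
  assumes "1 < p" "0 \<le> q" "q < 1"
  shows "E1 p x q = cos_weight.G (1 - 2 / p) (\<lambda>t. sqrt (1 - q\<^sup>2 * (sin t)\<^sup>2)) x"
  unfolding E1_def cos_weight.G_def[OF cos_weight_E1[OF assms]] cos_weight.w_def[OF cos_weight_E1[OF assms]]
  by (simp add: mult.commute)

text \<open>The difference of two weights is again a weight, positive away from the zeros of the sine.\<close>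

lemma cos_weight_diff_pos:
  assumes 1: "cos_weight \<alpha> m1" and 2: "cos_weight \<alpha> m2"
    and less: "\<And>t. sin t \<noteq> 0 \<Longrightarrow> m1 t < m2 t" and le: "\<And>t. m1 t \<le> m2 t"
  shows "cos_weight.G \<alpha> m1 (pi / 2) < cos_weight.G \<alpha> m2 (pi / 2)"
proof -
  interpret m1: cos_weight \<alpha> m1 by (rule 1)
  interpret m2: cos_weight \<alpha> m2 by (rule 2)
  interpret d: cos_weight \<alpha> "\<lambda>t. m2 t - m1 t"
    by unfold_locales
       (use m1.\<alpha> m1.cont_m m2.cont_m less le m1.m_shift m2.m_shift m1.m_minus m2.m_minus
         in \<open>auto intro!: continuous_intros\<close>)
  have "d.G (pi / 2) = integral {0..pi / 2} (\<lambda>t. m2.w t - m1.w t)"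
    using d.G_diff_integral[of 0 "pi / 2"]
    by (simp add: d.G_0 d.w_def[abs_def] m1.w_def m2.w_def right_diff_distrib)
  also have "\<dots> = m2.G (pi / 2) - m1.G (pi / 2)"
    using m1.G_diff_integral[of 0 "pi / 2"] m2.G_diff_integral[of 0 "pi / 2"]
    by (subst Henstock_Kurzweil_Integration.integral_diff)
       (auto simp: m1.G_0 m2.G_0 m1.w_integrable_on m2.w_integrable_on)
  finally show ?thesis using d.G_half_pi_pos by simp
qed

text \<open>As the modulus grows, \<open>E1_complete\<close> strictly decreases and
  \<open>K1_complete\<close> strictly increases, so the equation has at most one solution; a given
  root is therefore the value of \<open>THE\<close>.\<close>

lemma q_star_unique:
  assumes p: "1 < p" and q: "0 < q" "q < 1" and eq: "2 * E1_complete p q = K1_complete p q"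
  shows "q_star p = q"
proof -
  have mono: "E1_complete p r' < E1_complete p r" "K1_complete p r < K1_complete p r'"
    if r: "0 < r" "r < r'" "r' < 1" for r r'
  proof -
    have rr: "0 \<le> r" "r < 1" "0 \<le> r'" "r' < 1" using r by auto
    have sq: "r\<^sup>2 < r'\<^sup>2" using r by (simp add: power_strict_mono)
    have lt: "1 - r'\<^sup>2 * (sin t)\<^sup>2 < 1 - r\<^sup>2 * (sin t)\<^sup>2" if "sin t \<noteq> 0" for t
      using sq that by simp
    have le: "1 - r'\<^sup>2 * (sin t)\<^sup>2 \<le> 1 - r\<^sup>2 * (sin t)\<^sup>2" for t
      using sq by (simp add: mult_right_mono)
    show "E1_complete p r' < E1_complete p r"
      unfolding E1_complete_def E1_eq_G[OF p rr(1,2)] E1_eq_G[OF p rr(3,4)]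
      by (rule cos_weight_diff_pos[OF cos_weight_E1[OF p rr(3,4)] cos_weight_E1[OF p rr(1,2)]])
         (use lt le in auto)
    show "K1_complete p r < K1_complete p r'"
      unfolding K1_complete_def F1_eq_G[OF p rr(1,2)] F1_eq_G[OF p rr(3,4)]
    proof (rule cos_weight_diff_pos[OF cos_weight_F1[OF p rr(1,2)] cos_weight_F1[OF p rr(3,4)]])
      show "1 / sqrt (1 - r\<^sup>2 * (sin t)\<^sup>2) < 1 / sqrt (1 - r'\<^sup>2 * (sin t)\<^sup>2)" if "sin t \<noteq> 0" for t
        using lt[OF that] one_minus_q_sin_pos[OF rr(1,2), of t] one_minus_q_sin_pos[OF rr(3,4), of t]
        by (intro divide_strict_left_mono) auto
      show "1 / sqrt (1 - r\<^sup>2 * (sin t)\<^sup>2) \<le> 1 / sqrt (1 - r'\<^sup>2 * (sin t)\<^sup>2)" for t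
        using le[of t] one_minus_q_sin_pos[OF rr(1,2), of t] one_minus_q_sin_pos[OF rr(3,4), of t]
        by (intro divide_left_mono) auto
    qed
  qed
  have Kpos: "0 < K1_complete p r" if "0 < r" "r < 1" for r
    unfolding K1_complete_def using that
    by (subst F1_eq_G[OF p]) (auto intro!: cos_weight.G_half_pi_pos cos_weight_F1 p)
  have iff: "2 * (E1_complete p r / K1_complete p r) - 1 = 0 \<longleftrightarrow> 2 * E1_complete p r = K1_complete p r"
    if "0 < r" "r < 1" for r
    using Kpos[OF that] by (simp add: field_simps)
  show ?thesis
    unfolding q_star_def
  proof (rule the_equality)
    show "0 < q \<and> q < 1 \<and> 2 * (E1_complete p q / K1_complete p q) - 1 = 0"
      by (intro conjI q iff[OF q, THEN iffD2] eq)
    fix r assume r: "0 < r \<and> r < 1 \<and> 2 * (E1_complete p r / K1_complete p r) - 1 = 0"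
    then have er: "2 * E1_complete p r = K1_complete p r" using iff by simp
    show "r = q"
      using mono[of r q] mono[of q r] r q eq er by (cases r q rule: linorder_cases) auto
  qed
qed

section \<open>Wavelike elasticae\<close>

text \<open>An accumulation point of zeros would itself be a zero, with difference quotients equal
  to 0 arbitrarily close by, against the nonzero derivative.\<close>

lemma finite_simple_zeros:
  fixes f :: "real \<Rightarrow> real"
  assumes cont: "continuous_on {0..1} f"
    and deriv: "\<And>t. t \<in> {0..1} \<Longrightarrow> f t = 0 \<Longrightarrow> \<exists>d. d \<noteq> 0 \<and> (f has_real_derivative d) (at t within {0..1})"
  shows "finite {t\<in>{0..1}. f t = 0}"
proof (rule ccontr)
  assume inf: "infinite {t\<in>{0..1}. f t = 0}"
  have B: "\<forall>T. infinite T \<and> T \<subseteq> {0..1::real} \<longrightarrow> (\<exists>x\<in>{0..1}. x islimpt T)"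
    using compact_Icc[of 0 "1::real"] by (simp only: compact_eq_Bolzano_Weierstrass)
  have "{t\<in>{0..1}. f t = 0} \<subseteq> {0..1}" by (rule Collect_restrict)
  with inf have "\<exists>x\<in>{0..1}. x islimpt {t\<in>{0..1}. f t = 0}"
    by (intro B[THEN spec, THEN mp] conjI)
  then obtain z where z: "z \<in> {0..1}" "z islimpt {t\<in>{0..1}. f t = 0}" by blast
  have "closed {t\<in>{0..1}. f t = 0}"
    using continuous_closed_preimage_constant[OF cont closed_atLeastAtMost, of 0] by simp
  then have "z \<in> {t\<in>{0..1}. f t = 0}" using z(2) unfolding closed_limpt by blast
  then have "f z = 0" by simp
  then obtain d where d: "d \<noteq> 0" "(f has_real_derivative d) (at z within {0..1})"
    using deriv z(1) by blast
  have "((\<lambda>s. (f s - f z) / (s - z)) \<longlongrightarrow> d) (at z within {0..1})"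
    using d(2) by (simp add: has_field_derivative_iff)
  then have "\<forall>\<^sub>F s in at z within {0..1}. (f s - f z) / (s - z) \<noteq> 0"
    using d(1) by (rule tendsto_imp_eventually_ne)
  then obtain e where e: "0 < e" "\<And>s. s \<in> {0..1} \<Longrightarrow> s \<noteq> z \<Longrightarrow> dist s z < e \<Longrightarrow> (f s - f z) / (s - z) \<noteq> 0"
    unfolding eventually_at by blast
  obtain s where "s \<in> {t\<in>{0..1}. f t = 0}" "s \<noteq> z" "dist s z < e"
    using z(2) e(1) unfolding islimpt_approachable by blast
  then show False using e(2)[of s] \<open>f z = 0\<close> by simp
qed

text \<open>\<open>C\<close> and \<open>S\<close> describe a path on the unit circle of the complex
  plane. A continuous logarithm exists along it because the interval is contractible, and its
  imaginary part is the angle.\<close>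

lemma angle_lift:
  fixes C S :: "real \<Rightarrow> real"
  assumes "continuous_on {0..1} C" "continuous_on {0..1} S"
    and one: "\<And>t. t \<in> {0..1} \<Longrightarrow> (C t)\<^sup>2 + (S t)\<^sup>2 = 1"
  obtains a where "continuous_on {0..1} a" "\<And>t. t \<in> {0..1} \<Longrightarrow> cos (a t) = C t"
    "\<And>t. t \<in> {0..1} \<Longrightarrow> sin (a t) = S t"
proof -
  define f where "f = (\<lambda>t. complex_of_real (C t) + \<i> * complex_of_real (S t))"
  have f: "Re (f t) = C t" "Im (f t) = S t" for t by (simp_all add: f_def)
  have nf: "cmod (f t) = 1" if "t \<in> {0..1}" for t
    using one[OF that] by (simp add: cmod_def f)
  have contf: "continuous_on {0..1} f" unfolding f_def by (intro continuous_intros assms)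
  have f0: "f t \<noteq> 0" if "t \<in> {0..1}" for t using nf[OF that] by auto
  obtain g where g: "continuous_on {0..1} g" "\<And>t. t \<in> {0..1} \<Longrightarrow> f t = exp (g t)"
    using continuous_logarithm_on_contractible[OF contf convex_imp_contractible[OF convex_real_interval(5)] f0]
    by blast
  show ?thesis
  proof (rule that[of "\<lambda>t. Im (g t)"])
    show "continuous_on {0..1} (\<lambda>t. Im (g t))" by (intro continuous_intros g)
    fix t :: real assume t: "t \<in> {0..1}"
    have "exp (Re (g t)) = 1" using nf[OF t] g(2)[OF t] by simp
    then show "cos (Im (g t)) = C t" "sin (Im (g t)) = S t"
      using f[of t] g(2)[OF t] by (simp_all add: Re_exp Im_exp)
  qed
qed

text \<open>Caratheodory's form of the derivative of the sine: its slope function tends to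
  \<open>cos (a t)\<close> along the continuous \<open>a\<close>, so the difference quotient of
  \<open>sin (a s)\<close> can be divided by it.\<close>

lemma angle_lift_derivative:
  fixes a :: "real \<Rightarrow> real"
  assumes cont: "continuous (at t within A) a"
    and d: "((\<lambda>s. sin (a s)) has_real_derivative d) (at t within A)" and cos: "cos (a t) \<noteq> 0"
  shows "(a has_real_derivative d / cos (a t)) (at t within A)"
proof -
  obtain g where g: "\<And>z. sin z - sin (a t) = g z * (z - a t)" "isCont g (a t)" "g (a t) = cos (a t)"
    using DERIV_sin[of "a t"] unfolding CARAT_DERIV by blast
  have "((\<lambda>s. g (a s)) \<longlongrightarrow> cos (a t)) (at t within A)"
    using continuous_within_compose3[OF g(2) cont] g(3) by (simp add: continuous_within)
  moreover from this have ev: "\<forall>\<^sub>F s in at t within A. g (a s) \<noteq> 0"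
    using cos by (rule tendsto_imp_eventually_ne)
  moreover have "((\<lambda>s. (sin (a s) - sin (a t)) / (s - t)) \<longlongrightarrow> d) (at t within A)"
    using d by (simp add: has_field_derivative_iff)
  ultimately have "((\<lambda>s. (sin (a s) - sin (a t)) / (s - t) / g (a s)) \<longlongrightarrow> d / cos (a t)) (at t within A)"
    using cos by (intro tendsto_divide)
  then have "((\<lambda>s. (a s - a t) / (s - t)) \<longlongrightarrow> d / cos (a t)) (at t within A)"
    by (rule Lim_transform_eventually) (use ev g(1) in \<open>auto elim!: eventually_mono\<close>)
  then show ?thesis by (simp add: has_field_derivative_iff)
qed

lemma spow_eq_0_iff: "spow a x = 0 \<longleftrightarrow> x = 0"
  by (auto simp: spow_def sgn_eq_0_iff)

lemma spow_minus_one: "spow (1 + b) c = \<bar>c\<bar> powr b * c"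
proof (cases "c = 0")
  case False
  have "\<bar>c\<bar> powr b * c = (\<bar>c\<bar> powr b * \<bar>c\<bar> powr 1) * sgn c" using False by (simp add: mult.assoc abs_mult_sgn)
  also have "\<dots> = spow (1 + b) c" unfolding powr_add[symmetric] by (simp add: spow_def add.commute)
  finally show ?thesis ..
qed (simp add: spow_def)

text \<open>The coordinates are recovered separately. The first uses
  \<open>2 * (1 - u\<^sup>2) - 1 = x\<close>, which makes \<open>2 E - F\<close> along the amplitude
  an affine function of \<open>X\<close>; the second uses that
  \<open>Y + p / l * spow (p - 1) (K t)\<close> is constant.\<close>

lemma wavelike_case:
  fixes X Y x y \<sigma> K :: "real \<Rightarrow> real"
  assumes p: "1 < p" and l: "- l < \<mu>" "\<mu> < l"
    and \<sigma>: "continuous_on {0..1} \<sigma>" "\<And>t. t \<in> {0..1} \<Longrightarrow> 0 < \<sigma> t" and contK: "continuous_on {0..1} K"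
    and xy: "\<And>t. t \<in> {0..1} \<Longrightarrow> (x t)\<^sup>2 + (y t)\<^sup>2 = 1"
    and dX: "\<And>t. t \<in> {0..1} \<Longrightarrow> (X has_real_derivative \<sigma> t * x t) (at t within {0..1})"
    and dY: "\<And>t. t \<in> {0..1} \<Longrightarrow> (Y has_real_derivative \<sigma> t * y t) (at t within {0..1})"
    and dx: "\<And>t. t \<in> {0..1} \<Longrightarrow> (x has_real_derivative - (\<sigma> t * K t * y t)) (at t within {0..1})"
    and dy: "\<And>t. t \<in> {0..1} \<Longrightarrow> (y has_real_derivative \<sigma> t * K t * x t) (at t within {0..1})"
    and dW: "\<And>t. t \<in> {0..1} \<Longrightarrow> ((\<lambda>t. spow (p - 1) (K t)) has_real_derivative - (\<sigma> t * l * y t / p)) (at t within {0..1})"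
    and en: "\<And>t. t \<in> {0..1} \<Longrightarrow> (p - 1) * \<bar>K t\<bar> powr p = \<mu> + l * x t"
    and closed: "X 0 = X 1" "x 0 = x 1" "y 0 = y 1" "K 0 = K 1"
  obtains N r h s0 cX cY where "1 \<le> N" "0 < r"
    "reparametrization (4 * real N * K1_complete p (q_star p)) h"
    "\<And>t. t \<in> {0..1} \<Longrightarrow> X t = r * wavelike p (q_star p) (h t + s0) $ 1 + cX"
    "\<And>t. t \<in> {0..1} \<Longrightarrow> Y t = r * wavelike p (q_star p) (h t + s0) $ 2 + cY"
proof -
  have l0: "0 < l" using l by simp
  \<comment> \<open>With \<open>u\<close> the sine of half the tangent angle,
    \<open>\<mu> + l * x = 2 * l * (q\<^sup>2 - u\<^sup>2)\<close>. So \<open>q\<close> is the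
    largest \<open>\<bar>u\<bar>\<close> that the first integral permits, and
    \<open>\<bar>\<mu>\<bar> < l\<close> puts it strictly between 0 and 1.\<close>
  define q where "q = sqrt ((\<mu> + l) / (2 * l))"
  have q2: "q\<^sup>2 = (\<mu> + l) / (2 * l)" using l l0 by (simp add: q_def)
  have q: "0 < q" "q < 1"
  proof -
    show "0 < q" using l l0 by (simp add: q_def)
    have "(\<mu> + l) / (2 * l) < 1" using l l0 by simp
    then show "q < 1" unfolding q_def by (simp only: real_sqrt_lt_1_iff)
  qed
  have lq: "2 * l * q\<^sup>2 = \<mu> + l" using l0 by (simp add: q2)
  \<comment> \<open>The value of \<open>\<bar>K\<bar>\<close> that the first integral gives for
    \<open>x = 1\<close>, hence an upper bound for \<open>\<bar>K\<bar>\<close>.\<close>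
  define \<kappa> where "\<kappa> = (2 * l * q\<^sup>2 / (p - 1)) powr (1 / p)"
  have \<kappa>: "0 < \<kappa>" "\<kappa> powr p = 2 * l * q\<^sup>2 / (p - 1)"
    using p l0 q(1) by (auto simp: \<kappa>_def powr_powr)
  \<comment> \<open>Because \<open>\<mu> < l\<close>, the tangent never points against the axis;
    half its angle stays within a right angle, with positive cosine
    \<open>\<rho> t / 2\<close>.\<close>
  have x1: "- 1 < x t" if t: "t \<in> {0..1}" for t
  proof -
    have "0 \<le> (p - 1) * \<bar>K t\<bar> powr p" using p by simp
    then have "l * (- 1) < l * x t" using en[OF t] l(2) by simp
    then show ?thesis using l0 by (simp only: mult_less_cancel_left_pos)
  qed
  have contx: "continuous_on {0..1} x" and conty: "continuous_on {0..1} y" and contX: "continuous_on {0..1} X"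
    by (rule DERIV_continuous_on[OF dx] DERIV_continuous_on[OF dy] DERIV_continuous_on[OF dX]; assumption)+
  define \<rho> where "\<rho> = (\<lambda>t. sqrt (2 * (1 + x t)))"
  have \<rho>: "0 < \<rho> t" "(\<rho> t)\<^sup>2 = 2 * (1 + x t)" if "t \<in> {0..1}" for t
    using x1[OF that] by (auto simp: \<rho>_def)
  (* u is the sine of half the angle between the tangent and the first axis. *)
  define u where "u = (\<lambda>t. y t / \<rho> t)"
  have u2: "(u t)\<^sup>2 = (1 - x t) / 2" if t: "t \<in> {0..1}" for t
  proof -
    have yx: "(y t)\<^sup>2 = (1 - x t) * (1 + x t)" using xy[OF t] by (simp add: algebra_simps power2_eq_square)
    have "1 + x t \<noteq> 0" using x1[OF t] by simp
    then show ?thesis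
      unfolding u_def power_divide \<rho>(2)[OF t] yx by (rule nonzero_mult_divide_mult_cancel_right)
  qed
  have xu: "x t = 1 - 2 * (u t)\<^sup>2" if "t \<in> {0..1}" for t using u2[OF that] by simp
  have sq: "sqrt (1 - (u t)\<^sup>2) = \<rho> t / 2" if t: "t \<in> {0..1}" for t
  proof (rule real_sqrt_unique)
    show "(\<rho> t / 2)\<^sup>2 = 1 - (u t)\<^sup>2" using \<rho>(2)[OF t] u2[OF t] by (simp add: power_divide)
  qed (use \<rho>(1)[OF t] in simp)
  have contu: "continuous_on {0..1} u"
    unfolding u_def \<rho>_def using x1 by (intro continuous_intros contx conty) force
  have du: "(u has_real_derivative \<sigma> t * K t * \<rho> t / 4) (at t within {0..1})" if t: "t \<in> {0..1}" for t
  proof -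
    have d\<rho>: "(\<rho> has_real_derivative (2 * (- (\<sigma> t * K t * y t))) * (inverse (\<rho> t) / 2)) (at t within {0..1})"
      unfolding \<rho>_def using x1[OF t] dx[OF t]
      by (auto intro!: derivative_eq_intros)
    have d1: "(u has_real_derivative (\<sigma> t * K t * x t * \<rho> t - y t * ((2 * (- (\<sigma> t * K t * y t))) * (inverse (\<rho> t) / 2))) / (\<rho> t * \<rho> t)) (at t within {0..1})"
      unfolding u_def by (rule DERIV_divide[OF dy[OF t] d\<rho>]) (use \<rho>(1)[OF t] in simp)
    have e1: "(\<sigma> t * K t * x t * \<rho> t - y t * ((2 * (- (\<sigma> t * K t * y t))) * (inverse (\<rho> t) / 2))) / (\<rho> t * \<rho> t) = \<sigma> t * K t * \<rho> t / 4"
    proof -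
      have "\<sigma> t * K t * x t * \<rho> t - y t * ((2 * (- (\<sigma> t * K t * y t))) * (inverse (\<rho> t) / 2))
          = \<sigma> t * K t * (x t * (\<rho> t)\<^sup>2 + (y t)\<^sup>2) / \<rho> t"
        using \<rho>(1)[OF t] by (simp add: field_simps power2_eq_square)
      also have "x t * (\<rho> t)\<^sup>2 + (y t)\<^sup>2 = ((\<rho> t)\<^sup>2)\<^sup>2 / 4"
        using xy[OF t] unfolding \<rho>(2)[OF t] by (simp add: power2_eq_square algebra_simps)
      finally show ?thesis using \<rho>(1)[OF t] by (simp add: field_simps power2_eq_square)
    qed
    show ?thesis using d1 unfolding e1 .
  qed
  \<comment> \<open>The exponent \<open>p / 2\<close> makes \<open>C\<^sup>2\<close> equal to
    \<open>(\<bar>K\<bar> / \<kappa>) powr p\<close>, so that the first integral becomes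
    \<open>C\<^sup>2 + S\<^sup>2 = 1\<close>.\<close>
  define C where "C = (\<lambda>t. spow (p / 2) (K t / \<kappa>))"
  define S where "S = (\<lambda>t. u t / q)"
  have contC: "continuous_on {0..1} C"
    unfolding C_def using p \<kappa>(1) by (intro continuous_on_spow continuous_intros contK) auto
  have contS: "continuous_on {0..1} S"
    unfolding S_def using q by (intro continuous_intros contu) auto
  have CS: "(C t)\<^sup>2 + (S t)\<^sup>2 = 1" if t: "t \<in> {0..1}" for t
  proof -
    have "(C t)\<^sup>2 = \<bar>C t\<bar> powr 2" by simp
    also have "\<dots> = \<bar>K t / \<kappa>\<bar> powr p" unfolding C_def abs_spow powr_powr by simp
    also have "\<dots> = \<bar>K t\<bar> powr p / \<kappa> powr p" using \<kappa>(1) by (simp add: abs_divide powr_divide)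
    finally have "(C t)\<^sup>2 = ((p - 1) * \<bar>K t\<bar> powr p) / (2 * l * q\<^sup>2)" using p by (simp add: \<kappa>(2))
    also have "(p - 1) * \<bar>K t\<bar> powr p = 2 * l * (q\<^sup>2 - (u t)\<^sup>2)"
      using en[OF t] xu[OF t] lq by (simp add: algebra_simps)
    also have "2 * l * (q\<^sup>2 - (u t)\<^sup>2) / (2 * l * q\<^sup>2) = (q\<^sup>2 - (u t)\<^sup>2) / q\<^sup>2"
      using l0 by simp
    finally show ?thesis using q(1) by (simp add: S_def power_divide diff_divide_distrib)
  qed
  obtain a where a: "continuous_on {0..1} a" "\<And>t. t \<in> {0..1} \<Longrightarrow> cos (a t) = C t"
    "\<And>t. t \<in> {0..1} \<Longrightarrow> sin (a t) = S t"
    using angle_lift[OF contC contS CS] by blast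
  (* a is the amplitude; off the zeros of K, the derivative of F.G o a is a constant
     multiple of the speed. *)
  define \<kappa>' where "\<kappa>' = \<kappa> / (2 * q)"
  have \<kappa>': "0 < \<kappa>'" using \<kappa>(1) q(1) by (simp add: \<kappa>'_def)
  have q0: "0 \<le> q" using q by simp
  note F = F1_eq_G[OF p q0 q(2)] and E = E1_eq_G[OF p q0 q(2)]
  interpret F: cos_weight "1 - 2 / p" "\<lambda>t. 1 / sqrt (1 - q\<^sup>2 * (sin t)\<^sup>2)" by (rule cos_weight_F1[OF p q0 q(2)])
  interpret E: cos_weight "1 - 2 / p" "\<lambda>t. sqrt (1 - q\<^sup>2 * (sin t)\<^sup>2)" by (rule cos_weight_E1[OF p q0 q(2)])
  have da: "(a has_real_derivative \<sigma> t * K t * \<rho> t / 4 / q / C t) (at t within {0..1})"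
    if t: "t \<in> {0..1}" and K: "K t \<noteq> 0" for t
  proof -
    have C0: "C t \<noteq> 0" using K \<kappa>(1) by (simp add: C_def spow_eq_0_iff)
    have dS: "((\<lambda>s. sin (a s)) has_real_derivative \<sigma> t * K t * \<rho> t / 4 / q) (at t within {0..1})"
    proof (rule has_field_derivative_transform_within[OF _ zero_less_one t])
      show "(S has_real_derivative \<sigma> t * K t * \<rho> t / 4 / q) (at t within {0..1})"
        unfolding S_def by (rule DERIV_cdivide[OF du[OF t]])
    qed (use a(3) in simp)
    have "continuous (at t within {0..1}) a"
      using a(1) t by (simp add: continuous_on_eq_continuous_within)
    from angle_lift_derivative[OF this dS, unfolded a(2)[OF t], OF C0] show ?thesis .
  qed
  have wE: "E.w (a t) = (1 - (u t)\<^sup>2) * F.w (a t)" and wF: "F.w (a t) = \<bar>C t\<bar> powr (1 - 2 / p) * (2 / \<rho> t)" if t: "t \<in> {0..1}" for t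
  proof -
    have qs: "q\<^sup>2 * (sin (a t))\<^sup>2 = (u t)\<^sup>2" using q by (simp add: a(3)[OF t] S_def power_divide)
    have Ew: "E.w (a t) = \<bar>C t\<bar> powr (1 - 2 / p) * (\<rho> t / 2)"
      unfolding E.w_def a(2)[OF t] qs sq[OF t] ..
    show Fw: "F.w (a t) = \<bar>C t\<bar> powr (1 - 2 / p) * (2 / \<rho> t)"
      unfolding F.w_def a(2)[OF t] qs sq[OF t] by simp
    have uu: "1 - (u t)\<^sup>2 = (\<rho> t / 2) * (\<rho> t / 2)"
      using \<rho>(2)[OF t] u2[OF t] by (simp add: power2_eq_square)
    show "E.w (a t) = (1 - (u t)\<^sup>2) * F.w (a t)"
      unfolding Ew Fw uu using \<rho>(1)[OF t] by simp
  qed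
  have dF: "((\<lambda>t. F.G (a t)) has_real_derivative \<sigma> t * \<kappa>') (at t within {0..1})"
    and dE: "((\<lambda>t. E.G (a t)) has_real_derivative (1 - (u t)\<^sup>2) * (\<sigma> t * \<kappa>')) (at t within {0..1})"
    if t: "t \<in> {0..1}" and K: "K t \<noteq> 0" for t
  proof -
    define z where "z = K t / \<kappa>"
    have z: "z \<noteq> 0" "K t = \<kappa> * z" using K \<kappa>(1) by (auto simp: z_def)
    have C0: "C t \<noteq> 0" using z(1) by (simp add: C_def z_def[symmetric] spow_eq_0_iff)
    have co: "cos (a t) \<noteq> 0" using C0 a(2)[OF t] by simp
    \<comment> \<open>The exponent in the integrand of \<open>F1\<close> is made for this
      cancellation: as powers of \<open>\<bar>z\<bar>\<close> the factors have exponents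
      \<open>p / 2 - 1\<close>, \<open>1\<close> and \<open>- p / 2\<close>.\<close>
    have "\<bar>C t\<bar> powr (1 - 2 / p) * (z / C t) = 1"
    proof -
      have "\<bar>C t\<bar> powr (1 - 2 / p) = \<bar>z\<bar> powr (p / 2 - 1)"
      proof -
        have "p / 2 * (1 - 2 / p) = p / 2 - 1" using p by (simp add: field_simps)
        then show ?thesis unfolding C_def abs_spow z_def[symmetric] powr_powr by (simp only:)
      qed
      moreover have "z / C t = \<bar>z\<bar> powr 1 / \<bar>z\<bar> powr (p / 2)"
      proof -
        have "C t = spow (p / 2) z" by (simp add: C_def z_def)
        then show ?thesis using z(1) by (auto simp: spow_def sgn_if)
      qed
      ultimately show ?thesis
        using z(1) by (simp only: powr_diff[symmetric] powr_add[symmetric]) simp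
    qed
    then have fw: "F.w (a t) * (\<sigma> t * K t * \<rho> t / 4 / q / C t) = \<sigma> t * \<kappa>'"
    proof -
      assume e: "\<bar>C t\<bar> powr (1 - 2 / p) * (z / C t) = 1"
      have "F.w (a t) * (\<sigma> t * K t * \<rho> t / 4 / q / C t)
          = (\<bar>C t\<bar> powr (1 - 2 / p) * (z / C t)) * (\<sigma> t * \<kappa>')"
        using \<rho>(1)[OF t] q(1) C0 unfolding wF[OF t] z(2) \<kappa>'_def by (simp add: field_simps)
      then show ?thesis unfolding e by simp
    qed
    show "((\<lambda>t. F.G (a t)) has_real_derivative \<sigma> t * \<kappa>') (at t within {0..1})"
      using DERIV_chain2[OF F.G_has_derivative[OF co] da[OF t K]] unfolding fw .
    have ew: "E.w (a t) * (\<sigma> t * K t * \<rho> t / 4 / q / C t) = (1 - (u t)\<^sup>2) * (\<sigma> t * \<kappa>')"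
      unfolding wE[OF t] mult.assoc[of "1 - (u t)\<^sup>2" "F.w (a t)"] fw ..
    show "((\<lambda>t. E.G (a t)) has_real_derivative (1 - (u t)\<^sup>2) * (\<sigma> t * \<kappa>')) (at t within {0..1})"
      using DERIV_chain2[OF E.G_has_derivative[OF co] da[OF t K]] unfolding ew .
  qed
  \<comment> \<open>At zeros of \<open>K\<close> the cosine of the amplitude vanishes and
    \<open>G_has_derivative\<close> fails to apply. These points are isolated because the derivative
    of \<open>spow (p - 1) (K t)\<close> is a nonzero multiple of \<open>y t\<close>, which is
    nonzero there.\<close>
  have "finite {t\<in>{0..1}. spow (p - 1) (K t) = 0}"
  proof (rule finite_simple_zeros)
    show "continuous_on {0..1} (\<lambda>t. spow (p - 1) (K t))"
      using p by (intro continuous_on_spow contK) auto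
    fix t :: real assume t: "t \<in> {0..1}" "spow (p - 1) (K t) = 0"
    then have K: "K t = 0" by (simp add: spow_eq_0_iff)
    have "y t \<noteq> 0"
    proof
      assume "y t = 0"
      then have "(x t)\<^sup>2 = 1" using xy[OF t(1)] by simp
      then have "x t = 1" using x1[OF t(1)] by (simp add: power2_eq_1_iff)
      then show False using en[OF t(1)] K l by simp
    qed
    then show "\<exists>d. d \<noteq> 0 \<and> ((\<lambda>t. spow (p - 1) (K t)) has_real_derivative d) (at t within {0..1})"
      using dW[OF t(1)] \<sigma>(2)[OF t(1)] l0 p by (intro exI[of _ "- (\<sigma> t * l * y t / p)"]) auto
  qed
  then have fin: "finite {t\<in>{0..1}. K t = 0}"
    by (simp add: spow_eq_0_iff)
  \<comment> \<open>Continuity bridges the finitely many excluded points.\<close>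
  have const: "f t = f 0"
    if contf: "continuous_on {0..1} f" and t: "t \<in> {0..1}"
      and df: "\<And>t. t \<in> {0..1} \<Longrightarrow> K t \<noteq> 0 \<Longrightarrow> (f has_real_derivative 0) (at t within {0..1})" for f :: "real \<Rightarrow> real" and t
  proof (rule has_derivative_zero_unique_strong_interval[OF fin contf refl _ t])
    fix s assume s: "s \<in> {0..1} - {t\<in>{0..1}. K t = 0}"
    then have "(f has_real_derivative 0) (at s within {0..1})" using df by auto
    then show "(f has_derivative (\<lambda>h. 0)) (at s within {0..1})"
      by (simp add: has_field_derivative_def lambda_zero)
  qed
  have contFa: "continuous_on {0..1} (\<lambda>t. F.G (a t))" and contEa: "continuous_on {0..1} (\<lambda>t. E.G (a t))"
    by (rule continuous_on_compose2[OF F.G_continuous a(1)] continuous_on_compose2[OF E.G_continuous a(1)]; simp)+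
  define h where "h = (\<lambda>t. \<kappa>' * integral {0..t} \<sigma>)"
  have dh: "(h has_real_derivative \<sigma> t * \<kappa>') (at t within {0..1})" if t: "t \<in> {0..1}" for t
  proof -
    have "((\<lambda>t. integral {0..t} \<sigma>) has_real_derivative \<sigma> t) (at t within {0..1})"
      unfolding has_real_derivative_iff_has_vector_derivative
      by (rule integral_has_vector_derivative[OF \<sigma>(1) t])
    from DERIV_cmult[OF this, of \<kappa>'] show ?thesis by (simp add: h_def mult.commute)
  qed
  have h0: "h 0 = 0" by (simp add: h_def)
  have rep: "reparametrization (h 1) h" "0 < h 1"
    by (rule reparametrization_if_positive_derivative[OF dh];
        use \<kappa>' \<sigma> h0 in \<open>auto intro!: continuous_intros\<close>)+
  define s0 where "s0 = F.G (a 0)"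
  have Fa: "F.G (a t) = h t + s0" if t: "t \<in> {0..1}" for t
  proof -
    have "F.G (a t) - h t = F.G (a 0) - h 0"
    proof (rule const[of "\<lambda>t. F.G (a t) - h t", OF _ t])
      show "continuous_on {0..1} (\<lambda>t. F.G (a t) - h t)"
        by (intro continuous_intros contFa DERIV_continuous_on[OF dh])
      show "((\<lambda>t. F.G (a t) - h t) has_real_derivative 0) (at t within {0..1})" if "t \<in> {0..1}" "K t \<noteq> 0" for t
        using DERIV_diff[OF dF[OF that] dh[OF that(1)]] by simp
    qed
    then show ?thesis using h0 by (simp add: s0_def)
  qed
  define c0 where "c0 = 2 * E.G (a 0) - F.G (a 0) - \<kappa>' * X 0"
  have EX: "2 * E.G (a t) - F.G (a t) = \<kappa>' * X t + c0" if t: "t \<in> {0..1}" for t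
  proof -
    have "2 * E.G (a t) - F.G (a t) - \<kappa>' * X t = 2 * E.G (a 0) - F.G (a 0) - \<kappa>' * X 0"
    proof (rule const[of "\<lambda>t. 2 * E.G (a t) - F.G (a t) - \<kappa>' * X t", OF _ t])
      show "continuous_on {0..1} (\<lambda>t. 2 * E.G (a t) - F.G (a t) - \<kappa>' * X t)"
        by (intro continuous_intros contFa contEa contX)
      fix t assume t: "t \<in> {0..1}" "K t \<noteq> 0"
      have "((\<lambda>t. 2 * E.G (a t) - F.G (a t) - \<kappa>' * X t) has_real_derivative
          2 * ((1 - (u t)\<^sup>2) * (\<sigma> t * \<kappa>')) - \<sigma> t * \<kappa>' - \<kappa>' * (\<sigma> t * x t)) (at t within {0..1})"
        by (intro DERIV_diff DERIV_cmult dF dE dX t)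
      then show "((\<lambda>t. 2 * E.G (a t) - F.G (a t) - \<kappa>' * X t) has_real_derivative 0) (at t within {0..1})"
        by (simp add: xu[OF t(1)] algebra_simps)
    qed
    then show ?thesis by (simp add: c0_def)
  qed
  \<comment> \<open>Closing fixes the amplitude only modulo \<open>2 * pi\<close>; the strict growth
    of \<open>F.G (a t)\<close> makes the number of turns positive.\<close>
  have "C 1 = C 0" "S 1 = S 0" using closed by (simp_all add: C_def S_def u_def \<rho>_def)
  then have "sin (a 1) = sin (a 0) \<and> cos (a 1) = cos (a 0)" using a(2,3) by simp
  then obtain n :: int where n: "a 1 = a 0 + 2 * pi * of_int n" by (auto simp: sin_cos_eq_iff)
  have "F.G (a 0) < F.G (a 1)" using Fa[of 0] Fa[of 1] rep(2) h0 by simp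
  then have "a 0 < a 1" using F.G_mono[of "a 1" "a 0"] by (meson not_le)
  then have "0 < n" using n pi_gt_zero by (simp add: zero_less_mult_iff)
  define N where "N = nat n"
  have N: "1 \<le> N" "a 1 = a 0 + 2 * pi * real N" using \<open>0 < n\<close> n by (auto simp: N_def)
  have h1: "h 1 = 4 * real N * F.G (pi / 2)"
    using Fa[of 0] Fa[of 1] h0 F.G_period[of "a 0" N] N(2) by simp
  \<comment> \<open>Since \<open>X 0 = X 1\<close>, the increments of \<open>2 * E.G\<close> and
    \<open>F.G\<close> over \<open>N\<close> full turns agree; this is the equation for the
    figure-eight modulus.\<close>
  have "2 * (4 * real N * E.G (pi / 2)) = 4 * real N * F.G (pi / 2)"
  proof -
    have "2 * E.G (a 1) - F.G (a 1) = 2 * E.G (a 0) - F.G (a 0)"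
      using EX[of 0] EX[of 1] closed(1) by simp
    moreover have "2 * e = f" if "2 * (A + e) - (B + f) = 2 * A - B" for A B e f :: real
      using that by simp
    ultimately show ?thesis unfolding N(2) F.G_period E.G_period by blast
  qed
  then have "2 * E1_complete p q = K1_complete p q"
    using N(1) by (simp add: E1_complete_def K1_complete_def F E)
  then have qs: "q_star p = q" by (rule q_star_unique[OF p q])
  have am: "am1 p (h t + s0) q = a t" if "t \<in> {0..1}" for t
    unfolding am1_def F Fa[OF that, symmetric] by (rule inv_f_f[OF F.inj_G])
  have cn: "cn_p p (h t + s0) q = K t / \<kappa>" if t: "t \<in> {0..1}" for t
  proof -
    have "cn_p p (h t + s0) q = spow (2 / p) (C t)"
      using spow_minus_one[of "2 / p - 1" "C t"] by (simp add: cn_p_def am[OF t] a(2)[OF t])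
    also have "\<dots> = K t / \<kappa>" using spow_spow[of "p / 2" "K t / \<kappa>"] p by (simp add: C_def)
    finally show ?thesis .
  qed
  define r where "r = 1 / \<kappa>'"
  define cY where "cY = Y 0 + p / l * spow (p - 1) (K 0)"
  show ?thesis
  proof (rule that[of N r h s0 "- r * c0" cY])
    show "1 \<le> N" by (rule N(1))
    show "0 < r" using \<kappa>' by (simp add: r_def)
    show "reparametrization (4 * real N * K1_complete p (q_star p)) h"
      using rep(1) h1 by (simp add: qs K1_complete_def F)
    fix t :: real assume t: "t \<in> {0..1}"
    have "wavelike p q (h t + s0) $ 1 = 2 * E.G (a t) - F.G (a t)"
      by (simp add: wavelike_def am[OF t] E Fa[OF t])
    then show "X t = r * wavelike p (q_star p) (h t + s0) $ 1 + - r * c0"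
      using \<kappa>' EX[OF t] by (simp add: qs r_def field_simps)
    have "((\<lambda>t. Y t + p / l * spow (p - 1) (K t)) has_real_derivative 0) (at t within {0..1})" if t: "t \<in> {0..1}" for t
    proof -
      have "((\<lambda>t. Y t + p / l * spow (p - 1) (K t)) has_real_derivative \<sigma> t * y t + p / l * (- (\<sigma> t * l * y t / p))) (at t within {0..1})"
        by (intro DERIV_add DERIV_cmult dY dW t)
      then show ?thesis using l0 p by simp
    qed
    from constant_if_real_derivative_zero[OF this t]
    have Yt: "Y t = cY - p / l * spow (p - 1) (K t)" by (simp add: cY_def)
    have "wavelike p q (h t + s0) $ 2 = - q * (p / (p - 1)) * (\<bar>K t / \<kappa>\<bar> powr (p - 2) * (K t / \<kappa>))"
      by (simp add: wavelike_def cn[OF t])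
    also have "\<bar>K t / \<kappa>\<bar> powr (p - 2) * (K t / \<kappa>) = spow (p - 1) (K t) / \<kappa> powr (p - 1)"
      unfolding spow_minus_one[symmetric] using spow_divide[OF \<kappa>(1), of "p - 1" "K t"] by simp
    finally have w2: "wavelike p q (h t + s0) $ 2 = - q * (p / (p - 1)) * (spow (p - 1) (K t) / \<kappa> powr (p - 1))" .
    \<comment> \<open>The scale factor \<open>r\<close> was fixed by the first coordinate; the
      definition of \<open>\<kappa>\<close> shows that the second coordinate has the same
      factor.\<close>
    have "\<kappa> powr (p - 1) * \<kappa> = 2 * l * q\<^sup>2 / (p - 1)"
      using powr_add[of \<kappa> "p - 1" 1] \<kappa> by simp
    then have "1 / \<kappa> = (\<kappa> powr (p - 1)) * (p - 1) / (2 * l * q\<^sup>2)"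
      using \<kappa>(1) p l0 q(1) by (simp add: field_simps)
    then have r: "r = (\<kappa> powr (p - 1)) * (p - 1) / (l * q)"
    proof -
      assume i: "1 / \<kappa> = (\<kappa> powr (p - 1)) * (p - 1) / (2 * l * q\<^sup>2)"
      have "r = 2 * q * (1 / \<kappa>)" by (simp add: r_def \<kappa>'_def)
      also have "\<dots> = (\<kappa> powr (p - 1)) * (p - 1) / (l * q)"
        unfolding i using q(1) l0 by (simp add: power2_eq_square)
      finally show ?thesis .
    qed
    have "r * wavelike p q (h t + s0) $ 2 = - (p / l * spow (p - 1) (K t))"
      unfolding w2 r using \<kappa>(1) p l0 q(1) by (simp add: field_simps)
    then show "Y t = r * wavelike p (q_star p) (h t + s0) $ 2 + cY"
      using Yt by (simp add: qs)
  qed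
qed

theorem theorem1p13:
  fixes p :: real and \<gamma> :: "real \<Rightarrow> real^2"
  assumes "1 < p"
    and "p_elastica p \<gamma>"
    and "closed_curve \<gamma>"
  shows "(\<exists>N\<ge>1. N_fold_circle N \<gamma>) \<or> (\<exists>N\<ge>1. N_fold_figure_eight p N \<gamma>)"
proof -
  note p = assms(1)
  obtain \<sigma> T K \<mu> c where \<sigma>: "continuous_on {0..1} \<sigma>" and contK: "continuous_on {0..1} K"
    and \<sigma>0: "\<And>t. t \<in> {0..1} \<Longrightarrow> 0 < \<sigma> t" and T: "\<And>t. t \<in> {0..1} \<Longrightarrow> norm (T t) = 1"
    and d\<gamma>: "\<And>t. t \<in> {0..1} \<Longrightarrow> (\<gamma> has_vector_derivative \<sigma> t *\<^sub>R T t) (at t within {0..1})"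
    and dT: "\<And>t. t \<in> {0..1} \<Longrightarrow> (T has_vector_derivative (\<sigma> t * K t) *\<^sub>R rot (T t)) (at t within {0..1})"
    and dW: "\<And>t. t \<in> {0..1} \<Longrightarrow> ((\<lambda>t. spow (p - 1) (K t)) has_real_derivative \<sigma> t / p * (c \<bullet> rot (T t))) (at t within {0..1})"
    and en: "\<And>t. t \<in> {0..1} \<Longrightarrow> (p - 1) * \<bar>K t\<bar> powr p = \<mu> + c \<bullet> T t"
    by (rule Euler_Lagrange_ode[OF p assms(2)], rule that)
  note closed = closed_curve_endpoints[OF assms(3) \<sigma> \<sigma>0 T d\<gamma>]
  show ?thesis
  proof (cases "c = 0")
    case True
    then have dW0: "((\<lambda>t. spow (p - 1) (K t)) has_real_derivative 0) (at t within {0..1})" if "t \<in> {0..1}" for t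
      using dW[OF that] by simp
    have "\<exists>N\<ge>1. N_fold_circle N \<gamma>"
      by (rule circle_case[OF p \<sigma> \<sigma>0 T d\<gamma> dT dW0 closed])
    then show ?thesis ..
  next
    case False
    define l where "l = norm c"
    define e where "e = (1 / l) *\<^sub>R c"
    have l: "0 < l" "c = l *\<^sub>R e" using False by (simp_all add: l_def e_def)
    have e: "norm e = 1" "e \<bullet> e = 1" using False by (simp_all add: e_def l_def dot_square_norm)
    define X where "X = (\<lambda>t. \<gamma> t \<bullet> e)"
    define Y where "Y = (\<lambda>t. \<gamma> t \<bullet> rot e)"
    define x where "x = (\<lambda>t. T t \<bullet> e)"
    define y where "y = (\<lambda>t. T t \<bullet> rot e)"
    have dot: "((\<lambda>t. f t \<bullet> v) has_real_derivative d \<bullet> v) (at t within {0..1})"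
      if "(f has_vector_derivative d) (at t within {0..1})" for f d t and v :: "real^2"
      using bounded_linear.has_vector_derivative[OF bounded_linear_inner_left that]
      by (simp add: has_real_derivative_iff_has_vector_derivative)
    have dX: "(X has_real_derivative \<sigma> t * x t) (at t within {0..1})" if "t \<in> {0..1}" for t
      using dot[OF d\<gamma>[OF that], of e] by (simp add: X_def x_def)
    have dY: "(Y has_real_derivative \<sigma> t * y t) (at t within {0..1})" if "t \<in> {0..1}" for t
      using dot[OF d\<gamma>[OF that], of "rot e"] by (simp add: Y_def y_def)
    have ry: "rot (T t) \<bullet> e = - y t" for t by (simp add: y_def inner_real2)
    have dx: "(x has_real_derivative - (\<sigma> t * K t * y t)) (at t within {0..1})" if "t \<in> {0..1}" for t
      using dot[OF dT[OF that], of e] by (simp add: x_def[symmetric] ry)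
    have dy: "(y has_real_derivative \<sigma> t * K t * x t) (at t within {0..1})" if "t \<in> {0..1}" for t
      using dot[OF dT[OF that], of "rot e"] by (simp add: y_def[symmetric] x_def)
    have dW': "((\<lambda>t. spow (p - 1) (K t)) has_real_derivative - (\<sigma> t * l * y t / p)) (at t within {0..1})" if "t \<in> {0..1}" for t
      using dW[OF that] by (simp add: l(2) inner_commute[of e] ry mult.assoc)
    have en': "(p - 1) * \<bar>K t\<bar> powr p = \<mu> + l * x t" if "t \<in> {0..1}" for t
      using en[OF that] by (simp add: l(2) x_def inner_commute)
    have decomp: "v = (v \<bullet> e) *\<^sub>R e + (v \<bullet> rot e) *\<^sub>R rot e" for v
      using real2_decomposition[of e v] e(2) by (simp add: inner_commute)
    have xy: "(x t)\<^sup>2 + (y t)\<^sup>2 = 1" if "t \<in> {0..1}" for t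
    proof -
      have "T t \<bullet> T t = (x t)\<^sup>2 + (y t)\<^sup>2"
        by (subst (2) decomp) (simp add: inner_add_right x_def y_def power2_eq_square)
      then show ?thesis using T[OF that] by (simp add: dot_square_norm)
    qed
    have cl: "X 0 = X 1" "Y 0 = Y 1" "x 0 = x 1" "y 0 = y 1"
      using closed by (simp_all add: X_def Y_def x_def y_def)
    \<comment> \<open>Closedness speaks of position and tangent only. The curvature closes up
      because \<open>Y t + p / l * spow (p - 1) (K t)\<close> is constant and the signed power is
      injective.\<close>
    have K01: "K 0 = K 1"
    proof -
      have "((\<lambda>t. Y t + p / l * spow (p - 1) (K t)) has_real_derivative 0) (at t within {0..1})" if t: "t \<in> {0..1}" for t
      proof -
        have "((\<lambda>t. Y t + p / l * spow (p - 1) (K t)) has_real_derivative \<sigma> t * y t + p / l * (- (\<sigma> t * l * y t / p))) (at t within {0..1})"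
          by (intro DERIV_add DERIV_cmult dY dW' t)
        then show ?thesis using l p by simp
      qed
      from constant_if_real_derivative_zero[OF this, of 1]
      have "p / l * spow (p - 1) (K 1) = p / l * spow (p - 1) (K 0)" using cl by simp
      then have "spow (p - 1) (K 1) = spow (p - 1) (K 0)" using p l by simp
      then show ?thesis using spow_spow[of "p - 1" "K 0"] spow_spow[of "p - 1" "K 1"] p by simp
    qed
    note \<mu> = closed_implies_wavelike[OF p l(1) \<sigma>0 contK xy dX dx dy en' cl(1) K01 cl(4)]
    obtain N r h s0 cX cY where N: "1 \<le> N" and r: "0 < r"
      and h: "reparametrization (4 * real N * K1_complete p (q_star p)) h"
      and X: "\<And>t. t \<in> {0..1} \<Longrightarrow> X t = r * wavelike p (q_star p) (h t + s0) $ 1 + cX"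
      and Y: "\<And>t. t \<in> {0..1} \<Longrightarrow> Y t = r * wavelike p (q_star p) (h t + s0) $ 2 + cY"
      by (rule wavelike_case[OF p \<mu> \<sigma> \<sigma>0 contK xy dX dY dx dy dW' en' cl(1,3,4) K01], assumption+, rule that)
    define Q where "Q = (\<lambda>z :: real^2. z $ 1 *\<^sub>R e + z $ 2 *\<^sub>R rot e)"
    define b where "b = cX *\<^sub>R e + cY *\<^sub>R rot e"
    have "represented_by (wavelike p (q_star p)) (4 * real N * K1_complete p (q_star p)) \<gamma>"
      unfolding represented_by_def
    proof (intro exI conjI ballI)
      have "orthogonal_transformation Q"
        unfolding Q_def by (rule orthogonal_transformation_frame) (use e in simp_all)
      then show "similarity (\<lambda>z. r *\<^sub>R Q z + b)"
        unfolding similarity_def using r by blast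
      show "reparametrization (4 * real N * K1_complete p (q_star p)) h" by (rule h)
      fix t :: real assume t: "t \<in> {0..1}"
      have "\<gamma> t = X t *\<^sub>R e + Y t *\<^sub>R rot e" using decomp[of "\<gamma> t"] by (simp add: X_def Y_def)
      then show "\<gamma> t = r *\<^sub>R Q (wavelike p (q_star p) (h t + s0)) + b"
        by (simp add: X[OF t] Y[OF t] Q_def b_def algebra_simps)
    qed
    then show ?thesis using N by (auto simp: N_fold_figure_eight_def)
  qed
qed

end
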